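(* The intrinsic torsion of an integrable qc $K$-structure on a $(4n+3)$-dimensional manifold is constant: $\Theta^K\equiv\Theta_0^K$.
   Context: Fix $n\ge 1$. $T=\mathbb R^{4n+3}=V\oplus W$, $V=\mathbb R^{4n}$, $W=\mathbb R^3$; $e_1,\dots,e_{4n+3}$ standard basis, $e^a$ dual basis, $e^{ab}=e^a\wedge e^b$, $w_s=e_{4n+s}$, $w^s=e^{4n+s}$. Set $\omega_1=\sum_{j=1}^n(e^{4j-3,4j-2}-e^{4j-1,4j})$, $\omega_2=\sum_{j=1}^n(e^{4j-3,4j-1}+e^{4j-2,4j})$, $\omega_3=\sum_{j=1}^n(e^{4j-3,4j}-e^{4j-2,4j-1})$, and $\Theta_0=\sum_s\omega_s\otimes w_s\in\Lambda^2T^*\otimes T$. For a Lie subgroup $G\subset\mathrm{GL}(T)$ with Lie algebra $\mathfrak g$, a $G$-structure is a reduction $P$ to $G$ of the bundle of frames $u\colon T\to T_xM$; $\partial_G\colon T^*\otimes\mathfrak g\to\Lambda^2T^*\otimes T$ is the restriction of $e^k\otimes(e^i\otimes e_j)\mapsto e^{ki}\otimes e_j$. The torsion of any connection on $P$, viewed as a map $P\to\Lambda^2T^*\otimes T$ and projected to $\mathrm{coker}\,\partial_G$, is the intrinsic torsion $\Theta^G$. $\Theta_0^G$ denotes the class of $\Theta_0$ in $\mathrm{coker}\,\partial_G$. $Q\subset\mathrm{GL}(T)$ is the stabilizer of $V$, and $B=\mathrm{Sp}(n)\mathbb H^*\ltimes\mathrm{Hom}(W,V)$ is the stabilizer in $Q$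 of $\Theta_0^Q\in\mathrm{coker}\,\partial_Q=\Lambda^2V^*\otimes T/V$; identifying $\mathbb R^{4n}=\mathbb H^n$ via $1,i,j,k$ in each factor, $(g,p)\in\mathrm{Sp}(n)\times\mathbb H^*$ acts on $V$ by $v\mapsto gvp^{-1}$ and on $W$ as the dual of the action $q\mapsto pq\bar p$ on $\mathrm{Im}\,\mathbb H\cong W^*$. Identifying $V\cong V^*$ via the standard metric, let $EH=\{\sum_s w^s\otimes(v\lrcorner\omega_s)\mid v\in V\}\subset\mathrm{Hom}(W,V)$ and $K=\mathrm{Sp}(n)\mathbb H^*\ltimes EH\subset B$. An integrable qc $K$-structure is a $K$-structure $P$ such that the intrinsic torsion $\Theta^B$ of the $B$-structure containing $P$ satisfies $\Theta^B(u)=\Theta^B_0$ for all $u\in P$. *)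

theory Defs
  imports "HOL-Analysis.Analysis"
begin

section \<open>Smooth manifolds and frames\<close>

primrec Ck_on :: "nat \<Rightarrow> 'a set \<Rightarrow> ('a::real_normed_vector \<Rightarrow> 'b::real_normed_vector) \<Rightarrow> bool" where
  "Ck_on 0 S f \<longleftrightarrow> continuous_on S f"
| "Ck_on (Suc k) S f \<longleftrightarrow> f differentiable_on S \<and> (\<forall>v. Ck_on k S (\<lambda>x. frechet_derivative f (at x) v))"

text \<open>Only used for open \<open>S\<close>, where the Frechet derivative at a point is unambiguous.\<close>

definition smooth_on :: "'a set \<Rightarrow> ('a::real_normed_vector \<Rightarrow> 'b::real_normed_vector) \<Rightarrow> bool" where
  "smooth_on S f \<longleftrightarrow> (\<forall>k. Ck_on k S f)"

text \<open>A chart is a domain together with a coordinate map (whose values off the domain are irrelevant).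
  The manifold is the whole type \<open>'m\<close>, which is required to be Hausdorff and second countable.\<close>

type_synonym ('m, 'a) chart = "'m set \<times> ('m \<Rightarrow> 'a)"

definition chart_inv :: "('m, 'a) chart \<Rightarrow> 'a \<Rightarrow> 'm" where
  "chart_inv c = inv_into (fst c) (snd c)"

definition transition :: "('m, 'a) chart \<Rightarrow> ('m, 'a) chart \<Rightarrow> 'a \<Rightarrow> 'a" where
  "transition c d = snd d \<circ> chart_inv c"

definition smooth_atlas ::
    "('m::{t2_space, second_countable_topology}, 'a::euclidean_space) chart set \<Rightarrow> bool" where
  "smooth_atlas A \<longleftrightarrow>
     (\<Union>c\<in>A. fst c) = UNIV \<and>
     (\<forall>c\<in>A. open (fst c) \<and> open (snd c ` fst c) \<and>
        homeomorphism (fst c) (snd c ` fst c) (snd c) (chart_inv c)) \<and>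
     (\<forall>c\<in>A. \<forall>d\<in>A. smooth_on (snd c ` (fst c \<inter> fst d)) (transition c d))"

definition transition_deriv :: "('m, 'a::euclidean_space) chart \<Rightarrow> ('m, 'a) chart \<Rightarrow> 'm \<Rightarrow> 'a \<Rightarrow> 'a" where
  "transition_deriv c d x = frechet_derivative (transition c d) (at (snd c x))"

definition transition_deriv2 ::
    "('m, 'a::euclidean_space) chart \<Rightarrow> ('m, 'a) chart \<Rightarrow> 'm \<Rightarrow> 'a \<Rightarrow> 'a \<Rightarrow> 'a" where
  "transition_deriv2 c d x X Y =
     frechet_derivative (\<lambda>q. frechet_derivative (transition c d) (at q) Y) (at (snd c x)) X"

text \<open>A tangent vector at \<open>x\<close> is the family of its components in the charts around \<open>x\<close>;
  the value at all other charts is normalised to \<open>0\<close>.\<close>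

definition tangent_space ::
    "('m, 'a::euclidean_space) chart set \<Rightarrow> 'm \<Rightarrow> (('m, 'a) chart \<Rightarrow> 'a) set" where
  "tangent_space A x =
     {v. (\<forall>c\<in>A. \<forall>d\<in>A. x \<in> fst c \<longrightarrow> x \<in> fst d \<longrightarrow> v d = transition_deriv c d x (v c)) \<and>
         (\<forall>c. \<not> (c \<in> A \<and> x \<in> fst c) \<longrightarrow> v c = 0)}"

type_synonym ('m, 'a) frame = "'a \<Rightarrow> ('m, 'a) chart \<Rightarrow> 'a"

definition frames :: "('m, 'a::euclidean_space) chart set \<Rightarrow> 'm \<Rightarrow> ('m, 'a) frame set" where
  "frames A x = {u. (\<forall>c. linear (\<lambda>a. u a c)) \<and> bij_betw u UNIV (tangent_space A x)}"

section \<open>G-structures\<close>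

definition local_section ::
    "('m::topological_space, 'a::euclidean_space) chart set \<Rightarrow> ('m \<times> ('m, 'a) frame) set
      \<Rightarrow> 'm set \<Rightarrow> ('m \<Rightarrow> ('m, 'a) frame) \<Rightarrow> bool" where
  "local_section A P U s \<longleftrightarrow> open U \<and> (\<forall>x\<in>U. (x, s x) \<in> P) \<and>
     (\<forall>c\<in>A. \<forall>a. smooth_on (snd c ` (U \<inter> fst c)) (\<lambda>y. s (chart_inv c y) a c))"

text \<open>A reduction of the frame bundle to \<open>G\<close>; meant for closed subgroups \<open>G\<close> of the general linear
  group, so that smoothness of a section into \<open>P\<close> is smoothness as a field of frames.\<close>

definition G_structure ::
    "('m::topological_space, 'a::euclidean_space) chart set \<Rightarrow> ('a \<Rightarrow> 'a) set
      \<Rightarrow> ('m \<times> ('m, 'a) frame) set \<Rightarrow> bool" where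
  "G_structure A G P \<longleftrightarrow>
     P \<subseteq> Sigma UNIV (frames A) \<and>
     (\<forall>(x, u)\<in>P. {u'. (x, u') \<in> P} = {u \<circ> g | g. g \<in> G}) \<and>
     (\<forall>x. \<exists>U s. x \<in> U \<and> local_section A P U s)"

definition extend_structure ::
    "('m \<times> ('m, 'a) frame) set \<Rightarrow> ('a \<Rightarrow> 'a) set \<Rightarrow> ('m \<times> ('m, 'a) frame) set" where
  "extend_structure P G = {(x, u \<circ> g) | x u g. (x, u) \<in> P \<and> g \<in> G}"

text \<open>The tangent space of \<open>G\<close> at the identity. For a closed subgroup, velocities of curves that are
  merely differentiable at \<open>0\<close> give the same space as velocities of smooth curves.\<close>

definition lie_algebra :: "('a::euclidean_space \<Rightarrow> 'a) set \<Rightarrow> ('a \<Rightarrow> 'a) set" where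
  "lie_algebra G = {X. linear X \<and>
     (\<exists>\<gamma>::real \<Rightarrow> 'a \<Rightarrow> 'a. (\<forall>t. \<gamma> t \<in> G) \<and> \<gamma> 0 = id \<and>
        (\<forall>a. ((\<lambda>t. \<gamma> t a) has_vector_derivative X a) (at 0)))}"

section \<open>Connections and intrinsic torsion\<close>

text \<open>A connection on the restriction of \<open>P\<close> to \<open>U\<close> is represented by the linear connection it
  induces on the tangent bundle, given by Christoffel symbols
  \<open>\<Gamma> c x X Y\<close> in each chart \<open>c\<close>, so that in coordinates \<open>\<nabla>\<^sub>X Y = D Y X + \<Gamma> X Y\<close>. A linear connection comes
  from a connection on \<open>P\<close> iff for all local sections \<open>s\<close> of \<open>P\<close> the local connection
  form \<open>s\<^sup>-\<^sup>1 \<nabla> s\<close> takes values in the Lie algebra; this is the last clause.\<close>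

type_synonym ('m, 'a) christoffel = "('m, 'a) chart \<Rightarrow> 'm \<Rightarrow> 'a \<Rightarrow> 'a \<Rightarrow> 'a"

definition linear_connection ::
    "('m::topological_space, 'a::euclidean_space) chart set \<Rightarrow> 'm set \<Rightarrow> ('m, 'a) christoffel \<Rightarrow> bool" where
  "linear_connection A U \<Gamma> \<longleftrightarrow> open U \<and>
     (\<forall>c\<in>A. \<forall>x \<in> U \<inter> fst c. bilinear (\<Gamma> c x)) \<and>
     (\<forall>c\<in>A. \<forall>X Y. smooth_on (snd c ` (U \<inter> fst c)) (\<lambda>y. \<Gamma> c (chart_inv c y) X Y)) \<and>
     (\<forall>c\<in>A. \<forall>d\<in>A. \<forall>x \<in> U \<inter> fst c \<inter> fst d. \<forall>X Y.
        transition_deriv2 c d x X Y + \<Gamma> d x (transition_deriv c d x X) (transition_deriv c d x Y)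
          = transition_deriv c d x (\<Gamma> c x X Y))"

text \<open>Component in the chart \<open>c\<close> of \<open>\<nabla>\<^sub>X (s a)\<close>, where \<open>s a\<close> is the vector field \<open>x \<mapsto> s x a\<close>.\<close>

definition cov_deriv_frame ::
    "('m, 'a::euclidean_space) christoffel \<Rightarrow> ('m \<Rightarrow> ('m, 'a) frame) \<Rightarrow> ('m, 'a) chart
      \<Rightarrow> 'm \<Rightarrow> 'a \<Rightarrow> 'a \<Rightarrow> 'a" where
  "cov_deriv_frame \<Gamma> s c x X a =
     frechet_derivative (\<lambda>y. s (chart_inv c y) a c) (at (snd c x)) X + \<Gamma> c x X (s x a c)"

definition connection_on ::
    "('m::topological_space, 'a::euclidean_space) chart set \<Rightarrow> ('a \<Rightarrow> 'a) set
      \<Rightarrow> ('m \<times> ('m, 'a) frame) set \<Rightarrow> 'm set \<Rightarrow> ('m, 'a) christoffel \<Rightarrow> bool" where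
  "connection_on A G P U \<Gamma> \<longleftrightarrow> linear_connection A U \<Gamma> \<and>
     (\<forall>V s. local_section A P V s \<longrightarrow>
        (\<forall>c\<in>A. \<forall>x \<in> U \<inter> V \<inter> fst c. \<forall>X. \<exists>\<xi>\<in>lie_algebra G. \<forall>a.
           cov_deriv_frame \<Gamma> s c x X a = s x (\<xi> a) c))"

text \<open>The tensor \<open>\<nabla>\<^sub>X Y - \<nabla>\<^sub>Y X - [X, Y]\<close>, evaluated on coordinate-constant extensions.\<close>

definition torsion_tensor ::
    "('m, 'a::euclidean_space) chart set \<Rightarrow> ('m, 'a) christoffel \<Rightarrow> 'm
      \<Rightarrow> (('m, 'a) chart \<Rightarrow> 'a) \<Rightarrow> (('m, 'a) chart \<Rightarrow> 'a) \<Rightarrow> ('m, 'a) chart \<Rightarrow> 'a" where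
  "torsion_tensor A \<Gamma> x X Y =
     (\<lambda>c. if c \<in> A \<and> x \<in> fst c then \<Gamma> c x (X c) (Y c) - \<Gamma> c x (Y c) (X c) else 0)"

definition torsion ::
    "('m, 'a::euclidean_space) chart set \<Rightarrow> ('m, 'a) christoffel \<Rightarrow> 'm \<times> ('m, 'a) frame
      \<Rightarrow> 'a \<Rightarrow> 'a \<Rightarrow> 'a" where
  "torsion A \<Gamma> = (\<lambda>(x, u) a b. inv u (torsion_tensor A \<Gamma> x (u a) (u b)))"

text \<open>Conventions: \<open>\<Lambda>\<^sup>2T\<^sup>*\<otimes>T\<close> consists of alternating bilinear maps with
  \<open>(\<alpha> \<and> \<beta>)(x, y) = \<alpha> x * \<beta> y - \<beta> x * \<alpha> y\<close>, and \<open>T\<^sup>*\<otimes>\<gg>\<close> of linear maps into \<open>\<gg>\<close>.\<close>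

definition dual_tensor :: "('a::euclidean_space \<Rightarrow> 'a) set \<Rightarrow> ('a \<Rightarrow> 'a \<Rightarrow> 'a) set" where
  "dual_tensor \<gg> = {\<alpha>. bilinear \<alpha> \<and> (\<forall>x. \<alpha> x \<in> \<gg>)}"

definition spencer :: "('a::euclidean_space \<Rightarrow> 'a \<Rightarrow> 'a) \<Rightarrow> 'a \<Rightarrow> 'a \<Rightarrow> 'a" where
  "spencer \<alpha> x y = \<alpha> x y - \<alpha> y x"

definition coker_class ::
    "('a::euclidean_space \<Rightarrow> 'a) set \<Rightarrow> ('a \<Rightarrow> 'a \<Rightarrow> 'a) \<Rightarrow> ('a \<Rightarrow> 'a \<Rightarrow> 'a) set" where
  "coker_class G t =
     {\<lambda>x y. t x y + spencer \<alpha> x y | \<alpha>. \<alpha> \<in> dual_tensor (lie_algebra G)}"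

text \<open>Intrinsic torsion is a local invariant, so it is computed from any connection on the
  restriction of \<open>P\<close> to a neighbourhood of the base point. Restrictions of global connections are
  included.\<close>

definition intrinsic_torsion ::
    "('m::topological_space, 'a::euclidean_space) chart set \<Rightarrow> ('a \<Rightarrow> 'a) set
      \<Rightarrow> ('m \<times> ('m, 'a) frame) set \<Rightarrow> 'm \<times> ('m, 'a) frame \<Rightarrow> ('a \<Rightarrow> 'a \<Rightarrow> 'a) set" where
  "intrinsic_torsion A G P p =
     (THE \<tau>. \<exists>U \<Gamma>. fst p \<in> U \<and> connection_on A G P U \<Gamma> \<and> \<tau> = coker_class G (torsion A \<Gamma> p))"

section \<open>Quaternionic linear algebra\<close>

text \<open>Components 1, 2, 3, 4 of a quaternion are the coefficients of 1, i, j, k.\<close>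

type_synonym quat = "(real, 4) vec"

definition qmult :: "quat \<Rightarrow> quat \<Rightarrow> quat" where
  "qmult a b = vector
    [a$1 * b$1 - a$2 * b$2 - a$3 * b$3 - a$4 * b$4,
     a$1 * b$2 + a$2 * b$1 + a$3 * b$4 - a$4 * b$3,
     a$1 * b$3 - a$2 * b$4 + a$3 * b$1 + a$4 * b$2,
     a$1 * b$4 + a$2 * b$3 - a$3 * b$2 + a$4 * b$1]"

definition qcnj :: "quat \<Rightarrow> quat" where
  "qcnj a = vector [a$1, - a$2, - a$3, - a$4]"

definition qinv :: "quat \<Rightarrow> quat" where
  "qinv a = (1 / (norm a)\<^sup>2) *\<^sub>R qcnj a"

definition of_imH :: "real ^ 3 \<Rightarrow> quat" where
  "of_imH q = vector [0, q$1, q$2, q$3]"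

definition imH :: "quat \<Rightarrow> real ^ 3" where
  "imH a = vector [a$2, a$3, a$4]"

text \<open>\<open>V = (real ^ 4) ^ 'n\<close> with \<open>CARD('n) = n\<close>: the basis vector with index \<open>4j - 4 + k\<close>
  (\<open>k = 1, 2, 3, 4\<close>) is the \<open>k\<close>-th basis vector of the \<open>j\<close>-th factor. Also \<open>W = real ^ 3\<close> and
  \<open>T = V \<times> W\<close>.\<close>

type_synonym 'n V = "(quat, 'n) vec"
type_synonym W = "(real, 3) vec"
type_synonym 'n T = "'n V \<times> W"

definition scale_right :: "('n::finite) V \<Rightarrow> quat \<Rightarrow> 'n V" where
  "scale_right v q = (\<chi> j. qmult (v$j) q)"

definition wedge4 :: "4 \<Rightarrow> 4 \<Rightarrow> quat \<Rightarrow> quat \<Rightarrow> real" where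
  "wedge4 a b x y = x$a * y$b - x$b * y$a"

definition omega :: "3 \<Rightarrow> ('n::finite) V \<Rightarrow> 'n V \<Rightarrow> real" where
  "omega s x y = (\<Sum>j\<in>UNIV.
     if s = 1 then wedge4 1 2 (x$j) (y$j) - wedge4 3 4 (x$j) (y$j)
     else if s = 2 then wedge4 1 3 (x$j) (y$j) + wedge4 2 4 (x$j) (y$j)
     else wedge4 1 4 (x$j) (y$j) - wedge4 2 3 (x$j) (y$j))"

definition Theta0 :: "('n::finite) T \<Rightarrow> 'n T \<Rightarrow> 'n T" where
  "Theta0 a b = (0, \<Sum>s\<in>UNIV. omega s (fst a) (fst b) *\<^sub>R axis s 1)"

text \<open>The compact symplectic group, as the quaternion-linear isometries of the right module
  of \<open>n\<close>-tuples of quaternions.\<close>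

definition Sp :: "(('n::finite) V \<Rightarrow> 'n V) set" where
  "Sp = {g. orthogonal_transformation g \<and> (\<forall>v q. g (scale_right v q) = scale_right (g v) q)}"

text \<open>The action \<open>q \<mapsto> p q p\<close>-bar on imaginary quaternions, and its contragredient, where both
  spaces are identified with \<open>real ^ 3\<close> by the bases dual to each other.\<close>

definition imH_action :: "quat \<Rightarrow> real ^ 3 \<Rightarrow> real ^ 3" where
  "imH_action p q = imH (qmult (qmult p (of_imH q)) (qcnj p))"

definition W_action :: "quat \<Rightarrow> W \<Rightarrow> W" where
  "W_action p = adjoint (imH_action (qinv p))"

definition SpnH :: "(('n::finite) T \<Rightarrow> 'n T) set" where
  "SpnH = {\<lambda>(v, w). (scale_right (g v) (qinv p), W_action p w) | g p. g \<in> Sp \<and> p \<noteq> 0}"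

definition unipotent :: "(W \<Rightarrow> ('n::finite) V) \<Rightarrow> 'n T \<Rightarrow> 'n T" where
  "unipotent \<eta> = (\<lambda>(v, w). (v + \<eta> w, w))"

text \<open>The vector dual to the 1-form \<open>omega s v\<close> under the standard metric.\<close>

definition contract_omega :: "3 \<Rightarrow> ('n::finite) V \<Rightarrow> 'n V" where
  "contract_omega s v = (\<Sum>b\<in>Basis. omega s v b *\<^sub>R b)"

definition EH :: "(W \<Rightarrow> ('n::finite) V) set" where
  "EH = {\<lambda>w. \<Sum>s\<in>UNIV. w$s *\<^sub>R contract_omega s v | v. True}"

definition B_group :: "(('n::finite) T \<Rightarrow> 'n T) set" where
  "B_group = {unipotent \<eta> \<circ> h | \<eta> h. linear \<eta> \<and> h \<in> SpnH}"

definition K_group :: "(('n::finite) T \<Rightarrow> 'n T) set" where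
  "K_group = {unipotent \<eta> \<circ> h | \<eta> h. \<eta> \<in> EH \<and> h \<in> SpnH}"

definition integrable_qc_K_structure ::
    "('m::topological_space, ('n::finite) T) chart set \<Rightarrow> ('m \<times> ('m, 'n T) frame) set \<Rightarrow> bool" where
  "integrable_qc_K_structure A P \<longleftrightarrow> G_structure A K_group P \<and>
     (\<forall>p\<in>P. intrinsic_torsion A B_group (extend_structure P B_group) p = coker_class B_group Theta0)"

end

theory Submission
  imports Defs
begin

text \<open>A local section \<open>s\<close> of \<open>P\<close> defines the flat connection with \<open>\<nabla> s = 0\<close>, which is a connection
  both on \<open>P\<close> and on its extension to \<open>B\<close>. Intrinsic torsion does not depend on the connection, so by
  hypothesis its torsion in the frame \<open>s\<close> is \<open>\<tau> = \<Theta>\<^sub>0 + \<partial>\<alpha>\<close> with \<open>\<alpha>\<close> in \<open>T\<^sup>*\<otimes>\<bb>\<close> at every point, and it remains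
  to replace \<open>\<alpha>\<close> by an element of \<open>T\<^sup>*\<otimes>\<kk>\<close>. Since \<open>\<tau>(a, b)\<close> represents \<open>-[s a, s b]\<close>, the Jacobi identity says
  that the cyclic sums of \<open>D\<tau>(a; b, c)\<close> and \<open>\<tau>(a, \<tau>(b, c))\<close> agree. The \<open>W\<close>-component of this identity on
  \<open>V \<times> V \<times> W\<close> shows that the maps \<open>H\<^sub>s = (v \<mapsto> \<alpha>\<^sub>v w\<^sub>s)\<close> on \<open>V\<close> satisfy
  \<open>\<omega>\<^sub>r(H\<^sub>s a, b) + \<omega>\<^sub>r(a, H\<^sub>s b) = \<phi>(a, b) \<delta>\<^sub>r\<^sub>s\<close> up to terms skew in \<open>r, s\<close>. Quaternionic linear algebra
  then gives \<open>H\<^sub>s = J\<^sub>s A + X\<^sub>s\<close> with one common \<open>A\<close> and \<open>X\<^sub>s\<close> in \<open>sp(n)\<close>: the first summand is the contribution of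
  \<open>V\<^sup>*\<otimes>EH\<close>, the second one can be moved to \<open>W\<^sup>*\<otimes>sp(n)\<close> without changing \<open>\<partial>\<alpha>\<close>, and the part of \<open>\<partial>\<alpha>\<close> in
  \<open>\<Lambda>\<^sup>2W\<^sup>*\<otimes>V\<close> is the image of \<open>W\<^sup>*\<otimes>EH\<close>.\<close>

section \<open>Calculus\<close>

lemma Ck_on_Suc_imp: "Ck_on (Suc k) S f \<Longrightarrow> Ck_on k S f"
proof (induction k arbitrary: f)
  case 0
  then show ?case by (simp add: differentiable_imp_continuous_on)
next
  case (Suc k)
  then show ?case by (metis Ck_on.simps(2))
qed

lemma Ck_on_has_derivative:
  assumes "open S" "Ck_on (Suc k) S f" "x \<in> S"
  shows "(f has_derivative frechet_derivative f (at x)) (at x)"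
proof -
  have "f differentiable (at x within S)"
    using assms(2,3) unfolding Ck_on.simps differentiable_on_def by blast
  then show ?thesis
    using at_within_open[OF assms(3,1)] frechet_derivative_works by metis
qed

lemma Ck_on_cong:
  assumes "open S" "\<And>x. x \<in> S \<Longrightarrow> f x = g x" "Ck_on k S f"
  shows "Ck_on k S g"
  using assms(2,3)
proof (induction k arbitrary: f g)
  case 0
  then show ?case by (simp cong: continuous_on_cong)
next
  case (Suc k)
  have fd: "(g has_derivative frechet_derivative f (at x)) (at x)" if "x \<in> S" for x
    by (rule has_derivative_transform_within_open[OF Ck_on_has_derivative[OF assms(1) Suc.prems(2) that]
          assms(1) that Suc.prems(1)])
  then have eq: "frechet_derivative f (at x) = frechet_derivative g (at x)" if "x \<in> S" for x
    using frechet_derivative_at that by blast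
  have "g differentiable_on S"
    using fd by (meson differentiable_on_def differentiable_at_withinI differentiable_def)
  moreover have "Ck_on k S (\<lambda>x. frechet_derivative g (at x) v)" for v
    by (rule Suc.IH[where f="\<lambda>x. frechet_derivative f (at x) v"]) (use eq Suc.prems in auto)
  ultimately show ?case by simp
qed

text \<open>On an open set derivatives are unique, so a derivative found by differentiation rules
  may stand in for \<open>frechet_derivative\<close>. Closure under linear maps, sums and products
  rests on this.\<close>

lemma Ck_on_SucI:
  assumes "open S" "\<And>x. x \<in> S \<Longrightarrow> (f has_derivative f' x) (at x)"
    "\<And>v. Ck_on k S (\<lambda>x. f' x v)"
  shows "Ck_on (Suc k) S f"
proof -
  have "f differentiable_on S"
    using assms(2) by (meson differentiable_on_def differentiable_at_withinI differentiable_def)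
  moreover have "Ck_on k S (\<lambda>x. frechet_derivative f (at x) v)" for v
    by (rule Ck_on_cong[OF assms(1) _ assms(3)[of v]]) (use frechet_derivative_at[OF assms(2)] in simp)
  ultimately show ?thesis by simp
qed

lemma Ck_on_const: "Ck_on k S (\<lambda>x. c)"
  by (induction k arbitrary: c) (auto simp: differentiable_on_const)

lemma Ck_on_bounded_linear:
  assumes "open S" "bounded_linear h" "Ck_on k S f"
  shows "Ck_on k S (\<lambda>x. h (f x))"
  using assms(3)
proof (induction k arbitrary: f)
  case 0
  then show ?case using assms(2) by (simp add: bounded_linear.continuous_on)
next
  case (Suc k)
  show ?case
    by (rule Ck_on_SucI[OF assms(1)],
        rule bounded_linear.has_derivative[OF assms(2) Ck_on_has_derivative[OF assms(1) Suc.prems]])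
      (use Suc in auto)
qed

lemma Ck_on_add:
  assumes "open S" "Ck_on k S f" "Ck_on k S g"
  shows "Ck_on k S (\<lambda>x. f x + g x)"
  using assms(2,3)
proof (induction k arbitrary: f g)
  case 0
  then show ?case by (simp add: continuous_on_add)
next
  case (Suc k)
  show ?case
    by (rule Ck_on_SucI[OF assms(1)], rule has_derivative_add[OF Ck_on_has_derivative[OF assms(1) Suc.prems(1)]
          Ck_on_has_derivative[OF assms(1) Suc.prems(2)]]) (use Suc in auto)
qed

lemma Ck_on_sum:
  assumes "open S" "\<And>i. i \<in> I \<Longrightarrow> Ck_on k S (f i)"
  shows "Ck_on k S (\<lambda>x. \<Sum>i\<in>I. f i x)"
  using assms(2)
  by (induction I rule: infinite_finite_induct) (auto intro: Ck_on_const Ck_on_add[OF assms(1)])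

lemma Ck_on_scaleR:
  fixes f :: "'a::real_normed_vector \<Rightarrow> real"
  assumes "open S" "Ck_on k S f" "Ck_on k S g"
  shows "Ck_on k S (\<lambda>x. f x *\<^sub>R g x)"
  using assms(2,3)
proof (induction k arbitrary: f g)
  case 0
  then show ?case by (simp add: continuous_on_scaleR)
next
  case (Suc k)
  \<comment> \<open>The product rule leaves one factor undifferentiated; its order is lowered from
    \<open>Suc k\<close> to \<open>k\<close> before the induction hypothesis applies.\<close>
  have 1: "Ck_on k S (\<lambda>x. f x *\<^sub>R frechet_derivative g (at x) v)" for v
    using Suc.prems Suc.IH[OF Ck_on_Suc_imp] by auto
  have 2: "Ck_on k S (\<lambda>x. frechet_derivative f (at x) v *\<^sub>R g x)" for v
    using Suc.prems(1) Suc.IH[OF _ Ck_on_Suc_imp[OF Suc.prems(2)]] by simp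
  show ?case
    by (rule Ck_on_SucI[OF assms(1)], rule has_derivative_scaleR[OF Ck_on_has_derivative[OF assms(1) Suc.prems(1)]
          Ck_on_has_derivative[OF assms(1) Suc.prems(2)]]) (auto intro!: Ck_on_add assms(1) 1 2)
qed

section \<open>Derivatives of families of linear maps\<close>

lemma linear_eq_sum_Basis:
  fixes f :: "'a::euclidean_space \<Rightarrow> 'b::real_vector"
  assumes "linear f"
  shows "f a = (\<Sum>b\<in>Basis. (a \<bullet> b) *\<^sub>R f b)"
  by (metis (no_types, lifting) assms euclidean_representation linear_sum linear_cmul sum.cong)

text \<open>A family \<open>L y\<close> is known to be differentiable only on each fixed vector.
  Expanding the argument in the finite basis makes this enough, without a topology on the space of
  linear maps.\<close>

lemma frechet_derivative_linear_family:
  fixes L :: "'c::real_normed_vector \<Rightarrow> 'a::euclidean_space \<Rightarrow> 'b::real_normed_vector"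
  assumes "open S" "x \<in> S" "\<And>y. y \<in> S \<Longrightarrow> linear (L y)"
    and D: "\<And>a. (\<lambda>y. L y a) differentiable (at x)"
  shows "frechet_derivative (\<lambda>y. L y a) (at x) X =
    (\<Sum>b\<in>Basis. (a \<bullet> b) *\<^sub>R frechet_derivative (\<lambda>y. L y b) (at x) X)"
proof -
  have "((\<lambda>y. L y a) has_derivative
      (\<lambda>X. \<Sum>b\<in>Basis. (a \<bullet> b) *\<^sub>R frechet_derivative (\<lambda>y. L y b) (at x) X)) (at x)"
  proof (rule has_derivative_transform_within_open[OF _ assms(1,2)])
    show "(\<Sum>b\<in>Basis. (a \<bullet> b) *\<^sub>R L y b) = L y a" if "y \<in> S" for y
      using linear_eq_sum_Basis[OF assms(3)[OF that]] by metis
    show "((\<lambda>y. \<Sum>b\<in>Basis. (a \<bullet> b) *\<^sub>R L y b) has_derivative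
        (\<lambda>X. \<Sum>b\<in>Basis. (a \<bullet> b) *\<^sub>R frechet_derivative (\<lambda>y. L y b) (at x) X)) (at x)"
      using D by (intro has_derivative_sum has_derivative_scaleR_right) (simp add: frechet_derivative_works)
  qed
  then show ?thesis by (rule fun_cong[OF frechet_derivative_at[symmetric]])
qed

lemma linear_frechet_derivative_family:
  fixes L :: "'c::real_normed_vector \<Rightarrow> 'a::euclidean_space \<Rightarrow> 'b::real_normed_vector"
  assumes "open S" "x \<in> S" "\<And>y. y \<in> S \<Longrightarrow> linear (L y)"
    and D: "\<And>a. (\<lambda>y. L y a) differentiable (at x)"
  shows "linear (\<lambda>a. frechet_derivative (\<lambda>y. L y a) (at x) X)"
proof -
  have "(\<lambda>a. frechet_derivative (\<lambda>y. L y a) (at x) X) =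
      (\<lambda>a. \<Sum>b\<in>Basis. (a \<bullet> b) *\<^sub>R frechet_derivative (\<lambda>y. L y b) (at x) X)"
    by (rule ext) (rule frechet_derivative_linear_family[OF assms])
  moreover have "linear (\<lambda>a. (a \<bullet> b) *\<^sub>R frechet_derivative (\<lambda>y. L y b) (at x) X)" for b
    by (rule bounded_linear.linear[OF bounded_linear_compose[OF bounded_linear_scaleR_left bounded_linear_inner_left]])
  ultimately show ?thesis by (simp add: linear_compose_sum)
qed

text \<open>In the basis expansion \<open>L y (Z y)\<close> is a finite sum of scalar functions
  times \<open>L y b\<close>, to which the ordinary product rule applies; linearity then collects
  the terms again.\<close>

lemma has_derivative_linear_family:
  fixes L :: "'c::real_normed_vector \<Rightarrow> 'a::euclidean_space \<Rightarrow> 'b::real_normed_vector"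
  assumes "open S" "x \<in> S" "\<And>y. y \<in> S \<Longrightarrow> linear (L y)"
    and D: "\<And>a. (\<lambda>y. L y a) differentiable (at x)" and Z: "(Z has_derivative Z') (at x)"
  shows "((\<lambda>y. L y (Z y)) has_derivative
           (\<lambda>X. frechet_derivative (\<lambda>y. L y (Z x)) (at x) X + L x (Z' X))) (at x)"
proof (rule has_derivative_transform_within_open[OF _ assms(1,2)])
  show "(\<Sum>b\<in>Basis. (Z y \<bullet> b) *\<^sub>R L y b) = L y (Z y)" if "y \<in> S" for y
    using linear_eq_sum_Basis[OF assms(3)[OF that]] by metis
  have "((\<lambda>y. \<Sum>b\<in>Basis. (Z y \<bullet> b) *\<^sub>R L y b) has_derivative (\<lambda>X. \<Sum>b\<in>Basis.
      (Z x \<bullet> b) *\<^sub>R frechet_derivative (\<lambda>y. L y b) (at x) X + (Z' X \<bullet> b) *\<^sub>R L x b)) (at x)"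
    using D by (intro has_derivative_sum has_derivative_scaleR has_derivative_inner_left Z)
      (simp add: frechet_derivative_works)
  moreover have "L x (Z' X) = (\<Sum>b\<in>Basis. (Z' X \<bullet> b) *\<^sub>R L x b)" for X
    using linear_eq_sum_Basis[OF assms(3)[OF assms(2)]] by metis
  ultimately show "((\<lambda>y. \<Sum>b\<in>Basis. (Z y \<bullet> b) *\<^sub>R L y b) has_derivative
      (\<lambda>X. frechet_derivative (\<lambda>y. L y (Z x)) (at x) X + L x (Z' X))) (at x)"
    using frechet_derivative_linear_family[OF assms(1-4), where a="Z x"] by (simp add: sum.distrib)
qed

section \<open>Symmetry of second derivatives\<close>

lemma second_difference:
  fixes g :: "'a::euclidean_space \<Rightarrow> real"
  assumes "h > 0" and S: "open S" "\<And>s t. 0 \<le> s \<Longrightarrow> s \<le> h \<Longrightarrow> 0 \<le> t \<Longrightarrow> t \<le> h \<Longrightarrow> x + s *\<^sub>R X + t *\<^sub>R Y \<in> S"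
    and C: "Ck_on 2 S g"
  obtains s t where "0 < s" "s < h" "0 < t" "t < h"
    "g (x + h *\<^sub>R X + h *\<^sub>R Y) - g (x + h *\<^sub>R X) - g (x + h *\<^sub>R Y) + g x =
      h * (h * frechet_derivative (\<lambda>y. frechet_derivative g (at y) X) (at (x + s *\<^sub>R X + t *\<^sub>R Y)) Y)"
proof -
  let ?g = "\<lambda>y. frechet_derivative g (at y)"
  let ?h = "\<lambda>y. frechet_derivative (\<lambda>y. ?g y X) (at y)"
  have C1: "Ck_on (Suc 1) S g" using C by (simp add: numeral_2_eq_2)
  have C2: "Ck_on (Suc 0) S (\<lambda>y. ?g y X)" using C by (simp add: numeral_2_eq_2)
  have der: "((\<lambda>s. G (p + s *\<^sub>R Z)) has_real_derivative frechet_derivative G (at (p + s *\<^sub>R Z)) Z) (at s)"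
    if "Ck_on (Suc k) S G" "p + s *\<^sub>R Z \<in> S" for G :: "'a \<Rightarrow> real" and p Z s k
  proof -
    have G: "(G has_derivative frechet_derivative G (at (p + s *\<^sub>R Z))) (at (p + s *\<^sub>R Z))"
      using Ck_on_has_derivative[OF S(1) that] .
    have "((\<lambda>s. G (p + s *\<^sub>R Z)) has_derivative (\<lambda>d. frechet_derivative G (at (p + s *\<^sub>R Z)) (d *\<^sub>R Z))) (at s)"
      by (rule has_derivative_compose[where f="\<lambda>s. p + s *\<^sub>R Z", OF _ G]) (auto intro!: derivative_eq_intros)
    then show ?thesis
      by (simp add: has_field_derivative_def linear_cmul[OF has_derivative_linear[OF G]] mult.commute
          mult_commute_abs)
  qed
  \<comment> \<open>The second difference is the increment over \<open>[0, h]\<close> of the first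
    difference in the direction \<open>Y\<close>, seen as a function of \<open>s\<close>. The mean
    value theorem is applied here in \<open>s\<close>, and below in \<open>t\<close> to the
    resulting derivative.\<close>
  have "\<exists>s>0. s < h \<and> (g (x + h *\<^sub>R Y + h *\<^sub>R X) - g (x + h *\<^sub>R X)) - (g (x + h *\<^sub>R Y + 0 *\<^sub>R X) - g (x + 0 *\<^sub>R X))
      = (h - 0) * (?g (x + h *\<^sub>R Y + s *\<^sub>R X) X - ?g (x + s *\<^sub>R X) X)"
  proof (rule MVT2[OF assms(1)])
    fix s assume "0 \<le> s" "s \<le> h"
    then show "((\<lambda>s. g (x + h *\<^sub>R Y + s *\<^sub>R X) - g (x + s *\<^sub>R X)) has_real_derivative
        ?g (x + h *\<^sub>R Y + s *\<^sub>R X) X - ?g (x + s *\<^sub>R X) X) (at s)"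
      using S(2)[of s h] S(2)[of s 0] assms(1)
      by (intro DERIV_diff der[OF C1]) (auto simp: algebra_simps)
  qed
  then obtain s where s: "0 < s" "s < h"
    and e: "(g (x + h *\<^sub>R Y + h *\<^sub>R X) - g (x + h *\<^sub>R X)) - (g (x + h *\<^sub>R Y) - g x)
      = h * (?g (x + h *\<^sub>R Y + s *\<^sub>R X) X - ?g (x + s *\<^sub>R X) X)" by auto
  have "\<exists>t>0. t < h \<and> ?g (x + s *\<^sub>R X + h *\<^sub>R Y) X - ?g (x + s *\<^sub>R X + 0 *\<^sub>R Y) X
      = (h - 0) * ?h (x + s *\<^sub>R X + t *\<^sub>R Y) Y"
  proof (rule MVT2[OF assms(1)])
    fix t assume "0 \<le> t" "t \<le> h"
    then show "((\<lambda>t. ?g (x + s *\<^sub>R X + t *\<^sub>R Y) X) has_real_derivative ?h (x + s *\<^sub>R X + t *\<^sub>R Y) Y) (at t)"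
      using S(2)[of s t] s by (intro der[OF C2]) auto
  qed
  then obtain t where t: "0 < t" "t < h"
    "?g (x + s *\<^sub>R X + h *\<^sub>R Y) X - ?g (x + s *\<^sub>R X) X = h * ?h (x + s *\<^sub>R X + t *\<^sub>R Y) Y" by auto
  show ?thesis
    by (rule that[OF s t(1,2)]) (use e t(3) in \<open>simp add: ac_simps\<close>)
qed

lemma frechet_derivative_inner:
  assumes "f differentiable (at x)"
  shows "frechet_derivative (\<lambda>y. f y \<bullet> b) (at x) v = frechet_derivative f (at x) v \<bullet> b"
  using frechet_derivative_at[OF has_derivative_inner_left[OF assms[unfolded frechet_derivative_works]]]
  by metis

text \<open>The second difference over the parallelogram spanned by \<open>h X\<close> and
  \<open>h Y\<close> is symmetric in \<open>X\<close> and \<open>Y\<close>, and equals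
  \<open>h * h\<close> times either mixed derivative at some point of the parallelogram. Continuity
  of both derivatives lets the parallelogram shrink to \<open>x\<close>.\<close>

lemma mixed_derivatives_eq_real:
  fixes g :: "'a::euclidean_space \<Rightarrow> real"
  assumes S: "open S" "x \<in> S" and C: "Ck_on 2 S g"
  shows "frechet_derivative (\<lambda>y. frechet_derivative g (at y) X) (at x) Y =
         frechet_derivative (\<lambda>y. frechet_derivative g (at y) Y) (at x) X" (is "?A x = ?B x")
proof (rule ccontr)
  assume ne: "?A x \<noteq> ?B x"
  \<comment> \<open>Each mixed derivative is kept within half of their gap at \<open>x\<close>, so
    that equal values at two nearby points are contradictory.\<close>
  define e where "e = \<bar>?A x - ?B x\<bar> / 2"
  have e: "e > 0" using ne by (simp add: e_def)
  have cont: "continuous_on S ?A" "continuous_on S ?B"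
    using C by (simp_all add: numeral_2_eq_2)
  obtain d1 where d1: "d1 > 0" "\<And>y. y \<in> S \<Longrightarrow> dist y x < d1 \<Longrightarrow> dist (?A y) (?A x) < e"
    using cont(1) S(2) e unfolding continuous_on_iff by blast
  obtain d2 where d2: "d2 > 0" "\<And>y. y \<in> S \<Longrightarrow> dist y x < d2 \<Longrightarrow> dist (?B y) (?B x) < e"
    using cont(2) S(2) e unfolding continuous_on_iff by blast
  obtain d3 where d3: "d3 > 0" "ball x d3 \<subseteq> S" using S open_contains_ball by metis
  define d where "d = min d1 (min d2 d3)"
  \<comment> \<open>The summand \<open>1\<close> keeps the denominator positive also for
    \<open>X = Y = 0\<close> and makes the bound in \<open>close\<close> strict.\<close>
  define h where "h = d / (norm X + norm Y + 1)"
  have dp: "d > 0" using d1 d2 d3 by (simp add: d_def)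
  then have h: "h > 0" by (simp add: h_def add_nonneg_pos)
  have close: "dist (x + s *\<^sub>R X + t *\<^sub>R Y) x < d" if "0 \<le> s" "s \<le> h" "0 \<le> t" "t \<le> h" for s t
  proof -
    have "dist (x + s *\<^sub>R X + t *\<^sub>R Y) x = norm (s *\<^sub>R X + t *\<^sub>R Y)" by (simp add: dist_norm)
    also have "\<dots> \<le> norm (s *\<^sub>R X) + norm (t *\<^sub>R Y)" by (rule norm_triangle_ineq)
    also have "\<dots> \<le> h * norm X + h * norm Y" using that by (simp add: add_mono mult_right_mono)
    also have "\<dots> < h * (norm X + norm Y + 1)" using h by (simp add: algebra_simps)
    also have "\<dots> = d" unfolding h_def
      by (metis add_nonneg_pos add_nonneg_nonneg nonzero_eq_divide_eq norm_ge_zero order_less_irrefl zero_less_one)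
    finally show ?thesis .
  qed
  then have inS: "x + s *\<^sub>R X + t *\<^sub>R Y \<in> S" if "0 \<le> s" "s \<le> h" "0 \<le> t" "t \<le> h" for s t
    using that d3(2) by (force simp: d_def dist_commute)
  obtain s t where st: "0 < s" "s < h" "0 < t" "t < h"
    and 1: "g (x + h *\<^sub>R X + h *\<^sub>R Y) - g (x + h *\<^sub>R X) - g (x + h *\<^sub>R Y) + g x
      = h * (h * ?A (x + s *\<^sub>R X + t *\<^sub>R Y))"
    using second_difference[OF h S(1) inS C] by blast
  have inS': "x + s *\<^sub>R Y + t *\<^sub>R X \<in> S" if "0 \<le> s" "s \<le> h" "0 \<le> t" "t \<le> h" for s t
    using inS[of t s] that by (simp add: ac_simps)
  obtain s' t' where st': "0 < s'" "s' < h" "0 < t'" "t' < h"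
    and 2: "g (x + h *\<^sub>R Y + h *\<^sub>R X) - g (x + h *\<^sub>R Y) - g (x + h *\<^sub>R X) + g x
      = h * (h * ?B (x + s' *\<^sub>R Y + t' *\<^sub>R X))"
    using second_difference[OF h S(1) inS' C] by blast
  have "g (x + h *\<^sub>R Y + h *\<^sub>R X) = g (x + h *\<^sub>R X + h *\<^sub>R Y)"
    by (simp add: ac_simps)
  then have "h * (h * ?A (x + s *\<^sub>R X + t *\<^sub>R Y)) = h * (h * ?B (x + s' *\<^sub>R Y + t' *\<^sub>R X))"
    using 1 2 by argo
  then have "?A (x + s *\<^sub>R X + t *\<^sub>R Y) = ?B (x + s' *\<^sub>R Y + t' *\<^sub>R X)"
    using h by simp
  moreover have "dist (?A (x + s *\<^sub>R X + t *\<^sub>R Y)) (?A x) < e"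
    using d1(2)[OF inS[of s t]] close[of s t] st by (simp add: d_def)
  moreover have "dist (?B (x + s' *\<^sub>R Y + t' *\<^sub>R X)) (?B x) < e"
    using d2(2)[OF inS'[of s' t']] close[of t' s'] st' by (simp add: d_def ac_simps)
  ultimately show False by (auto simp: e_def dist_real_def abs_if field_simps split: if_splits)
qed

text \<open>The mean value theorem concerns real functions, so the vector case is reduced to the
  components \<open>f y \<bullet> b\<close>.\<close>

lemma mixed_derivatives_eq:
  fixes f :: "'a::euclidean_space \<Rightarrow> 'b::euclidean_space"
  assumes S: "open S" "x \<in> S" and C: "Ck_on 2 S f"
  shows "frechet_derivative (\<lambda>y. frechet_derivative f (at y) X) (at x) Y =
         frechet_derivative (\<lambda>y. frechet_derivative f (at y) Y) (at x) X"
proof (rule euclidean_eqI)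
  fix b :: 'b assume "b \<in> Basis"
  have C': "Ck_on (Suc 1) S f" "Ck_on (Suc 0) S (\<lambda>y. frechet_derivative f (at y) X)" for X
    using C by (simp_all add: numeral_2_eq_2)
  have d1: "f differentiable (at y)" if "y \<in> S" for y
    using Ck_on_has_derivative[OF S(1) C'(1) that] frechet_derivative_works by blast
  have d2: "(\<lambda>y. frechet_derivative f (at y) X) differentiable (at y)" if "y \<in> S" for y X
    using Ck_on_has_derivative[OF S(1) C'(2) that] frechet_derivative_works by blast
  have "frechet_derivative (\<lambda>y. frechet_derivative (\<lambda>z. f z \<bullet> b) (at y) X) (at x) Y
      = frechet_derivative (\<lambda>y. frechet_derivative f (at y) X) (at x) Y \<bullet> b" for X Y
  proof -
    have "((\<lambda>y. frechet_derivative (\<lambda>z. f z \<bullet> b) (at y) X) has_derivative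
        (\<lambda>Y. frechet_derivative (\<lambda>y. frechet_derivative f (at y) X) (at x) Y \<bullet> b)) (at x)"
      by (rule has_derivative_transform_within_open[OF has_derivative_inner_left[OF
              d2[OF S(2), unfolded frechet_derivative_works]] S])
        (use d1 frechet_derivative_inner in metis)
    then show ?thesis using frechet_derivative_at by metis
  qed
  moreover have "Ck_on 2 S (\<lambda>z. f z \<bullet> b)"
    by (rule Ck_on_bounded_linear[OF S(1) bounded_linear_inner_left C])
  ultimately show "frechet_derivative (\<lambda>y. frechet_derivative f (at y) X) (at x) Y \<bullet> b =
      frechet_derivative (\<lambda>y. frechet_derivative f (at y) Y) (at x) X \<bullet> b"
    using mixed_derivatives_eq_real[OF S] by metis
qed

section \<open>Inverses of families of linear maps\<close>

lemma linear_family_bounded_below: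
  fixes L :: "'c::real_normed_vector \<Rightarrow> 'a::euclidean_space \<Rightarrow> 'a"
  assumes "open S" "x \<in> S" "\<And>y. y \<in> S \<Longrightarrow> linear (L y)" "inj (L x)"
    and "\<And>a. isCont (\<lambda>y. L y a) x"
  obtains m where "m > 0" "eventually (\<lambda>y. y \<in> S \<and> (\<forall>a. m * norm a \<le> norm (L y a))) (at x)"
proof -
  obtain m where m: "m > 0" "\<And>a. m * norm a \<le> norm (L x a)"
    using linear_inj_bounded_below_pos[OF assms(3)[OF assms(2)] assms(4)] by blast
  define N where "N = real (DIM('a))"
  have N: "N > 0" by (simp add: N_def)
  \<comment> \<open>Closeness within \<open>m / (2 * N)\<close> on the \<open>N\<close> basis
    vectors costs at most half of the lower bound \<open>m\<close> on every vector.\<close>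
  have "eventually (\<lambda>y. \<forall>b\<in>(Basis::'a set). dist (L y b) (L x b) < m / (2 * N)) (at x)"
    using assms(5) m(1) N by (intro eventually_ball_finite) (auto simp: isCont_def tendsto_iff)
  moreover have "eventually (\<lambda>y. y \<in> S) (at x)"
    using assms(1,2) eventually_at_in_open' by blast
  ultimately have "eventually (\<lambda>y. y \<in> S \<and> (\<forall>a. m / 2 * norm a \<le> norm (L y a))) (at x)"
  proof eventually_elim
    case (elim y)
    have "m / 2 * norm a \<le> norm (L y a)" for a
    proof -
      have "norm (L y a - L x a) = norm (\<Sum>b\<in>Basis. (a \<bullet> b) *\<^sub>R (L y b - L x b))"
        unfolding scaleR_diff_right sum_subtractf
        using linear_eq_sum_Basis[OF assms(3)[OF elim(2)], of a] linear_eq_sum_Basis[OF assms(3)[OF assms(2)], of a]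
        by simp
      also have "\<dots> \<le> (\<Sum>b\<in>(Basis::'a set). norm a * (m / (2 * N)))"
        by (rule sum_norm_le)
          (use elim in \<open>auto simp: dist_norm less_imp_le simp del: times_divide_eq_right intro!: mult_mono Basis_le_norm\<close>)
      also have "\<dots> = m / 2 * norm a" using N by (simp add: N_def)
      finally have "norm (L y a - L x a) \<le> m / 2 * norm a" .
      moreover have "norm (L x a) \<le> norm (L y a) + norm (L y a - L x a)"
        by (metis norm_minus_commute norm_triangle_sub)
      ultimately show ?thesis using m(2)[of a] by linarith
    qed
    then show ?case using elim by blast
  qed
  then show ?thesis using m(1) that[of "m / 2"] by simp
qed

text \<open>With \<open>z\<close> the value at \<open>x\<close>, \<open>inv (L y) (F y) - z\<close>
  is \<open>inv (L y) (R y)\<close>, and \<open>R\<close> vanishes at \<open>x\<close>. The uniform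
  lower bound on \<open>L y\<close> takes the place of continuity of the inverses: it turns an
  estimate of \<open>L y\<close> applied to the error into one of the error itself.\<close>

lemma has_derivative_inverse_family:
  fixes L :: "'c::real_normed_vector \<Rightarrow> 'a::euclidean_space \<Rightarrow> 'a"
  assumes S: "open S" "x \<in> S" and lin: "\<And>y. y \<in> S \<Longrightarrow> linear (L y)" and bij: "\<And>y. y \<in> S \<Longrightarrow> bij (L y)"
    and L: "\<And>a. (\<lambda>y. L y a) differentiable (at x)" and F: "(F has_derivative F') (at x)"
  shows "((\<lambda>y. inv (L y) (F y)) has_derivative
           (\<lambda>X. inv (L x) (F' X - frechet_derivative (\<lambda>y. L y (inv (L x) (F x))) (at x) X))) (at x)"
proof -
  define z where "z = inv (L x) (F x)"
  define R where "R = (\<lambda>y. F y - L y z)"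
  define R' where "R' = (\<lambda>X. F' X - frechet_derivative (\<lambda>y. L y z) (at x) X)"
  define K where "K = inv (L x)"
  have inv: "L y (inv (L y) a) = a" "inv (L y) (L y a) = a" if "y \<in> S" for y a
    using bij[OF that] by (simp_all add: bij_is_surj surj_f_inv_f bij_is_inj inv_f_f)
  have R: "(R has_derivative R') (at x)"
    unfolding R_def R'_def using L[of z] by (intro has_derivative_diff F) (simp add: frechet_derivative_works)
  have Rx: "R x = 0" by (simp add: R_def z_def inv S)
  have K: "linear K" unfolding K_def using lin bij S by (simp add: bij_is_inj inj_linear_imp_inv_linear)
  then have bK: "bounded_linear (\<lambda>X. K (R' X))"
    using R bounded_linear_compose has_derivative_bounded_linear linear_conv_bounded_linear by blast
  have "((\<lambda>y. inv (L y) (F y)) has_derivative (\<lambda>X. K (R' X))) (at x)"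
  proof (rule has_derivativeI[OF bK])
    have cont: "isCont (\<lambda>y. L y a) x" for a
      using L differentiable_imp_continuous_within by blast
    obtain m where m: "m > 0" and
      ev: "eventually (\<lambda>y. y \<in> S \<and> (\<forall>a. m * norm a \<le> norm (L y a))) (at x)"
      using linear_family_bounded_below[OF S lin bij_is_inj[OF bij[OF S(2)]] cont] by blast
    \<comment> \<open>The first summand is the remainder of \<open>R\<close>, the second the
      variation of \<open>L\<close> on \<open>K (R' (y - x))\<close>, a vector bounded by a constant
      times \<open>norm (y - x)\<close>.\<close>
    define q where "q = (\<lambda>y. (1 / m) * (norm (R y - R x - R' (y - x)) / norm (y - x)
        + norm (L x (K (R' (y - x))) - L y (K (R' (y - x)))) / norm (y - x)))"
    obtain B where B: "B > 0" "\<And>X. norm (K (R' X)) \<le> norm X * B"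
      using bounded_linear.pos_bounded[OF bK] by blast
    have t1: "((\<lambda>y. norm (R y - R x - R' (y - x)) / norm (y - x)) \<longlongrightarrow> 0) (at x)"
      using R by (simp add: has_derivative_iff_norm)
    have t2: "((\<lambda>y. norm (L x (K (R' (y - x))) - L y (K (R' (y - x)))) / norm (y - x)) \<longlongrightarrow> 0) (at x)"
    proof (rule tendsto_sandwich[OF _ _ tendsto_const])
      show "\<forall>\<^sub>F y in at x. norm (L x (K (R' (y - x))) - L y (K (R' (y - x)))) / norm (y - x)
          \<le> (\<Sum>b\<in>Basis. B * norm (L x b - L y b))"
        using eventually_conj[OF ev eventually_neq_at_within[of x]]
      proof eventually_elim
        case (elim y)
        let ?a = "K (R' (y - x))"
        have "norm (L x ?a - L y ?a) = norm (\<Sum>b\<in>Basis. (?a \<bullet> b) *\<^sub>R (L x b - L y b))"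
          unfolding scaleR_diff_right sum_subtractf
          using linear_eq_sum_Basis[OF lin, of y ?a] linear_eq_sum_Basis[OF lin[OF S(2)], of ?a] elim
          by simp
        also have "\<dots> \<le> (\<Sum>b\<in>(Basis::'a set). (norm (y - x) * B) * norm (L x b - L y b))"
          by (rule sum_norm_le)
            (auto intro!: mult_right_mono intro: order_trans[OF Basis_le_norm B(2)])
        also have "\<dots> = norm (y - x) * (\<Sum>b\<in>Basis. B * norm (L x b - L y b))"
          by (simp add: sum_distrib_left mult.assoc)
        finally show ?case using elim by (simp add: pos_divide_le_eq mult.commute)
      qed
      have "((\<lambda>y. \<Sum>b\<in>Basis. B * norm (L x b - L y b)) \<longlongrightarrow> (\<Sum>b\<in>Basis. B * norm (L x b - L x b))) (at x)"
        using cont by (intro tendsto_intros) (auto simp: isCont_def)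
      then show "((\<lambda>y. \<Sum>b\<in>Basis. B * norm (L x b - L y b)) \<longlongrightarrow> 0) (at x)" by simp
    qed auto
    have q: "(q \<longlongrightarrow> 0) (at x)"
      unfolding q_def using tendsto_mult[OF tendsto_const tendsto_add[OF t1 t2], of "1/m"] by simp
    show "((\<lambda>y. (inv (L y) (F y) - inv (L x) (F x) - K (R' (y - x))) /\<^sub>R norm (y - x)) \<longlongrightarrow> 0) (at x)"
    proof (rule Lim_null_comparison[OF _ q])
      show "\<forall>\<^sub>F y in at x. norm ((inv (L y) (F y) - inv (L x) (F x) - K (R' (y - x))) /\<^sub>R norm (y - x)) \<le> q y"
        using eventually_conj[OF ev eventually_neq_at_within[of x]]
      proof eventually_elim
        case (elim y)
        let ?a = "K (R' (y - x))"
        let ?d = "inv (L y) (F y) - inv (L x) (F x) - ?a"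
        have "L y ?d = F y - L y z - L y ?a"
          using elim lin[of y] by (simp add: linear_diff inv z_def)
        also have "\<dots> = (R y - R x - R' (y - x)) + (L x ?a - L y ?a)"
          by (simp add: Rx) (simp add: R_def z_def K_def inv S)
        finally have "m * norm ?d \<le> norm (R y - R x - R' (y - x)) + norm (L x ?a - L y ?a)"
          using elim norm_triangle_ineq by (metis order_trans)
        then have "norm ?d \<le> (1 / m) * (norm (R y - R x - R' (y - x)) + norm (L x ?a - L y ?a))"
          using m by (simp add: field_simps)
        from divide_right_mono[OF this norm_ge_zero[of "y - x"]] show ?case
          by (simp add: q_def add_divide_distrib divide_inverse_commute distrib_left ac_simps)
      qed
    qed
  qed
  then show ?thesis by (simp add: K_def R'_def z_def)
qed

text \<open>The derivative of \<open>inv (L y) (F y)\<close> is built from terms of the same shape,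
  with \<open>F\<close> replaced by derivatives of \<open>F\<close> and of \<open>L\<close>. Hence
  the induction on the order runs over all smooth \<open>F\<close> at once.\<close>

lemma smooth_on_inverse_family:
  fixes L :: "'c::real_normed_vector \<Rightarrow> 'a::euclidean_space \<Rightarrow> 'a"
  assumes S: "open S" and lin: "\<And>y. y \<in> S \<Longrightarrow> linear (L y)" and bij: "\<And>y. y \<in> S \<Longrightarrow> bij (L y)"
    and L: "\<And>a. smooth_on S (\<lambda>y. L y a)" and F: "smooth_on S F"
  shows "smooth_on S (\<lambda>y. inv (L y) (F y))"
proof -
  let ?DL = "\<lambda>b y X. frechet_derivative (\<lambda>y. L y b) (at y) X"
  have D: "(\<lambda>y. L y a) differentiable (at x)" if "x \<in> S" for a x
    using Ck_on_has_derivative[OF S _ that, of 0] L frechet_derivative_works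
    unfolding smooth_on_def by blast
  have DL: "?DL a x X = (\<Sum>b\<in>Basis. (a \<bullet> b) *\<^sub>R ?DL b x X)" if "x \<in> S" for a X x
    by (rule frechet_derivative_linear_family[OF S that lin D[OF that]])
  have der: "((\<lambda>y. inv (L y) (F y)) has_derivative
      (\<lambda>X. inv (L x) (F' X) - (\<Sum>b\<in>Basis. (inv (L x) (F x) \<bullet> b) *\<^sub>R inv (L x) (?DL b x X)))) (at x)"
    if "x \<in> S" "(F has_derivative F') (at x)" for F F' x
  proof -
    have "linear (inv (L x))" using lin bij that(1) by (simp add: bij_is_inj inj_linear_imp_inv_linear)
    then show ?thesis
      using has_derivative_inverse_family[OF S that(1) lin bij D[OF that(1)] that(2)] DL[OF that(1), of "inv (L x) (F x)"]
      by (simp add: linear_diff linear_sum linear_cmul)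
  qed
  have "Ck_on k S (\<lambda>y. inv (L y) (F y))" for k
    using F
  proof (induction k arbitrary: F)
    case (0 F)
    then have "(F has_derivative frechet_derivative F (at x)) (at x)" if "x \<in> S" for x
      using Ck_on_has_derivative[OF S _ that, of 0] unfolding smooth_on_def by blast
    then have "continuous (at x within S) (\<lambda>y. inv (L y) (F y))" if "x \<in> S" for x
      using has_derivative_continuous[OF der[OF that]] that continuous_at_imp_continuous_within by blast
    then show ?case unfolding Ck_on.simps continuous_on_eq_continuous_within by blast
  next
    case (Suc k)
    have d: "(F has_derivative frechet_derivative F (at x)) (at x)" if "x \<in> S" for x
      using Ck_on_has_derivative[OF S _ that, of 0] Suc.prems unfolding smooth_on_def by blast
    have sD: "smooth_on S (\<lambda>x. frechet_derivative G (at x) v)" if "smooth_on S G" for G :: "'c \<Rightarrow> 'a" and v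
      using that unfolding smooth_on_def by (metis Ck_on.simps(2))
    show ?case
    proof (rule Ck_on_SucI[OF S der[OF _ d]])
      fix v
      have "Ck_on k S (\<lambda>x. inv (L x) (frechet_derivative F (at x) v)
          + (-1) *\<^sub>R (\<Sum>b\<in>Basis. (inv (L x) (F x) \<bullet> b) *\<^sub>R inv (L x) (?DL b x v)))"
        by (intro Ck_on_add S Suc.IH sD Suc.prems Ck_on_scaleR Ck_on_const Ck_on_sum L
            Ck_on_bounded_linear[OF S bounded_linear_inner_left])
      then show "Ck_on k S (\<lambda>x. inv (L x) (frechet_derivative F (at x) v)
          - (\<Sum>b\<in>Basis. (inv (L x) (F x) \<bullet> b) *\<^sub>R inv (L x) (?DL b x v)))" by simp
    qed
  qed
  then show ?thesis by (simp add: smooth_on_def)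
qed

text \<open>For the frame field \<open>E\<close>, \<open>E y (\<tau> y a b)\<close> is the bracket \<open>[E b, E a]\<close> and the conclusion is the Jacobi
  identity for \<open>E a\<close>, \<open>E b\<close>, \<open>E c\<close>.\<close>

lemma cyclic_identity_structure_functions:
  fixes E :: "'a::euclidean_space \<Rightarrow> 'a \<Rightarrow> 'a"
  assumes S: "open S" "p \<in> S" and lin: "\<And>y. y \<in> S \<Longrightarrow> linear (E y)" and bij: "\<And>y. y \<in> S \<Longrightarrow> bij (E y)"
    and C: "\<And>a. Ck_on 2 S (\<lambda>y. E y a)"
    and \<tau>: "\<And>y a b. y \<in> S \<Longrightarrow> E y (\<tau> y a b) =
      frechet_derivative (\<lambda>y. E y a) (at y) (E y b) - frechet_derivative (\<lambda>y. E y b) (at y) (E y a)"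
  shows "(\<lambda>y. \<tau> y b c) differentiable (at p)"
    and "frechet_derivative (\<lambda>y. \<tau> y b c) (at p) (E p a) + frechet_derivative (\<lambda>y. \<tau> y c a) (at p) (E p b)
      + frechet_derivative (\<lambda>y. \<tau> y a b) (at p) (E p c) =
      \<tau> p a (\<tau> p b c) + \<tau> p b (\<tau> p c a) + \<tau> p c (\<tau> p a b)"
proof -
  define D where "D a y = frechet_derivative (\<lambda>y. E y a) (at y)" for a y
  define D2 where "D2 a X Y = frechet_derivative (\<lambda>y. D a y Y) (at p) X" for a X Y
  have C': "Ck_on (Suc 1) S (\<lambda>y. E y a)" "Ck_on (Suc 0) S (\<lambda>y. D a y X)" for a X
    using C[of a] by (simp_all add: numeral_2_eq_2 D_def)
  have dE: "((\<lambda>y. E y a) has_derivative D a y) (at y)" if "y \<in> S" for a y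
    unfolding D_def by (rule Ck_on_has_derivative[OF S(1) C'(1) that])
  have linD: "linear (D a y)" if "y \<in> S" for a y using dE[OF that] has_derivative_linear by blast
  have dD: "((\<lambda>y. D a y X) has_derivative (\<lambda>Y. D2 a Y X)) (at p)" for a X
    unfolding D2_def by (rule Ck_on_has_derivative[OF S(1) C'(2) S(2)])
  have sym: "D2 a X Y = D2 a Y X" for a X Y
    unfolding D2_def D_def by (rule mixed_derivatives_eq[OF S C])
  have dF: "((\<lambda>y. D a y (E y b)) has_derivative (\<lambda>X. D2 a X (E p b) + D a p (D b p X))) (at p)" for a b
  proof -
    have "(\<lambda>y. D a y z) differentiable (at p)" for z using dD differentiable_def by blast
    from has_derivative_linear_family[OF S linD this dE[OF S(2), of b]] show ?thesis
      unfolding D2_def by simp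
  qed
  \<comment> \<open>\<open>\<tau> y a b\<close> is the inverse frame applied to a difference of
    derivatives; the term with \<open>D (\<tau> p a b)\<close> comes from differentiating that
    inverse.\<close>
  have d\<tau>: "((\<lambda>y. \<tau> y a b) has_derivative (\<lambda>X. inv (E p)
      ((D2 a X (E p b) + D a p (D b p X)) - (D2 b X (E p a) + D b p (D a p X)) - D (\<tau> p a b) p X))) (at p)" for a b
  proof (rule has_derivative_transform_within_open[OF _ S])
    have \<tau>': "inv (E y) (D a y (E y b) - D b y (E y a)) = \<tau> y a b" if "y \<in> S" for y
      using \<tau>[OF that, of a b] bij[OF that] unfolding D_def by (metis bij_is_inj inv_f_f)
    then show "inv (E y) (D a y (E y b) - D b y (E y a)) = \<tau> y a b" if "y \<in> S" for y using that .
    have "(\<lambda>y. E y z) differentiable (at p)" for z using dE[OF S(2)] differentiable_def by blast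
    from has_derivative_inverse_family[OF S lin bij this has_derivative_diff[OF dF[of a b] dF[of b a]]]
    show "((\<lambda>y. inv (E y) (D a y (E y b) - D b y (E y a))) has_derivative (\<lambda>X. inv (E p)
      ((D2 a X (E p b) + D a p (D b p X)) - (D2 b X (E p a) + D b p (D a p X)) - D (\<tau> p a b) p X))) (at p)"
      unfolding \<tau>'[OF S(2)] by (simp only: D_def)
  qed
  then show "(\<lambda>y. \<tau> y b c) differentiable (at p)" using differentiable_def by blast
  let ?D\<tau> = "\<lambda>a b c. frechet_derivative (\<lambda>y. \<tau> y b c) (at p) (E p a)"
  \<comment> \<open>The term from differentiating \<open>inv (E y)\<close>, last in
    \<open>1\<close>, occurs in \<open>2\<close> as well and drops out. The remaining terms cancel
    in the cyclic sum: second derivatives by \<open>sym\<close>, products of first derivatives in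
    pairs.\<close>
  have e': "E p (?D\<tau> a b c) = E p (\<tau> p a (\<tau> p b c)) + D2 b (E p a) (E p c) + D b p (D c p (E p a))
      - D2 c (E p a) (E p b) - D c p (D b p (E p a)) - D a p (D b p (E p c)) + D a p (D c p (E p b))" for a b c
  proof -
    have "?D\<tau> a b c = inv (E p) ((D2 b (E p a) (E p c) + D b p (D c p (E p a)))
        - (D2 c (E p a) (E p b) + D c p (D b p (E p a))) - D (\<tau> p b c) p (E p a))"
      using fun_cong[OF frechet_derivative_at[OF d\<tau>[of b c]], of "E p a"] by simp
    then have 1: "E p (?D\<tau> a b c) = (D2 b (E p a) (E p c) + D b p (D c p (E p a)))
        - (D2 c (E p a) (E p b) + D c p (D b p (E p a))) - D (\<tau> p b c) p (E p a)"
      using bij[OF S(2)] by (simp add: bij_is_surj surj_f_inv_f)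
    have 2: "E p (\<tau> p a (\<tau> p b c)) = D a p (D b p (E p c) - D c p (E p b)) - D (\<tau> p b c) p (E p a)"
      using \<tau>[OF S(2)] by (simp add: D_def)
    show ?thesis unfolding 1 2 linear_diff[OF linD[OF S(2)]] by (simp add: algebra_simps)
  qed
  have "E p (?D\<tau> a b c + ?D\<tau> b c a + ?D\<tau> c a b)
      = E p (\<tau> p a (\<tau> p b c) + \<tau> p b (\<tau> p c a) + \<tau> p c (\<tau> p a b))"
    unfolding linear_add[OF lin[OF S(2)]] e'
    by (simp add: sym[of a "E p b" "E p c"] sym[of b "E p c" "E p a"] sym[of c "E p a" "E p b"])
  then show "?D\<tau> a b c + ?D\<tau> b c a + ?D\<tau> c a b
      = \<tau> p a (\<tau> p b c) + \<tau> p b (\<tau> p c a) + \<tau> p c (\<tau> p a b)"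
    using bij[OF S(2)] by (meson bij_is_inj injD)
qed

section \<open>Linear groups and their Lie algebras\<close>

locale linear_group =
  fixes G :: "('a::euclidean_space \<Rightarrow> 'a) set"
  assumes linear: "g \<in> G \<Longrightarrow> linear g" and bij: "g \<in> G \<Longrightarrow> bij g"
    and id: "id \<in> G" and comp: "g \<in> G \<Longrightarrow> h \<in> G \<Longrightarrow> g \<circ> h \<in> G" and inv: "g \<in> G \<Longrightarrow> inv g \<in> G"
begin

text \<open>Only the germ of the curve at \<open>0\<close> matters: for
  \<open>\<bar>t\<bar> \<ge> r\<close> it is replaced by \<open>id\<close>, since the definition
  asks for differentiability at \<open>0\<close> alone. Linearity of \<open>X\<close> is inherited
  from the maps \<open>\<gamma> t\<close>.\<close>

lemma lie_algebraI:
  assumes "r > 0" "\<And>t. \<bar>t\<bar> < r \<Longrightarrow> \<gamma> t \<in> G" "\<gamma> 0 = id"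
    and der: "\<And>a. ((\<lambda>t. \<gamma> t a) has_vector_derivative X a) (at 0)"
  shows "X \<in> lie_algebra G"
proof -
  define \<delta> where "\<delta> t = (if \<bar>t\<bar> < r then \<gamma> t else id)" for t
  have \<delta>: "\<delta> t \<in> G" "\<delta> 0 = id" for t using assms id by (auto simp: \<delta>_def)
  have ball: "t \<in> ball 0 r \<longleftrightarrow> \<bar>t\<bar> < r" for t :: real by (simp add: dist_real_def)
  have d: "((\<lambda>t. \<delta> t a) has_vector_derivative X a) (at 0)" for a
    by (rule has_vector_derivative_transform_within_open[OF der[of a], of "ball 0 r"])
      (use assms(1) ball in \<open>auto simp: \<delta>_def\<close>)
  have lin: "linear (\<delta> t)" for t using \<delta> linear by blast
  have "linear X"
  proof (rule linearI)
    show "X (a + b) = X a + X b" for a b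
      by (rule vector_derivative_unique_at[OF d])
        (use has_vector_derivative_add[OF d[of a] d[of b]] in \<open>simp add: linear_add[OF lin]\<close>)
    show "X (k *\<^sub>R a) = k *\<^sub>R X a" for k a
      by (rule vector_derivative_unique_at[OF d])
        (use bounded_linear.has_vector_derivative[OF bounded_linear_scaleR_right d[of a], of k]
         in \<open>simp add: linear_cmul[OF lin]\<close>)
  qed
  then show ?thesis using \<delta> d unfolding lie_algebra_def by blast
qed

lemma lie_algebra_zero: "(\<lambda>a. 0) \<in> lie_algebra G"
  by (rule lie_algebraI[of 1 "\<lambda>t. id"]) (auto simp: id)

text \<open>The pointwise product of two curves through \<open>id\<close> stays in \<open>G\<close>,
  and its velocity at \<open>0\<close> is the sum of the two velocities.\<close>

lemma lie_algebra_add: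
  assumes "X \<in> lie_algebra G" "Y \<in> lie_algebra G"
  shows "(\<lambda>a. X a + Y a) \<in> lie_algebra G"
proof -
  obtain \<gamma> where \<gamma>: "\<And>t. \<gamma> t \<in> G" "\<gamma> 0 = id" "\<And>a. ((\<lambda>t. \<gamma> t a) has_vector_derivative X a) (at (0::real))"
    using assms(1) unfolding lie_algebra_def by blast
  obtain \<delta> where \<delta>: "\<And>t. \<delta> t \<in> G" "\<delta> 0 = id" "\<And>a. ((\<lambda>t. \<delta> t a) has_vector_derivative Y a) (at (0::real))"
    using assms(2) unfolding lie_algebra_def by blast
  have "((\<lambda>t. (\<gamma> t \<circ> \<delta> t) a) has_vector_derivative X a + Y a) (at 0)" for a
  proof -
    have d: "(\<lambda>t. \<gamma> t b) differentiable (at 0)" for b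
      using \<gamma>(3) unfolding has_vector_derivative_def differentiable_def by blast
    have "frechet_derivative (\<lambda>t. \<gamma> t a) (at 0) = (\<lambda>h. h *\<^sub>R X a)"
      using frechet_derivative_at[OF \<gamma>(3)[unfolded has_vector_derivative_def]] by metis
    then show ?thesis
      using has_derivative_linear_family[OF open_UNIV UNIV_I linear[OF \<gamma>(1)] d
          \<delta>(3)[of a, unfolded has_vector_derivative_def]] \<gamma>(2) \<delta>(2)
      by (simp add: has_vector_derivative_def scaleR_add_right)
  qed
  then show ?thesis
    by (intro lie_algebraI[of 1 "\<lambda>t. \<gamma> t \<circ> \<delta> t"]) (auto simp: \<gamma> \<delta> comp)
qed

lemma lie_algebra_scaleR:
  assumes "X \<in> lie_algebra G"
  shows "(\<lambda>a. k *\<^sub>R X a) \<in> lie_algebra G"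
proof -
  obtain \<gamma> where \<gamma>: "\<And>t. \<gamma> t \<in> G" "\<gamma> 0 = id" "\<And>a. ((\<lambda>t. \<gamma> t a) has_vector_derivative X a) (at (0::real))"
    using assms(1) unfolding lie_algebra_def by blast
  have "((\<lambda>t. \<gamma> (k * t) a) has_vector_derivative k *\<^sub>R X a) (at 0)" for a
  proof -
    have "((\<lambda>t. k * t) has_vector_derivative k) (at 0)" by (auto intro!: derivative_eq_intros)
    from vector_diff_chain_at[OF this, of "\<lambda>t. \<gamma> t a" "X a"] \<gamma>(3)[of a] show ?thesis
      by (simp add: o_def)
  qed
  then show ?thesis
    by (intro lie_algebraI[of 1 "\<lambda>t. \<gamma> (k * t)"]) (auto simp: \<gamma>)
qed

lemma lie_algebra_diff:
  assumes "X \<in> lie_algebra G" "Y \<in> lie_algebra G"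
  shows "(\<lambda>a. X a - Y a) \<in> lie_algebra G"
  using lie_algebra_add[OF assms(1) lie_algebra_scaleR[OF assms(2), of "-1"]] by simp

section \<open>Cosets of the image of the Spencer map\<close>

lemma dual_tensor_add:
  assumes "\<alpha> \<in> dual_tensor (lie_algebra G)" "\<beta> \<in> dual_tensor (lie_algebra G)"
  shows "(\<lambda>x y. \<alpha> x y + \<beta> x y) \<in> dual_tensor (lie_algebra G)"
  using assms lie_algebra_add unfolding dual_tensor_def bilinear_def
  by (auto intro: linear_compose_add)

lemma dual_tensor_uminus:
  assumes "\<alpha> \<in> dual_tensor (lie_algebra G)"
  shows "(\<lambda>x y. - \<alpha> x y) \<in> dual_tensor (lie_algebra G)"
  using assms lie_algebra_scaleR[of _ "-1"] unfolding dual_tensor_def bilinear_def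
  by (auto intro: linear_compose_neg)

lemma coker_class_eqI:
  assumes "\<alpha> \<in> dual_tensor (lie_algebra G)" "\<And>x y. t x y = t' x y + spencer \<alpha> x y"
  shows "coker_class G t = coker_class G t'"
proof -
  have *: "coker_class G t \<subseteq> coker_class G t'"
    if \<alpha>: "\<alpha> \<in> dual_tensor (lie_algebra G)" and e: "\<And>x y. t x y = t' x y + spencer \<alpha> x y" for t t' \<alpha>
  proof
    fix z assume "z \<in> coker_class G t"
    then obtain \<beta> where \<beta>: "\<beta> \<in> dual_tensor (lie_algebra G)" "z = (\<lambda>x y. t x y + spencer \<beta> x y)"
      unfolding coker_class_def by blast
    then have "z = (\<lambda>x y. t' x y + spencer (\<lambda>x y. \<alpha> x y + \<beta> x y) x y)"
      by (auto simp: e spencer_def algebra_simps)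
    then show "z \<in> coker_class G t'"
      using dual_tensor_add[OF \<alpha> \<beta>(1)] unfolding coker_class_def by blast
  qed
  have e: "t' x y = t x y + spencer (\<lambda>x y. - \<alpha> x y) x y" for x y
    using assms(2)[of x y] by (simp add: spencer_def)
  show ?thesis
    using *[OF assms] *[OF dual_tensor_uminus[OF assms(1)] e] by (rule equalityI)
qed

lemma mem_coker_class: "t \<in> coker_class G t"
proof -
  have "(\<lambda>x y. 0) \<in> dual_tensor (lie_algebra G)"
    using lie_algebra_zero by (auto simp: dual_tensor_def bilinear_def module_hom_zero linear_zero)
  moreover have "t = (\<lambda>x y. t x y + spencer (\<lambda>x y. 0) x y)" by (simp add: spencer_def)
  ultimately show ?thesis unfolding coker_class_def by blast
qed

end

section \<open>Charts and frames\<close>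

locale smooth_manifold =
  fixes A :: "('m::{t2_space, second_countable_topology}, 'a::euclidean_space) chart set"
  assumes atlas: "smooth_atlas A"
begin

lemma chart_exists: obtains c where "c \<in> A" "x \<in> fst c"
  using atlas unfolding smooth_atlas_def by blast

lemma chart_homeomorphism:
  "c \<in> A \<Longrightarrow> homeomorphism (fst c) (snd c ` fst c) (snd c) (chart_inv c)"
  using atlas unfolding smooth_atlas_def by blast

lemma chart_inv_chart [simp]: "c \<in> A \<Longrightarrow> x \<in> fst c \<Longrightarrow> chart_inv c (snd c x) = x"
  using chart_homeomorphism by (auto simp: homeomorphism_def)

lemma open_chart_image:
  assumes "c \<in> A" "open U"
  shows "open (snd c ` (U \<inter> fst c))"
proof -
  have "open (snd c ` fst c)" using assms atlas unfolding smooth_atlas_def by blast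
  moreover have "continuous_on (snd c ` fst c) (chart_inv c)"
    using chart_homeomorphism[OF assms(1)] by (simp add: homeomorphism_def)
  ultimately have "open (snd c ` fst c \<inter> chart_inv c -` U)"
    using assms(2) continuous_open_preimage by blast
  moreover have "snd c ` fst c \<inter> chart_inv c -` U = snd c ` (U \<inter> fst c)"
    using assms(1) by (auto simp: image_iff)
  ultimately show ?thesis by simp
qed

lemma open_transition_domain: "c \<in> A \<Longrightarrow> d \<in> A \<Longrightarrow> open (snd c ` (fst c \<inter> fst d))"
  using open_chart_image[of c "fst d"] atlas unfolding smooth_atlas_def by (simp add: Int_commute)

lemma Ck_on_transition: "c \<in> A \<Longrightarrow> d \<in> A \<Longrightarrow> Ck_on k (snd c ` (fst c \<inter> fst d)) (transition c d)"
  using atlas unfolding smooth_atlas_def smooth_on_def by blast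

lemma transition_chart: "c \<in> A \<Longrightarrow> x \<in> fst c \<Longrightarrow> transition c d (snd c x) = snd d x"
  by (simp add: transition_def)

lemma has_derivative_transition:
  assumes "c \<in> A" "d \<in> A" "x \<in> fst c" "x \<in> fst d"
  shows "(transition c d has_derivative transition_deriv c d x) (at (snd c x))"
  unfolding transition_deriv_def
  by (rule Ck_on_has_derivative[OF open_transition_domain Ck_on_transition]) (use assms in auto)

lemma linear_transition_deriv:
  assumes "c \<in> A" "d \<in> A" "x \<in> fst c" "x \<in> fst d"
  shows "linear (transition_deriv c d x)"
  using has_derivative_linear[OF has_derivative_transition[OF assms]] .

lemma has_derivative_transition_deriv:
  assumes "c \<in> A" "d \<in> A" "x \<in> fst c" "x \<in> fst d"
  shows "((\<lambda>q. frechet_derivative (transition c d) (at q) Y) has_derivative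
    (\<lambda>X. transition_deriv2 c d x X Y)) (at (snd c x))"
  unfolding transition_deriv2_def
  by (rule Ck_on_has_derivative[OF open_transition_domain, of c d 0])
    (use assms Ck_on_transition[of c d 2] in \<open>auto simp: numeral_2_eq_2\<close>)

lemma transition_deriv2_sym:
  assumes "c \<in> A" "d \<in> A" "x \<in> fst c" "x \<in> fst d"
  shows "transition_deriv2 c d x X Y = transition_deriv2 c d x Y X"
  unfolding transition_deriv2_def
  by (rule mixed_derivatives_eq[OF open_transition_domain _ Ck_on_transition])
    (use assms in auto)

section \<open>Tangent vectors and frames\<close>

lemma tangent_spaceI:
  assumes "\<And>c d. c \<in> A \<Longrightarrow> d \<in> A \<Longrightarrow> x \<in> fst c \<Longrightarrow> x \<in> fst d \<Longrightarrow> v d = transition_deriv c d x (v c)"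
    and "\<And>c. \<not> (c \<in> A \<and> x \<in> fst c) \<Longrightarrow> v c = 0"
  shows "v \<in> tangent_space A x"
  using assms unfolding tangent_space_def by blast

lemma frames_transition:
  assumes "u \<in> frames A x" "c \<in> A" "d \<in> A" "x \<in> fst c" "x \<in> fst d"
  shows "u a d = transition_deriv c d x (u a c)"
proof -
  have "u a \<in> tangent_space A x" using assms(1) by (auto simp: frames_def bij_betw_def)
  then show ?thesis using assms unfolding tangent_space_def by blast
qed

lemma tangent_space_eqI:
  assumes "v \<in> tangent_space A x" "w \<in> tangent_space A x" "c \<in> A" "x \<in> fst c" "v c = w c"
  shows "v = w"
proof
  fix d
  show "v d = w d"
  proof (cases "d \<in> A \<and> x \<in> fst d")
    case True
    then have "v d = transition_deriv c d x (v c)" "w d = transition_deriv c d x (w c)"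
      using assms unfolding tangent_space_def by blast+
    then show ?thesis using assms(5) by simp
  next
    case False
    then have "v d = 0" "w d = 0" using assms(1,2) unfolding tangent_space_def by blast+
    then show ?thesis by simp
  qed
qed

lemma frame_linear: "u \<in> frames A x \<Longrightarrow> linear (\<lambda>a. u a c)"
  unfolding frames_def by blast

text \<open>A tangent vector is determined by its component in one chart, which gives injectivity;
  surjectivity follows because this is an endomorphism of a finite-dimensional space.\<close>

lemma frame_bij:
  assumes "u \<in> frames A x" "c \<in> A" "x \<in> fst c"
  shows "bij (\<lambda>a. u a c)"
proof -
  have "inj (\<lambda>a. u a c)"
  proof (rule injI)
    fix a b assume "u a c = u b c"
    moreover have "u a \<in> tangent_space A x" "u b \<in> tangent_space A x"
      using assms(1) by (auto simp: frames_def bij_betw_def)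
    ultimately have "u a = u b" using tangent_space_eqI assms(2,3) by blast
    then show "a = b" using assms(1) by (auto simp: frames_def bij_betw_def inj_def)
  qed
  then show ?thesis
    using linear_injective_imp_surjective[OF frame_linear[OF assms(1)]] by (simp add: bij_def)
qed

section \<open>Torsion of a linear connection\<close>

text \<open>The inhomogeneous terms in the transformation law of \<open>\<Gamma>\<close> are
  symmetric second derivatives and cancel under antisymmetrisation. So the torsion tensor lies in
  the tangent space, where \<open>inv u\<close> really inverts the frame.\<close>

lemma frame_torsion:
  assumes lc: "linear_connection A U \<Gamma>" and x: "x \<in> U" and u: "u \<in> frames A x" and c: "c \<in> A" "x \<in> fst c"
  shows "u (torsion A \<Gamma> (x, u) a b) c = \<Gamma> c x (u a c) (u b c) - \<Gamma> c x (u b c) (u a c)"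
proof -
  have "torsion_tensor A \<Gamma> x (u a) (u b) \<in> tangent_space A x"
  proof (rule tangent_spaceI)
    fix c d assume cd: "c \<in> A" "d \<in> A" "x \<in> fst c" "x \<in> fst d"
    have e: "\<Gamma> d x (transition_deriv c d x X) (transition_deriv c d x Y)
        = transition_deriv c d x (\<Gamma> c x X Y) - transition_deriv2 c d x X Y" for X Y
      using lc cd x unfolding linear_connection_def
      by (metis (no_types, lifting) IntI add_diff_cancel_left')
    show "torsion_tensor A \<Gamma> x (u a) (u b) d = transition_deriv c d x (torsion_tensor A \<Gamma> x (u a) (u b) c)"
      using cd transition_deriv2_sym[OF cd, of "u a c" "u b c"]
      by (simp add: torsion_tensor_def frames_transition[OF u cd] e linear_diff[OF linear_transition_deriv[OF cd]])
  qed (auto simp: torsion_tensor_def)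
  then have "u (inv u (torsion_tensor A \<Gamma> x (u a) (u b))) = torsion_tensor A \<Gamma> x (u a) (u b)"
    using u by (auto simp: frames_def bij_betw_def intro!: f_inv_into_f)
  then show ?thesis using c by (simp add: torsion_def torsion_tensor_def)
qed

text \<open>The derivative of the section cancels in the difference of two covariant derivatives,
  which is therefore algebraic. Read in the frame it takes values in the Lie algebra, and its
  antisymmetrisation is the difference of the torsions.\<close>

lemma torsion_difference:
  assumes G: "linear_group G"
    and con: "connection_on A G P U \<Gamma>" "connection_on A G P U' \<Gamma>'" and s: "local_section A P V s"
    and x: "x \<in> U" "x \<in> U'" "x \<in> V" and u: "s x \<in> frames A x"
  obtains \<alpha> where "\<alpha> \<in> dual_tensor (lie_algebra G)"
    "\<And>a b. torsion A \<Gamma> (x, s x) a b = torsion A \<Gamma>' (x, s x) a b + spencer \<alpha> a b"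
proof -
  interpret linear_group G by (rule G)
  obtain c where c: "c \<in> A" "x \<in> fst c" by (rule chart_exists)
  let ?u = "\<lambda>a. s x a c"
  have lin: "linear ?u" by (rule frame_linear[OF u])
  have inj: "?u a = ?u b \<longleftrightarrow> a = b" for a b using frame_bij[OF u c] unfolding bij_def inj_def by blast
  have "\<exists>\<xi>\<in>lie_algebra G. \<forall>a. \<Gamma> c x X (?u a) - \<Gamma>' c x X (?u a) = ?u (\<xi> a)" for X
  proof -
    obtain \<xi> where \<xi>: "\<xi> \<in> lie_algebra G" "\<And>a. cov_deriv_frame \<Gamma> s c x X a = ?u (\<xi> a)"
      using con(1) s c x unfolding connection_on_def by blast
    obtain \<xi>' where \<xi>': "\<xi>' \<in> lie_algebra G" "\<And>a. cov_deriv_frame \<Gamma>' s c x X a = ?u (\<xi>' a)"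
      using con(2) s c x unfolding connection_on_def by blast
    have "\<Gamma> c x X (?u a) - \<Gamma>' c x X (?u a) = ?u (\<xi> a - \<xi>' a)" for a
      unfolding linear_diff[OF lin] \<xi>(2)[symmetric] \<xi>'(2)[symmetric] cov_deriv_frame_def by simp
    then show ?thesis by (intro bexI[OF _ lie_algebra_diff[OF \<xi>(1) \<xi>'(1)]] allI)
  qed
  then obtain \<xi> where \<xi>: "\<And>X. \<xi> X \<in> lie_algebra G"
    "\<And>X a. \<Gamma> c x X (?u a) - \<Gamma>' c x X (?u a) = ?u (\<xi> X a)" by metis
  \<comment> \<open>Each \<open>\<xi> X\<close> was chosen separately; linearity in \<open>X\<close>
    is recovered because the injective frame determines \<open>\<xi> X\<close> from the bilinear
    \<open>\<Gamma>\<close> and \<open>\<Gamma>'\<close>.\<close>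
  define \<alpha> where "\<alpha> a = \<xi> (?u a)" for a
  have lc: "linear_connection A U \<Gamma>" "linear_connection A U' \<Gamma>'"
    using con by (auto simp: connection_on_def)
  then have bil: "bilinear (\<Gamma> c x)" "bilinear (\<Gamma>' c x)"
    using c x by (auto simp: linear_connection_def)
  have "linear (\<lambda>a. \<alpha> a b)" for b
  proof (rule linearI)
    show "\<alpha> (a + a') b = \<alpha> a b + \<alpha> a' b" for a a'
      by (rule iffD1[OF inj], unfold linear_add[OF lin] \<alpha>_def \<xi>(2)[symmetric])
        (simp add: bilinear_ladd[OF bil(1)] bilinear_ladd[OF bil(2)])
    show "\<alpha> (k *\<^sub>R a) b = k *\<^sub>R \<alpha> a b" for k a
      by (rule iffD1[OF inj], unfold linear_cmul[OF lin] \<alpha>_def \<xi>(2)[symmetric])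
        (simp add: bilinear_lmul[OF bil(1)] bilinear_lmul[OF bil(2)] scaleR_diff_right)
  qed
  moreover have "linear (\<alpha> a)" for a using \<xi>(1) by (auto simp: \<alpha>_def lie_algebra_def)
  ultimately have "\<alpha> \<in> dual_tensor (lie_algebra G)"
    using \<xi>(1) by (auto simp: dual_tensor_def bilinear_def \<alpha>_def)
  moreover have "torsion A \<Gamma> (x, s x) a b = torsion A \<Gamma>' (x, s x) a b + spencer \<alpha> a b" for a b
    by (rule iffD1[OF inj], unfold linear_add[OF lin] spencer_def linear_diff[OF lin] \<alpha>_def
        \<xi>(2)[symmetric] frame_torsion[OF lc(1) x(1) u c] frame_torsion[OF lc(2) x(2) u c]) simp
  ultimately show ?thesis using that by blast
qed

text \<open>By \<open>torsion_difference\<close> all connections yield the same coset, so the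
  \<open>THE\<close> in the definition is well defined and any connection may compute it.\<close>

lemma intrinsic_torsion_eq:
  assumes G: "linear_group G" and con: "connection_on A G P U \<Gamma>" and s: "local_section A P V s"
    and x: "x \<in> U" "x \<in> V" and u: "s x \<in> frames A x"
  shows "intrinsic_torsion A G P (x, s x) = coker_class G (torsion A \<Gamma> (x, s x))"
  unfolding intrinsic_torsion_def
proof (rule the_equality)
  show "\<exists>U \<Gamma>'. fst (x, s x) \<in> U \<and> connection_on A G P U \<Gamma>' \<and>
      coker_class G (torsion A \<Gamma> (x, s x)) = coker_class G (torsion A \<Gamma>' (x, s x))"
    using con x by auto
  fix \<tau> assume "\<exists>U \<Gamma>. fst (x, s x) \<in> U \<and> connection_on A G P U \<Gamma> \<and> \<tau> = coker_class G (torsion A \<Gamma> (x, s x))"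
  then obtain U' \<Gamma>' where U': "x \<in> U'" "connection_on A G P U' \<Gamma>'" "\<tau> = coker_class G (torsion A \<Gamma>' (x, s x))"
    by auto
  show "\<tau> = coker_class G (torsion A \<Gamma> (x, s x))"
    using torsion_difference[OF G U'(2) con s U'(1) x u] linear_group.coker_class_eqI[OF G] U'(3) by metis
qed

end

section \<open>The flat connection of a local section\<close>

text \<open>Solves \<open>\<nabla> (s a) = 0\<close> for the connection: \<open>Y\<close> is written
  as \<open>s x a c\<close>, and \<open>a\<close> is held fixed while the frame is
  differentiated.\<close>

definition flat_christoffel :: "('m \<Rightarrow> ('m, 'a::euclidean_space) frame) \<Rightarrow> ('m, 'a) christoffel" where
  "flat_christoffel s c x X Y =
     - frechet_derivative (\<lambda>y. s (chart_inv c y) (inv (\<lambda>a. s x a c) Y) c) (at (snd c x)) X"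

locale framed_open = smooth_manifold A
  for A :: "('m::{t2_space, second_countable_topology}, 'a::euclidean_space) chart set" +
  fixes U :: "'m set" and s :: "'m \<Rightarrow> ('m, 'a) frame"
  assumes open_U: "open U" and frame: "x \<in> U \<Longrightarrow> s x \<in> frames A x"
    and smooth: "c \<in> A \<Longrightarrow> smooth_on (snd c ` (U \<inter> fst c)) (\<lambda>y. s (chart_inv c y) a c)"
begin

lemma open_domain: "c \<in> A \<Longrightarrow> open (snd c ` (U \<inter> fst c))"
  by (rule open_chart_image[OF _ open_U])

lemma linear_local_frame: "c \<in> A \<Longrightarrow> y \<in> snd c ` (U \<inter> fst c) \<Longrightarrow> linear (\<lambda>a. s (chart_inv c y) a c)"
  by (auto intro!: frame_linear[OF frame])

lemma bij_local_frame: "c \<in> A \<Longrightarrow> y \<in> snd c ` (U \<inter> fst c) \<Longrightarrow> bij (\<lambda>a. s (chart_inv c y) a c)"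
  by (auto intro!: frame_bij[OF frame])

lemma has_derivative_local_frame:
  assumes "c \<in> A" "y \<in> snd c ` (U \<inter> fst c)"
  shows "((\<lambda>y. s (chart_inv c y) a c) has_derivative
    frechet_derivative (\<lambda>y. s (chart_inv c y) a c) (at y)) (at y)"
  by (rule Ck_on_has_derivative[OF open_domain[OF assms(1)] _ assms(2), where k=0])
    (use smooth[OF assms(1)] in \<open>unfold smooth_on_def, blast\<close>)

lemma differentiable_local_frame:
  assumes "c \<in> A" "y \<in> snd c ` (U \<inter> fst c)"
  shows "(\<lambda>y. s (chart_inv c y) a c) differentiable (at y)"
  using has_derivative_local_frame[OF assms] frechet_derivative_works by blast

lemma inv_frame: "c \<in> A \<Longrightarrow> x \<in> U \<Longrightarrow> x \<in> fst c \<Longrightarrow> inv (\<lambda>a. s x a c) (s x a c) = a"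
  by (rule inv_f_f[OF bij_is_inj[OF frame_bij[OF frame]]])

lemma frame_inv: "c \<in> A \<Longrightarrow> x \<in> U \<Longrightarrow> x \<in> fst c \<Longrightarrow> s x (inv (\<lambda>a. s x a c) X) c = X"
  using surj_f_inv_f[OF bij_is_surj[OF frame_bij[OF frame]]] by metis

lemma flat_christoffel_frame:
  assumes "c \<in> A" "x \<in> U" "x \<in> fst c"
  shows "flat_christoffel s c x X (s x a c) = - frechet_derivative (\<lambda>y. s (chart_inv c y) a c) (at (snd c x)) X"
  by (simp add: flat_christoffel_def inv_frame[OF assms])

lemma bilinear_flat_christoffel:
  assumes c: "c \<in> A" "x \<in> U" "x \<in> fst c"
  shows "bilinear (flat_christoffel s c x)"
proof -
  have x: "snd c x \<in> snd c ` (U \<inter> fst c)" using c by blast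
  have "linear (\<lambda>a. frechet_derivative (\<lambda>y. s (chart_inv c y) a c) (at (snd c x)) X)" for X
    by (rule linear_frechet_derivative_family[OF open_domain[OF c(1)] x linear_local_frame[OF c(1)]
          differentiable_local_frame[OF c(1) x]])
  from linear_compose[OF inj_linear_imp_inv_linear[OF frame_linear[OF frame[OF c(2)]]
        bij_is_inj[OF frame_bij[OF frame[OF c(2)] c(1,3)]]] this]
  have 1: "linear (\<lambda>Y. flat_christoffel s c x X Y)" for X
    unfolding flat_christoffel_def o_def by (rule linear_compose_neg)
  have "linear (\<lambda>X. flat_christoffel s c x X Y)" for Y
    unfolding flat_christoffel_def
    by (rule linear_compose_neg[OF has_derivative_linear[OF has_derivative_local_frame[OF c(1) x]]])
  with 1 show ?thesis by (simp add: bilinear_def)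
qed

lemma smooth_flat_christoffel:
  assumes c: "c \<in> A"
  shows "smooth_on (snd c ` (U \<inter> fst c)) (\<lambda>y. flat_christoffel s c (chart_inv c y) X Y)"
  unfolding smooth_on_def
proof
  fix k
  let ?S = "snd c ` (U \<inter> fst c)"
  let ?E = "\<lambda>y a. s (chart_inv c y) a c"
  note S = open_domain[OF c]
  have inv: "Ck_on k ?S (\<lambda>y. inv (?E y) Y)"
    using smooth_on_inverse_family[OF S linear_local_frame[OF c] bij_local_frame[OF c] smooth[OF c], of "\<lambda>y. Y"] Ck_on_const
    unfolding smooth_on_def by blast
  have "Ck_on k ?S (\<lambda>y. frechet_derivative (\<lambda>y. ?E y b) (at y) X)" for b
    using smooth[OF c, of b] unfolding smooth_on_def by (metis Ck_on.simps(2))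
  then have "Ck_on k ?S (\<lambda>y. (-1) *\<^sub>R (\<Sum>b\<in>Basis. (inv (?E y) Y \<bullet> b) *\<^sub>R frechet_derivative (\<lambda>y. ?E y b) (at y) X))"
    by (intro Ck_on_scaleR[OF S] Ck_on_const Ck_on_sum[OF S] inv Ck_on_bounded_linear[OF S bounded_linear_inner_left])
  then show "Ck_on k ?S (\<lambda>y. flat_christoffel s c (chart_inv c y) X Y)"
  proof (rule Ck_on_cong[OF S, rotated])
    fix y assume y: "y \<in> ?S"
    then have y': "snd c (chart_inv c y) = y" using c by auto
    show "(-1) *\<^sub>R (\<Sum>b\<in>Basis. (inv (?E y) Y \<bullet> b) *\<^sub>R frechet_derivative (\<lambda>y. ?E y b) (at y) X)
        = flat_christoffel s c (chart_inv c y) X Y"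
      unfolding flat_christoffel_def y'
      using frechet_derivative_linear_family[OF S y linear_local_frame[OF c] differentiable_local_frame[OF c y], where a="inv (?E y) Y" and X=X]
      by simp
  qed
qed

text \<open>The components of the field \<open>s a\<close> in two charts are related by the
  derivative of the transition map. Differentiating this relation along \<open>X\<close> gives the
  inhomogeneous law, as each symbol is minus a derivative of the frame.\<close>

lemma flat_christoffel_transition:
  assumes cd: "c \<in> A" "d \<in> A" "x \<in> U" "x \<in> fst c" "x \<in> fst d"
  shows "transition_deriv2 c d x X Y + flat_christoffel s d x (transition_deriv c d x X) (transition_deriv c d x Y)
    = transition_deriv c d x (flat_christoffel s c x X Y)"
proof -
  define a where "a = inv (\<lambda>a. s x a c) Y"
  have Y: "Y = s x a c" unfolding a_def using frame_inv cd by simp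
  have tY: "transition_deriv c d x Y = s x a d"
    unfolding Y by (rule frames_transition[OF frame[OF cd(3)] cd(1,2,4,5), symmetric])
  let ?T = "transition c d"
  let ?S = "snd c ` ((U \<inter> fst d) \<inter> fst c)"
  let ?Ec = "\<lambda>q. s (chart_inv c q) a c" and ?Ed = "\<lambda>q. s (chart_inv d q) a d"
  have open_d: "open (fst d)" using cd atlas unfolding smooth_atlas_def by blast
  have S: "open ?S" using open_chart_image cd(1) open_U open_d by blast
  have x: "snd c x \<in> ?S" "snd c x \<in> snd c ` (U \<inter> fst c)" "snd d x \<in> snd d ` (U \<inter> fst d)"
    using cd by auto
  have t: "transition c d (snd c x) = snd d x" using transition_chart cd by simp
  have lin: "linear (frechet_derivative ?T (at q))" if "q \<in> ?S" for q
    using that linear_transition_deriv[OF cd(1,2)] cd unfolding transition_deriv_def by auto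
  have eq: "?Ed (?T q) = frechet_derivative ?T (at q) (?Ec q)" if q: "q \<in> ?S" for q
  proof -
    obtain z where z: "q = snd c z" "z \<in> U" "z \<in> fst c" "z \<in> fst d" using q by blast
    then show ?thesis
      using frames_transition[OF frame[OF z(2)] cd(1,2) z(3,4), of a] transition_chart[OF cd(1) z(3), of d] cd
      by (simp add: transition_deriv_def)
  qed
  have "((\<lambda>q. ?Ed (?T q)) has_derivative
      (\<lambda>X. frechet_derivative ?Ed (at (snd d x)) (transition_deriv c d x X))) (at (snd c x))"
    by (rule has_derivative_compose[OF has_derivative_transition[OF cd(1,2,4,5)]])
      (use has_derivative_local_frame[OF cd(2) x(3)] t in simp)
  then have 1: "((\<lambda>q. frechet_derivative ?T (at q) (?Ec q)) has_derivative
      (\<lambda>X. frechet_derivative ?Ed (at (snd d x)) (transition_deriv c d x X))) (at (snd c x))"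
    by (rule has_derivative_transform_within_open[OF _ S x(1) eq])
  have D: "(\<lambda>q. frechet_derivative ?T (at q) Z) differentiable (at (snd c x))" for Z
    using has_derivative_transition_deriv[OF cd(1,2,4,5)] differentiable_def by blast
  have "((\<lambda>q. frechet_derivative ?T (at q) (?Ec q)) has_derivative
      (\<lambda>X. transition_deriv2 c d x X Y + transition_deriv c d x (frechet_derivative ?Ec (at (snd c x)) X))) (at (snd c x))"
    using has_derivative_linear_family[OF S x(1) lin D has_derivative_local_frame[OF cd(1) x(2)]]
    using Y cd by (simp add: transition_deriv_def transition_deriv2_def)
  then have "(\<lambda>X. frechet_derivative ?Ed (at (snd d x)) (transition_deriv c d x X)) =
      (\<lambda>X. transition_deriv2 c d x X Y + transition_deriv c d x (frechet_derivative ?Ec (at (snd c x)) X))"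
    by (rule has_derivative_unique[OF 1])
  from fun_cong[OF this, of X] show ?thesis
    unfolding tY flat_christoffel_frame[OF cd(2,3,5)]
    unfolding Y flat_christoffel_frame[OF cd(1,3,4)]
    by (simp add: linear_neg[OF linear_transition_deriv[OF cd(1,2,4,5)]])
qed

lemma linear_connection_flat: "linear_connection A U (flat_christoffel s)"
  unfolding linear_connection_def
  using open_U bilinear_flat_christoffel smooth_flat_christoffel flat_christoffel_transition by auto

text \<open>\<open>P\<close> enters only through the hypothesis that its sections differ from
  \<open>s\<close> by elements of \<open>G\<close>, so one connection serves both for a structure
  and for its extension to a larger group.\<close>

lemma connection_on_flat:
  assumes G: "linear_group G"
    and sec: "\<And>V s' x. local_section A P V s' \<Longrightarrow> x \<in> U \<Longrightarrow> x \<in> V \<Longrightarrow> \<exists>g\<in>G. s' x = s x \<circ> g"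
  shows "connection_on A G P U (flat_christoffel s)"
  unfolding connection_on_def
proof (intro conjI linear_connection_flat allI impI ballI)
  interpret linear_group G by (rule G)
  fix V s' c x X
  assume s': "local_section A P V s'" and c: "c \<in> A" and x: "x \<in> U \<inter> V \<inter> fst c"
  let ?S = "snd c ` ((U \<inter> V) \<inter> fst c)" and ?p = "snd c x"
  let ?E = "\<lambda>y a. s (chart_inv c y) a c" and ?E' = "\<lambda>y a. s' (chart_inv c y) a c"
  define h where "h y a = inv (?E y) (?E' y a)" for y a
  have V: "open V" using s' by (simp add: local_section_def)
  have S: "open ?S" using open_chart_image c open_U V by blast
  have p: "?p \<in> ?S" "?p \<in> snd c ` (U \<inter> fst c)" "?p \<in> snd c ` (V \<inter> fst c)" using x by auto
  have S_U: "y \<in> snd c ` (U \<inter> fst c)" if "y \<in> ?S" for y using that by auto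
  have h: "h y \<in> G \<and> (\<forall>a. ?E' y a = ?E y (h y a))" if y: "y \<in> ?S" for y
  proof -
    obtain z where z: "y = snd c z" "z \<in> U" "z \<in> V" "z \<in> fst c" using y by blast
    obtain g where g: "g \<in> G" "s' z = s z \<circ> g" using sec[OF s' z(2,3)] by blast
    have "h y = g" using z c g(2) by (auto simp: h_def inv_frame)
    then show ?thesis using g z c by simp
  qed
  have linE: "linear (?E y)" and bijE: "bij (?E y)" if "y \<in> ?S" for y
    using linear_local_frame[OF c S_U[OF that]] bij_local_frame[OF c S_U[OF that]] by auto
  note dE = differentiable_local_frame[OF c p(2)]
  have "smooth_on (snd c ` (V \<inter> fst c)) (\<lambda>y. ?E' y a)" for a
    using s' c unfolding local_section_def by blast
  then have dE': "((\<lambda>y. ?E' y a) has_derivative frechet_derivative (\<lambda>y. ?E' y a) (at ?p)) (at ?p)" for a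
    using Ck_on_has_derivative[OF open_chart_image[OF c V] _ p(3), of 0] unfolding smooth_on_def by blast
  have dh: "((\<lambda>y. h y a) has_derivative frechet_derivative (\<lambda>y. h y a) (at ?p)) (at ?p)" for a
    using has_derivative_inverse_family[OF S p(1) linE bijE dE dE'[of a]] frechet_derivative_works differentiable_def
    unfolding h_def by blast
  \<comment> \<open>The connection form of the section \<open>s h\<close> is the logarithmic
    derivative of \<open>h\<close>. Composing with \<open>inv (h ?p)\<close> moves the curve
    \<open>h (?p + t X)\<close> to one through \<open>id\<close> with velocity
    \<open>\<xi>\<close>.\<close>
  define \<xi> where "\<xi> a = inv (h ?p) (frechet_derivative (\<lambda>y. h y a) (at ?p) X)" for a
  have hp: "h ?p \<in> G" using h p by blast
  have inv_hp: "h ?p (inv (h ?p) a) = a" for a using bij[OF hp] by (simp add: bij_is_surj surj_f_inv_f)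
  have "\<xi> \<in> lie_algebra G"
  proof -
    have "isCont (\<lambda>t. ?p + t *\<^sub>R X) 0" by simp
    then have "\<forall>\<^sub>F t in at 0. ?p + t *\<^sub>R X \<in> ?S"
      using S p(1) by (auto simp: isCont_def dest: topological_tendstoD)
    then obtain r where r: "r > 0" "\<And>t. \<bar>t\<bar> < r \<Longrightarrow> t \<noteq> 0 \<Longrightarrow> ?p + t *\<^sub>R X \<in> ?S"
      unfolding eventually_at by (auto simp: dist_real_def)
    then have r': "?p + t *\<^sub>R X \<in> ?S" if "\<bar>t\<bar> < r" for t
      using that p(1) by (cases "t = 0") auto
    show ?thesis
    proof (rule lie_algebraI[OF r(1), of "\<lambda>t. inv (h ?p) \<circ> h (?p + t *\<^sub>R X)"])
      show "inv (h ?p) \<circ> h (?p + t *\<^sub>R X) \<in> G" if "\<bar>t\<bar> < r" for t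
        using comp inv hp h r'[OF that] by blast
      show "inv (h ?p) \<circ> h (?p + 0 *\<^sub>R X) = id" using bij[OF hp] by (simp add: bij_is_inj)
      fix a
      have lin: "bounded_linear (inv (h ?p))" using linear[OF inv[OF hp]] linear_conv_bounded_linear by blast
      have "((\<lambda>t. h (?p + t *\<^sub>R X) a) has_derivative
          (\<lambda>t. frechet_derivative (\<lambda>y. h y a) (at ?p) (t *\<^sub>R X))) (at 0)"
        by (rule has_derivative_compose[where f="\<lambda>t. ?p + t *\<^sub>R X" and g="\<lambda>y. h y a"])
          (use dh in \<open>auto intro!: derivative_eq_intros\<close>)
      then have "((\<lambda>t. h (?p + t *\<^sub>R X) a) has_vector_derivative
          frechet_derivative (\<lambda>y. h y a) (at ?p) X) (at 0)"
        using linear_cmul[OF has_derivative_linear[OF dh]] by (simp add: has_vector_derivative_def)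
      from bounded_linear.has_vector_derivative[OF lin this]
      show "((\<lambda>t. (inv (h ?p) \<circ> h (?p + t *\<^sub>R X)) a) has_vector_derivative \<xi> a) (at 0)"
        by (simp add: \<xi>_def)
    qed
  qed
  moreover have "cov_deriv_frame (flat_christoffel s) s' c x X a = s' x (\<xi> a) c" for a
  proof -
    have ex: "s' x z c = s x (h ?p z) c" for z using h[OF p(1)] c x by auto
    have "((\<lambda>y. ?E y (h y a)) has_derivative (\<lambda>X. frechet_derivative (\<lambda>y. ?E y (h ?p a)) (at ?p) X
        + ?E ?p (frechet_derivative (\<lambda>y. h y a) (at ?p) X))) (at ?p)"
      by (rule has_derivative_linear_family[OF S p(1) linE dE dh])
    then have "((\<lambda>y. ?E' y a) has_derivative (\<lambda>X. frechet_derivative (\<lambda>y. ?E y (h ?p a)) (at ?p) X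
        + ?E ?p (frechet_derivative (\<lambda>y. h y a) (at ?p) X))) (at ?p)"
      by (rule has_derivative_transform_within_open[OF _ S p(1)]) (use h in auto)
    from fun_cong[OF frechet_derivative_at[OF this], of X]
    have "frechet_derivative (\<lambda>y. ?E' y a) (at ?p) X = frechet_derivative (\<lambda>y. ?E y (h ?p a)) (at ?p) X
        + s x (frechet_derivative (\<lambda>y. h y a) (at ?p) X) c" using c x by simp
    moreover have "flat_christoffel s c x X (s' x a c) = - frechet_derivative (\<lambda>y. ?E y (h ?p a)) (at ?p) X"
      unfolding ex by (rule flat_christoffel_frame) (use c x in auto)
    ultimately show ?thesis unfolding cov_deriv_frame_def ex \<xi>_def inv_hp by simp
  qed
  ultimately show "\<exists>\<xi>\<in>lie_algebra G. \<forall>a. cov_deriv_frame (flat_christoffel s) s' c x X a = s' x (\<xi> a) c"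
    by blast
qed

lemma flat_torsion_cyclic:
  assumes c: "c \<in> A" "x \<in> U" "x \<in> fst c"
  defines "\<tau> \<equiv> \<lambda>y. torsion A (flat_christoffel s) (chart_inv c y, s (chart_inv c y))"
    and "p \<equiv> snd c x"
  shows "(\<lambda>y. \<tau> y a b) differentiable (at p)"
    and "frechet_derivative (\<lambda>y. \<tau> y b d) (at p) (s x a c) + frechet_derivative (\<lambda>y. \<tau> y d a) (at p) (s x b c)
      + frechet_derivative (\<lambda>y. \<tau> y a b) (at p) (s x d c) =
      \<tau> p a (\<tau> p b d) + \<tau> p b (\<tau> p d a) + \<tau> p d (\<tau> p a b)"
proof -
  let ?E = "\<lambda>y a. s (chart_inv c y) a c" and ?S = "snd c ` (U \<inter> fst c)"
  have p: "p \<in> ?S" using c by (auto simp: p_def)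
  have C: "Ck_on 2 ?S (\<lambda>y. ?E y a)" for a using smooth[OF c(1)] unfolding smooth_on_def by blast
  have \<tau>: "?E y (\<tau> y a b) = frechet_derivative (\<lambda>y. ?E y a) (at y) (?E y b)
      - frechet_derivative (\<lambda>y. ?E y b) (at y) (?E y a)" if y: "y \<in> ?S" for y a b
  proof -
    obtain z where z: "y = snd c z" "z \<in> U" "z \<in> fst c" using y by blast
    then show ?thesis
      using frame_torsion[OF linear_connection_flat z(2) frame[OF z(2)] c(1) z(3), of a b] c
      by (simp add: \<tau>_def flat_christoffel_frame)
  qed
  note * = cyclic_identity_structure_functions[where E="?E" and \<tau>=\<tau>, OF open_domain[OF c(1)] p
      linear_local_frame[OF c(1)] bij_local_frame[OF c(1)] C \<tau>]
  show "(\<lambda>y. \<tau> y a b) differentiable (at p)" by (rule *(1))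
  show "frechet_derivative (\<lambda>y. \<tau> y b d) (at p) (s x a c) + frechet_derivative (\<lambda>y. \<tau> y d a) (at p) (s x b c)
      + frechet_derivative (\<lambda>y. \<tau> y a b) (at p) (s x d c) =
      \<tau> p a (\<tau> p b d) + \<tau> p b (\<tau> p d a) + \<tau> p d (\<tau> p a b)"
    using *(2)[where a=a and b=b and c=d] c by (simp add: p_def)
qed

end

section \<open>Quaternions\<close>

lemma vector_4 [simp]:
  "(vector [a, b, c, d] :: 'a::zero ^ 4) $ 1 = a" "(vector [a, b, c, d] :: 'a ^ 4) $ 2 = b"
  "(vector [a, b, c, d] :: 'a ^ 4) $ 3 = c" "(vector [a, b, c, d] :: 'a ^ 4) $ 4 = d"
  unfolding vector_def by simp_all

lemmas quat_simps = vec_eq_iff forall_4 forall_3 qmult_def qcnj_def of_imH_def imH_def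

definition qone :: quat where "qone = vector [1, 0, 0, 0]"

lemma qmult_assoc: "qmult (qmult a b) c = qmult a (qmult b c)"
  by (simp add: quat_simps algebra_simps)

lemma qmult_one [simp]: "qmult a qone = a" "qmult qone a = a"
  by (simp_all add: quat_simps qone_def)

lemma qcnj_qmult: "qcnj (qmult a b) = qmult (qcnj b) (qcnj a)"
  by (simp add: quat_simps algebra_simps)

lemma qcnj_qone [simp]: "qcnj qone = qone"
  by (simp add: quat_simps qone_def)

lemma qcnj_eq_0_iff [simp]: "qcnj a = 0 \<longleftrightarrow> a = 0"
  by (simp add: quat_simps)

lemma qmult_scaleR: "qmult (k *\<^sub>R a) b = k *\<^sub>R qmult a b" "qmult a (k *\<^sub>R b) = k *\<^sub>R qmult a b"
  by (simp_all add: quat_simps algebra_simps)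

lemma qmult_add: "qmult (a + a') b = qmult a b + qmult a' b" "qmult a (b + b') = qmult a b + qmult a b'"
  by (simp_all add: quat_simps algebra_simps)

lemma norm_quat: "(norm (a::quat))\<^sup>2 = (a$1)\<^sup>2 + (a$2)\<^sup>2 + (a$3)\<^sup>2 + (a$4)\<^sup>2"
  by (simp add: norm_eq_sqrt_inner inner_vec_def sum_4 power2_eq_square)

lemma qmult_qcnj: "qmult a (qcnj a) = (norm a)\<^sup>2 *\<^sub>R qone" "qmult (qcnj a) a = (norm a)\<^sup>2 *\<^sub>R qone"
  by (simp_all add: norm_quat, simp_all add: quat_simps qone_def power2_eq_square algebra_simps)

lemma qone_ne_0 [simp]: "qone \<noteq> 0"
  by (simp add: quat_simps qone_def)

lemma qinv_qmult [simp]: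
  assumes "a \<noteq> 0" shows "qmult (qinv a) a = qone" "qmult a (qinv a) = qone"
  using assms by (simp_all add: qinv_def qmult_scaleR qmult_qcnj)

lemma qinv_ne_0 [simp]: "a \<noteq> 0 \<Longrightarrow> qinv a \<noteq> 0"
  by (simp add: qinv_def)

lemma qmult_ne_0: "a \<noteq> 0 \<Longrightarrow> b \<noteq> 0 \<Longrightarrow> qmult a b \<noteq> 0"
  by (metis qinv_qmult(1) qmult_assoc qmult_one(1) qmult_scaleR(1) qone_ne_0 scaleR_zero_left qmult_scaleR(2))

lemma qinv_qinv [simp]: "a \<noteq> 0 \<Longrightarrow> qinv (qinv a) = a"
  by (metis qinv_ne_0 qinv_qmult(1) qmult_assoc qmult_one)

text \<open>Here \<open>q\<close> stands for the inverse of the quaternion \<open>p\<close> in the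
  definition of \<open>SpnH\<close>: right multiplication by \<open>q\<close> is the action on
  \<open>V\<close>, and this map is the action on \<open>W\<close>.\<close>

definition imH_conj :: "quat \<Rightarrow> W \<Rightarrow> W" where
  "imH_conj q w = imH (qmult (qmult (qcnj q) (of_imH w)) q)"

lemma of_imH_conj: "of_imH (imH_conj q w) = qmult (qmult (qcnj q) (of_imH w)) q"
  by (simp add: imH_conj_def quat_simps algebra_simps)

lemma imH_of_imH [simp]: "imH (of_imH w) = w"
  by (simp add: quat_simps)

lemma imH_conj_imH_conj: "imH_conj q (imH_conj p w) = imH_conj (qmult p q) w"
  by (metis imH_of_imH of_imH_conj qcnj_qmult qmult_assoc)

lemma imH_conj_qone [simp]: "imH_conj qone w = w"
  by (simp add: imH_conj_def)

lemma linear_imH_conj: "linear (imH_conj q)"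
  by (rule linearI; simp add: imH_conj_def quat_simps algebra_simps)

lemma imH_conj_0 [simp]: "imH_conj q 0 = 0"
  using linear_0[OF linear_imH_conj] .

text \<open>The quaternionic norm is multiplicative, so the map scales lengths by the square of
  \<open>norm q\<close>; the structure groups thus act on \<open>W\<close> by similarities.\<close>

lemma inner_imH_conj: "imH_conj q w \<bullet> imH_conj q w' = (norm q) ^ 4 * (w \<bullet> w')"
proof -
  have "norm q ^ 4 = ((norm q)\<^sup>2)\<^sup>2" by simp
  then show ?thesis
    unfolding norm_quat
    by (simp add: imH_conj_def inner_vec_def sum_3 quat_simps power2_eq_square algebra_simps)
qed

text \<open>The Euclidean adjoint of multiplication by a quaternion is multiplication by its
  conjugate on the same side, which moves the conjugate to the left factor.\<close>

lemma W_action_eq: "W_action p = imH_conj (qinv p)"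
  unfolding W_action_def
  by (rule adjoint_unique)
    (simp add: imH_action_def imH_conj_def inner_vec_def sum_3 quat_simps algebra_simps)

section \<open>Hypercomplex structure\<close>

definition J :: "3 \<Rightarrow> ('n::finite) V \<Rightarrow> 'n V" where
  "J s v = scale_right v (of_imH (axis s 1))"

lemma scale_right_nth [simp]: "scale_right v q $ j = qmult (v $ j) q"
  by (simp add: scale_right_def)

lemma scale_right_scale_right: "scale_right (scale_right v p) q = scale_right v (qmult p q)"
  by (simp add: vec_eq_iff[where 'b='a] qmult_assoc)

lemma scale_right_qone [simp]: "scale_right v qone = v"
  by (simp add: vec_eq_iff[where 'b='a])

lemma linear_scale_right: "linear (\<lambda>v. scale_right v q)"
  by (rule linearI; subst vec_eq_iff; simp add: qmult_add qmult_scaleR)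

lemma scale_right_add_right: "scale_right v (p + q) = scale_right v p + scale_right v q"
  and scale_right_scaleR_right: "scale_right v (k *\<^sub>R q) = k *\<^sub>R scale_right v q"
  by (subst vec_eq_iff; simp add: qmult_add qmult_scaleR)+

lemma linear_J: "linear (J s)"
  unfolding J_def by (rule linear_scale_right)

lemmas J_add = linear_add[OF linear_J] and J_diff = linear_diff[OF linear_J]
  and J_scaleR = linear_cmul[OF linear_J] and J_neg = linear_neg[OF linear_J]

text \<open>Right multiplications compose in reverse order: \<open>J 1 (J 2 v)\<close> is
  \<open>v (j i) = - v k\<close>. The signs of the mixed products are therefore opposite to those of
  the quaternion units.\<close>

lemma J_mult:
  "J 1 (J 1 v) = - v" "J 2 (J 2 v) = - v" "J 3 (J 3 v) = - v"
  "J 1 (J 2 v) = - J 3 v" "J 2 (J 1 v) = J 3 v" "J 2 (J 3 v) = - J 1 v"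
  "J 3 (J 2 v) = J 1 v" "J 3 (J 1 v) = - J 2 v" "J 1 (J 3 v) = J 2 v"
  unfolding J_def scale_right_scale_right
  by (subst vec_eq_iff; simp add: quat_simps axis_def)+

lemma J_J: "J s (J s v) = - v"
  using exhaust_3[of s] by (auto simp: J_mult)

lemma J_anticommute: "r \<noteq> s \<Longrightarrow> J r (J s v) = - J s (J r v)"
  using exhaust_3[of r] exhaust_3[of s] by (auto simp: J_mult)

lemma inner_J: "J s x \<bullet> y = - (x \<bullet> J s y)"
proof -
  have "qmult a (of_imH (axis s 1)) \<bullet> b = - (a \<bullet> qmult b (of_imH (axis s 1)))" for a b
    using exhaust_3[of s] by (auto simp: inner_vec_def sum_4 quat_simps axis_def)
  then show ?thesis by (simp add: inner_vec_def[where 'b='a] J_def sum_negf)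
qed

lemma scale_right_expand: "scale_right v q = (q$1) *\<^sub>R v + (q$2) *\<^sub>R J 1 v + (q$3) *\<^sub>R J 2 v + (q$4) *\<^sub>R J 3 v"
proof -
  have q: "q = (q$1) *\<^sub>R qone + (q$2) *\<^sub>R of_imH (axis 1 1) + (q$3) *\<^sub>R of_imH (axis 2 1) + (q$4) *\<^sub>R of_imH (axis 3 1)"
    by (simp add: quat_simps qone_def axis_def)
  show ?thesis
    by (subst q) (simp only: J_def scale_right_add_right scale_right_scaleR_right scale_right_qone)
qed

lemma omega_eq: "omega s x y = J s x \<bullet> y"
proof -
  have "(if s = 1 then wedge4 1 2 a b - wedge4 3 4 a b
     else if s = 2 then wedge4 1 3 a b + wedge4 2 4 a b
     else wedge4 1 4 a b - wedge4 2 3 a b) = qmult a (of_imH (axis s 1)) \<bullet> b" for a b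
    using exhaust_3[of s] by (auto simp: inner_vec_def sum_4 quat_simps axis_def wedge4_def algebra_simps)
  then show ?thesis by (simp add: omega_def inner_vec_def[where 'b='a] J_def)
qed

lemma contract_omega_eq: "contract_omega s v = J s v"
  unfolding contract_omega_def omega_eq by (rule euclidean_representation)

lemma scale_right_of_imH: "scale_right v (of_imH w) = (\<Sum>s\<in>UNIV. (w $ s) *\<^sub>R J s v)"
  by (simp add: scale_right_expand sum_3 of_imH_def)

section \<open>The \<open>W\<close>-valued form and the compact symplectic group\<close>

definition imH_form :: "('n::finite) V \<Rightarrow> 'n V \<Rightarrow> W" where
  "imH_form x y = (\<chi> s. J s x \<bullet> y)"

lemma Theta0_eq: "Theta0 a b = (0, imH_form (fst a) (fst b))"
  by (simp add: Theta0_def imH_form_def omega_eq vec_eq_iff axis_def if_distrib cong: if_cong)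

lemma bounded_bilinear_imH_form: "bounded_bilinear (imH_form :: ('n::finite) V \<Rightarrow> _)"
  unfolding bilinear_conv_bounded_bilinear[symmetric] bilinear_def
  by (intro conjI allI; rule linearI)
    (simp_all add: imH_form_def vec_eq_iff inner_add_left inner_add_right J_add J_scaleR)

text \<open>Together with \<open>imH_form_Sp\<close> this expresses the invariance of
  \<open>Theta0\<close> under \<open>SpnH\<close>. Summation over the factors of \<open>V\<close>
  reduces it to one pair of quaternions.\<close>

lemma imH_form_scale_right: "imH_form (scale_right x q) (scale_right y q) = imH_conj q (imH_form x y)"
proof -
  have q: "(\<chi> s. qmult (qmult a q) (of_imH (axis s 1)) \<bullet> qmult b q) =
    imH_conj q (\<chi> s. qmult a (of_imH (axis s 1)) \<bullet> b)" for a b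
    by (simp add: imH_conj_def inner_vec_def sum_4 quat_simps axis_def algebra_simps)
  have e: "imH_form x y = (\<Sum>j\<in>UNIV. (\<chi> s. qmult (x$j) (of_imH (axis s 1)) \<bullet> (y$j)))" for x y :: "'a V"
    by (simp add: imH_form_def vec_eq_iff J_def inner_vec_def[where 'b='a])
  show ?thesis unfolding e linear_sum[OF linear_imH_conj] by (simp add: q)
qed

lemma Sp_J: "g \<in> Sp \<Longrightarrow> g (J s v) = J s (g v)"
  by (simp add: Sp_def J_def)

lemma imH_form_Sp: "g \<in> Sp \<Longrightarrow> imH_form (g x) (g y) = imH_form x y"
  unfolding imH_form_def by (simp add: Sp_J[symmetric]) (simp add: Sp_def orthogonal_transformation_def)

lemma SpI:
  assumes "linear g" "\<And>v. norm (g v) = norm v" "\<And>s v. g (J s v) = J s (g v)"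
  shows "g \<in> Sp"
  using assms by (simp add: Sp_def orthogonal_transformation scale_right_expand linear_add linear_cmul)

lemma Sp_linear: "g \<in> Sp \<Longrightarrow> linear g" and Sp_bij: "g \<in> Sp \<Longrightarrow> bij g"
  by (auto simp: Sp_def orthogonal_transformation_linear orthogonal_transformation_bij)

lemma Sp_id: "id \<in> Sp"
  by (auto simp: Sp_def id_def)

lemma Sp_comp: "g \<in> Sp \<Longrightarrow> h \<in> Sp \<Longrightarrow> g \<circ> h \<in> Sp"
  by (auto simp: Sp_def orthogonal_transformation_compose)

lemma Sp_inv: assumes "g \<in> Sp" shows "inv g \<in> Sp"
proof -
  have "inv g (scale_right v q) = scale_right (inv g v) q" for v q
  proof -
    have "g (inv g v) = v" for v using Sp_bij[OF assms] by (simp add: bij_is_surj surj_f_inv_f)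
    then have "g (scale_right (inv g v) q) = scale_right v q" using assms by (simp add: Sp_def)
    then show ?thesis using Sp_bij[OF assms] by (metis bij_is_inj inv_f_f)
  qed
  then show ?thesis using assms by (simp add: Sp_def orthogonal_transformation_inv)
qed

section \<open>The structure groups\<close>

definition sp_act :: "(('n::finite) V \<Rightarrow> 'n V) \<Rightarrow> quat \<Rightarrow> 'n T \<Rightarrow> 'n T" where
  "sp_act g q = (\<lambda>(v, w). (scale_right (g v) q, imH_conj q w))"

lemma SpnH_eq: "(SpnH :: ('n::finite T \<Rightarrow> 'n T) set) = {sp_act g q | g q. g \<in> Sp \<and> q \<noteq> 0}"
proof -
  have "(SpnH :: ('n T \<Rightarrow> 'n T) set) = {sp_act g (qinv p) | g p. g \<in> Sp \<and> p \<noteq> 0}"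
    by (simp add: SpnH_def sp_act_def W_action_eq)
  also have "\<dots> = {sp_act g q | g q. g \<in> Sp \<and> q \<noteq> 0}"
  proof (intro equalityI subsetI)
    fix f :: "'n T \<Rightarrow> 'n T" assume "f \<in> {sp_act g q | g q. g \<in> Sp \<and> q \<noteq> 0}"
    then obtain g q where f: "f = sp_act g q" "g \<in> Sp" "q \<noteq> 0" by blast
    then have "f = sp_act g (qinv (qinv q))" "qinv q \<noteq> 0" by simp_all
    with f(2) show "f \<in> {sp_act g (qinv p) | g p. g \<in> Sp \<and> p \<noteq> 0}" by blast
  qed (use qinv_ne_0 in blast)
  finally show ?thesis .
qed

lemma sp_act_comp: "h \<in> Sp \<Longrightarrow> g \<in> Sp \<Longrightarrow> sp_act g q \<circ> sp_act h p = sp_act (g \<circ> h) (qmult p q)"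
  by (auto simp: sp_act_def fun_eq_iff imH_conj_imH_conj scale_right_scale_right Sp_def)

lemma linear_sp_act: assumes "g \<in> Sp" shows "linear (sp_act g q)"
  by (rule linearI)
    (auto simp: sp_act_def linear_add[OF Sp_linear[OF assms]] linear_cmul[OF Sp_linear[OF assms]]
      linear_add[OF linear_scale_right] linear_cmul[OF linear_scale_right]
      linear_add[OF linear_imH_conj] linear_cmul[OF linear_imH_conj])

lemma sp_act_id [simp]: "sp_act id qone = id"
  by (auto simp: sp_act_def)

text \<open>The common form of both groups, so that the group axioms are verified once:
  \<open>E\<close> consists of all linear maps for \<open>B_group\<close> and is \<open>EH\<close>
  for \<open>K_group\<close>.\<close>

definition semidirect :: "(W \<Rightarrow> ('n::finite) V) set \<Rightarrow> ('n T \<Rightarrow> 'n T) set" where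
  "semidirect E = {unipotent \<eta> \<circ> sp_act g q | \<eta> g q. \<eta> \<in> E \<and> g \<in> Sp \<and> q \<noteq> 0}"

lemma B_group_eq: "B_group = semidirect {\<eta>. linear \<eta>}" and K_group_eq: "K_group = semidirect EH"
  by (auto simp: B_group_def K_group_def semidirect_def SpnH_eq)

lemma unipotent_conj:
  assumes "q \<noteq> 0" "g \<in> Sp"
  shows "sp_act g q \<circ> unipotent \<eta> = unipotent (\<lambda>w. scale_right (g (\<eta> (imH_conj (qinv q) w))) q) \<circ> sp_act g q"
  using assms by (auto simp: fun_eq_iff sp_act_def unipotent_def imH_conj_imH_conj
      linear_add[OF Sp_linear] linear_add[OF linear_scale_right])

text \<open>Unipotent factors multiply by adding their \<open>\<eta>\<close>, and conjugation by
  \<open>sp_act g q\<close> changes \<open>\<eta>\<close> as in \<open>unipotent_conj\<close>. So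
  the group axioms come down to additive closure of \<open>E\<close> and stability under this
  conjugation.\<close>

lemma linear_group_semidirect:
  fixes E :: "(W \<Rightarrow> ('n::finite) V) set"
  assumes lin: "\<And>\<eta>. \<eta> \<in> E \<Longrightarrow> linear \<eta>" and zero: "(\<lambda>w. 0) \<in> E"
    and add: "\<And>\<eta> \<eta>'. \<eta> \<in> E \<Longrightarrow> \<eta>' \<in> E \<Longrightarrow> (\<lambda>w. \<eta> w + \<eta>' w) \<in> E"
    and neg: "\<And>\<eta>. \<eta> \<in> E \<Longrightarrow> (\<lambda>w. - \<eta> w) \<in> E"
    and conj: "\<And>\<eta> g q. \<eta> \<in> E \<Longrightarrow> g \<in> Sp \<Longrightarrow> q \<noteq> 0 \<Longrightarrow>
      (\<lambda>w. scale_right (g (\<eta> (imH_conj (qinv q) w))) q) \<in> E"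
  shows "linear_group (semidirect E)"
proof -
  have u0: "unipotent (\<lambda>w. 0) = (id :: 'n T \<Rightarrow> 'n T)" by (auto simp: unipotent_def)
  have uu: "unipotent \<eta> \<circ> unipotent \<eta>' = (unipotent (\<lambda>w. \<eta> w + \<eta>' w) :: 'n T \<Rightarrow> 'n T)" for \<eta> \<eta>'
    by (auto simp: unipotent_def)
  have id: "id \<in> semidirect E"
    using zero Sp_id u0 sp_act_id qone_ne_0 unfolding semidirect_def
    by (metis (mono_tags, lifting) comp_id mem_Collect_eq)
  have comp: "f \<circ> f' \<in> semidirect E" if ff': "f \<in> semidirect E" "f' \<in> semidirect E" for f f'
  proof -
    obtain \<eta> g q where f: "f = unipotent \<eta> \<circ> sp_act g q" "\<eta> \<in> E" "g \<in> Sp" "q \<noteq> 0"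
      using ff'(1) unfolding semidirect_def by blast
    obtain \<eta>' g' q' where f': "f' = unipotent \<eta>' \<circ> sp_act g' q'" "\<eta>' \<in> E" "g' \<in> Sp" "q' \<noteq> 0"
      using ff'(2) unfolding semidirect_def by blast
    have "f \<circ> f' = unipotent \<eta> \<circ> (sp_act g q \<circ> unipotent \<eta>') \<circ> sp_act g' q'"
      by (simp add: f(1) f'(1) o_assoc)
    also have "\<dots> = (unipotent \<eta> \<circ> unipotent (\<lambda>w. scale_right (g (\<eta>' (imH_conj (qinv q) w))) q))
        \<circ> (sp_act g q \<circ> sp_act g' q')"
      by (simp add: unipotent_conj[OF f(4,3)] o_assoc)
    also have "\<dots> = unipotent (\<lambda>w. \<eta> w + scale_right (g (\<eta>' (imH_conj (qinv q) w))) q) \<circ> sp_act (g \<circ> g') (qmult q' q)"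
      by (simp add: uu sp_act_comp[OF f'(3) f(3)])
    finally show ?thesis
      unfolding semidirect_def
      using add[OF f(2) conj[OF f'(2) f(3,4)]] Sp_comp[OF f(3) f'(3)] qmult_ne_0[OF f'(4) f(4)] by blast
  qed
  have inv: "\<exists>f'\<in>semidirect E. f \<circ> f' = id \<and> f' \<circ> f = id" if f': "f \<in> semidirect E" for f
  proof -
    obtain \<eta> g q where f: "f = unipotent \<eta> \<circ> sp_act g q" "\<eta> \<in> E" "g \<in> Sp" "q \<noteq> 0"
      using f' unfolding semidirect_def by blast
    let ?h = "sp_act (inv g) (qinv q)" and ?u = "unipotent (\<lambda>w. - \<eta> w)"
    have "g \<circ> inv g = id" using Sp_bij[OF f(3)] surj_iff bij_is_surj by blast
    then have h: "sp_act g q \<circ> ?h = id" "?h \<circ> sp_act g q = id"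
      using sp_act_comp[OF Sp_inv[OF f(3)] f(3)] sp_act_comp[OF f(3) Sp_inv[OF f(3)]] f(4) Sp_bij[OF f(3)]
      by (simp_all add: bij_is_inj)
    have u: "unipotent \<eta> \<circ> ?u = (id :: 'n T \<Rightarrow> 'n T)" "?u \<circ> unipotent \<eta> = (id :: 'n T \<Rightarrow> 'n T)"
      by (simp_all add: uu u0)
    have "?h \<circ> ?u \<in> semidirect E"
      unfolding unipotent_conj[OF qinv_ne_0[OF f(4)] Sp_inv[OF f(3)]] semidirect_def
      using conj[OF neg[OF f(2)] Sp_inv[OF f(3)] qinv_ne_0[OF f(4)]] Sp_inv[OF f(3)] qinv_ne_0[OF f(4)] by blast
    moreover have "f \<circ> (?h \<circ> ?u) = id" "(?h \<circ> ?u) \<circ> f = id"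
    proof -
      have "f \<circ> (?h \<circ> ?u) = unipotent \<eta> \<circ> (sp_act g q \<circ> ?h) \<circ> ?u" by (simp only: f(1) o_assoc)
      then show "f \<circ> (?h \<circ> ?u) = id" by (simp only: h u comp_id)
      have "(?h \<circ> ?u) \<circ> f = ?h \<circ> (?u \<circ> unipotent \<eta>) \<circ> sp_act g q" by (simp only: f(1) o_assoc)
      then show "(?h \<circ> ?u) \<circ> f = id" by (simp only: h u comp_id)
    qed
    ultimately show ?thesis by blast
  qed
  show ?thesis
  proof (rule linear_group.intro)
    show "f \<in> semidirect E \<Longrightarrow> linear f" for f
    proof -
      assume "f \<in> semidirect E"
      then obtain \<eta> g q where f: "f = unipotent \<eta> \<circ> sp_act g q" "\<eta> \<in> E" "g \<in> Sp"
        unfolding semidirect_def by blast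
      have "linear (unipotent \<eta>)"
        using lin[OF f(2)] by (intro linearI) (auto simp: unipotent_def linear_add linear_cmul scaleR_add_right)
      then show "linear f" unfolding f(1) using linear_compose linear_sp_act[OF f(3)] by blast
    qed
    show "f \<in> semidirect E \<Longrightarrow> bij f" for f using inv o_bij by metis
    show "f \<in> semidirect E \<Longrightarrow> inv f \<in> semidirect E" for f using inv inv_unique_comp by metis
  qed (use id comp in auto)
qed

lemma linear_group_B: "linear_group (B_group :: ('n::finite T \<Rightarrow> 'n T) set)"
  unfolding B_group_eq
proof (rule linear_group_semidirect; clarsimp)
  show "linear (\<lambda>w. (0 :: 'n V))" by (simp add: linear_zero)
  show "linear (\<lambda>w. \<eta> w + \<eta>' w)" if "linear \<eta>" "linear \<eta>'" for \<eta> \<eta>' :: "W \<Rightarrow> 'n V"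
    using that by (rule linear_compose_add)
  show "linear (\<lambda>w. - \<eta> w)" if "linear \<eta>" for \<eta> :: "W \<Rightarrow> 'n V"
    using that by (rule linear_compose_neg)
  show "linear (\<lambda>w. scale_right (g (\<eta> (imH_conj (qinv q) w))) q)" if "linear \<eta>" "g \<in> Sp" for \<eta> :: "W \<Rightarrow> 'n V" and g q
    using linear_compose[OF linear_compose[OF linear_compose[OF linear_imH_conj that(1)] Sp_linear[OF that(2)]] linear_scale_right]
    by (simp add: o_def)
qed

text \<open>Contraction with \<open>omega s\<close> is right multiplication by an imaginary unit, so
  the sum over \<open>s\<close> assembles to right multiplication by the imaginary quaternion with
  coordinates \<open>w\<close>.\<close>

lemma EH_eq: "EH = {\<lambda>w. scale_right v (of_imH w) | v. True}"
  by (simp add: EH_def contract_omega_eq scale_right_of_imH)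

lemma linear_EH: "\<eta> \<in> EH \<Longrightarrow> linear \<eta>"
proof -
  have "linear of_imH" by (rule linearI) (simp_all add: quat_simps)
  then show "\<eta> \<in> EH \<Longrightarrow> linear \<eta>"
    unfolding EH_eq by (auto intro!: linearI simp: linear_add linear_cmul scale_right_add_right scale_right_scaleR_right)
qed

lemma linear_group_K: "linear_group (K_group :: ('n::finite T \<Rightarrow> 'n T) set)"
  unfolding K_group_eq
proof (rule linear_group_semidirect)
  note lin = linear_add[OF linear_scale_right] linear_neg[OF linear_scale_right] linear_0[OF linear_scale_right]
  show "linear \<eta>" if "\<eta> \<in> EH" for \<eta> :: "W \<Rightarrow> 'n V" by (rule linear_EH[OF that])
  show "(\<lambda>w. 0 :: 'n V) \<in> EH" unfolding EH_eq using lin(3) by fastforce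
  show "(\<lambda>w. \<eta> w + \<eta>' w) \<in> EH" if "\<eta> \<in> EH" "\<eta>' \<in> EH" for \<eta> \<eta>' :: "W \<Rightarrow> 'n V"
    using that unfolding EH_eq by (auto simp: lin(1)[symmetric])
  show "(\<lambda>w. - \<eta> w) \<in> EH" if "\<eta> \<in> EH" for \<eta> :: "W \<Rightarrow> 'n V"
    using that unfolding EH_eq by (auto simp: lin(2)[symmetric])
  show "(\<lambda>w. scale_right (g (\<eta> (imH_conj (qinv q) w))) q) \<in> EH"
    if \<eta>: "\<eta> \<in> EH" and g: "g \<in> Sp" and q: "q \<noteq> 0" for \<eta> :: "W \<Rightarrow> 'n V" and g q
  proof -
    obtain v where v: "\<eta> = (\<lambda>w. scale_right v (of_imH w))" using \<eta> unfolding EH_eq by blast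
    \<comment> \<open>The right factor of the conjugation cancels against \<open>q\<close>, and the
      left factor is absorbed into the vector, so the map is again of the form in
      \<open>EH_eq\<close>.\<close>
    have "scale_right (g (\<eta> (imH_conj (qinv q) w))) q
        = scale_right (scale_right (g v) (qcnj (qinv q))) (of_imH w)" for w
    proof -
      have "qmult (of_imH (imH_conj (qinv q) w)) q = qmult (qcnj (qinv q)) (of_imH w)"
        using q by (simp add: of_imH_conj qmult_assoc)
      then show ?thesis using g by (simp add: v Sp_def scale_right_scale_right)
    qed
    then show ?thesis unfolding EH_eq by blast
  qed
qed

lemma K_group_subset_B_group: "K_group \<subseteq> B_group"
  unfolding K_group_eq B_group_eq semidirect_def using linear_EH by blast

section \<open>Lie algebras of the structure groups\<close>

text \<open>Restricting to \<open>V\<close> and projecting to \<open>W\<close> removes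
  \<open>\<eta>\<close>. Along a differentiable curve the block diagonal part is therefore
  differentiable, although \<open>g\<close> and \<open>q\<close> are chosen separately at each
  time.\<close>

lemma semidirect_components:
  assumes "f \<in> semidirect E" "\<And>\<eta>. \<eta> \<in> E \<Longrightarrow> linear \<eta>"
  obtains g q where "g \<in> Sp" "q \<noteq> 0" "\<And>v. f (v, 0) = (scale_right (g v) q, 0)"
    "\<And>w. snd (f (0, w)) = imH_conj q w"
    "sp_act g q = (\<lambda>(v, w). (fst (f (v, 0)), snd (f (0, w))))"
proof -
  obtain \<eta> g q where f: "f = unipotent \<eta> \<circ> sp_act g q" "\<eta> \<in> E" "g \<in> Sp" "q \<noteq> 0"
    using assms(1) unfolding semidirect_def by blast
  have "\<eta> 0 = 0" using linear_0[OF assms(2)[OF f(2)]] .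
  then show ?thesis
    by (intro that[OF f(3,4)]) (auto simp: f(1) unipotent_def sp_act_def)
qed

lemma zero_in_EH: "(\<lambda>w. 0) \<in> (EH :: (W \<Rightarrow> ('n::finite) V) set)"
  unfolding EH_eq using linear_0[OF linear_scale_right] by fastforce

lemma sp_act_in_K_group: "g \<in> Sp \<Longrightarrow> q \<noteq> 0 \<Longrightarrow> sp_act g q \<in> K_group"
proof -
  assume "g \<in> Sp" "q \<noteq> 0"
  moreover have "sp_act g q = unipotent (\<lambda>w. 0) \<circ> sp_act g q" by (auto simp: unipotent_def)
  ultimately show ?thesis unfolding K_group_eq semidirect_def using zero_in_EH by blast
qed

text \<open>Each conclusion is the derivative at \<open>0\<close> of a relation along a curve in the
  group: \<open>V\<close> is preserved, the block diagonal part lies in \<open>K_group\<close>,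
  \<open>imH_form\<close> is equivariant, and the action on \<open>W\<close> is conformal.\<close>

lemma lie_algebra_B_group:
  fixes X :: "('n::finite) T \<Rightarrow> 'n T"
  assumes "X \<in> lie_algebra B_group"
  defines "A \<equiv> \<lambda>v. fst (X (v, 0))" and "C \<equiv> \<lambda>w. snd (X (0, w))"
  shows "snd (X (v, 0)) = 0"
    and "(\<lambda>(v, w). (A v, C w)) \<in> lie_algebra K_group"
    and "C (imH_form v v') = imH_form (A v) v' + imH_form v (A v')"
    and "\<exists>\<mu>. \<forall>w w'. C w \<bullet> w' + w \<bullet> C w' = \<mu> * (w \<bullet> w')"
proof -
  obtain \<gamma> where \<gamma>: "\<And>t. \<gamma> t \<in> B_group" "\<gamma> 0 = id" "\<And>a. ((\<lambda>t. \<gamma> t a) has_vector_derivative X a) (at (0::real))"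
    using assms(1) unfolding lie_algebra_def by blast
  define At where "At t v = fst (\<gamma> t (v, 0))" for t v
  define Ct where "Ct t w = snd (\<gamma> t (0, w))" for t w
  have comps: "\<exists>g\<in>Sp. \<exists>q. q \<noteq> 0 \<and> (\<forall>v. \<gamma> t (v, 0) = (scale_right (g v) q, 0)) \<and> (\<forall>w. Ct t w = imH_conj q w)
      \<and> sp_act g q = (\<lambda>(v, w). (At t v, Ct t w))" for t
  proof -
    obtain g q where "g \<in> Sp" "q \<noteq> 0" "\<And>v. \<gamma> t (v, 0) = (scale_right (g v) q, 0)"
      "\<And>w. snd (\<gamma> t (0, w)) = imH_conj q w"
      "sp_act g q = (\<lambda>(v, w). (fst (\<gamma> t (v, 0)), snd (\<gamma> t (0, w))))"
      by (rule semidirect_components[OF \<gamma>(1)[of t, unfolded B_group_eq]]) auto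
    then show ?thesis unfolding At_def Ct_def by blast
  qed
  have dA: "((\<lambda>t. At t v) has_vector_derivative A v) (at 0)" for v
    unfolding At_def A_def by (rule bounded_linear.has_vector_derivative[OF bounded_linear_fst \<gamma>(3)])
  have dC: "((\<lambda>t. Ct t w) has_vector_derivative C w) (at 0)" for w
    unfolding Ct_def C_def by (rule bounded_linear.has_vector_derivative[OF bounded_linear_snd \<gamma>(3)])
  have A0: "At 0 v = v" "Ct 0 w = w" for v w by (simp_all add: At_def Ct_def \<gamma>(2))
  have "snd (\<gamma> t (v, 0)) = 0" for t using comps[of t] by auto
  then have "((\<lambda>t. 0) has_vector_derivative snd (X (v, 0))) (at (0::real))"
    using bounded_linear.has_vector_derivative[OF bounded_linear_snd \<gamma>(3)[of "(v, 0)"]] by simp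
  then show "snd (X (v, 0)) = 0"
    using has_vector_derivative_const by (rule vector_derivative_unique_at)
  show "(\<lambda>(v, w). (A v, C w)) \<in> lie_algebra K_group"
  proof (rule linear_group.lie_algebraI[OF linear_group_K, of 1 "\<lambda>t (v, w). (At t v, Ct t w)"])
    show "(\<lambda>(v, w). (At t v, Ct t w)) \<in> K_group" for t
      using comps[of t] sp_act_in_K_group by metis
    show "(\<lambda>(v, w). (At 0 v, Ct 0 w)) = id" by (auto simp: A0)
    show "((\<lambda>t. case a of (v, w) \<Rightarrow> (At t v, Ct t w)) has_vector_derivative (case a of (v, w) \<Rightarrow> (A v, C w))) (at 0)" for a
      using has_vector_derivative_Pair[OF dA dC] by (cases a) simp
  qed simp
  show "C (imH_form v v') = imH_form (A v) v' + imH_form v (A v')"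
  proof (rule vector_derivative_unique_at[OF dC])
    have "imH_form (At t v) (At t v') = Ct t (imH_form v v')" for t
      using comps[of t] by (auto simp: At_def imH_form_scale_right imH_form_Sp)
    then show "((\<lambda>t. Ct t (imH_form v v')) has_vector_derivative imH_form (A v) v' + imH_form v (A v')) (at 0)"
      using bounded_bilinear.has_vector_derivative[OF bounded_bilinear_imH_form dA[of v] dA[of v']]
      by (simp add: A0 add.commute)
  qed
  have d: "((\<lambda>t. Ct t w \<bullet> Ct t w') has_vector_derivative C w \<bullet> w' + w \<bullet> C w') (at 0)" for w w'
    using bounded_bilinear.has_vector_derivative[OF bounded_bilinear_inner dC[of w] dC[of w']]
    by (simp add: A0 add.commute)
  let ?e = "axis 1 1 :: W"
  \<comment> \<open>Writing the conformal factor through the unit vector \<open>?e\<close> makes it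
    visibly differentiable in \<open>t\<close>.\<close>
  have scal: "Ct t w \<bullet> Ct t w' = (Ct t ?e \<bullet> Ct t ?e) * (w \<bullet> w')" for t w w'
    using comps[of t] by (auto simp: inner_imH_conj inner_axis_axis)
  have "C w \<bullet> w' + w \<bullet> C w' = (C ?e \<bullet> ?e + ?e \<bullet> C ?e) * (w \<bullet> w')" for w w'
  proof (rule vector_derivative_unique_at[OF d])
    show "((\<lambda>t. Ct t w \<bullet> Ct t w') has_vector_derivative (C ?e \<bullet> ?e + ?e \<bullet> C ?e) * (w \<bullet> w')) (at 0)"
      unfolding scal[of _ w w']
      by (rule bounded_linear.has_vector_derivative[OF bounded_linear_mult_left d])
  qed
  then show "\<exists>\<mu>. \<forall>w w'. C w \<bullet> w' + w \<bullet> C w' = \<mu> * (w \<bullet> w')" by blast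
qed

section \<open>Elements of the Lie algebra of \<open>K_group\<close>\<close>

lemma EH_in_lie_algebra_K:
  fixes p :: "('n::finite) V"
  shows "(\<lambda>(v, w). (scale_right p (of_imH w), 0)) \<in> lie_algebra K_group"
proof (rule linear_group.lie_algebraI[OF linear_group_K, of 1 "\<lambda>t. unipotent (\<lambda>w. scale_right (t *\<^sub>R p) (of_imH w))"])
  show "unipotent (\<lambda>w. scale_right (t *\<^sub>R p) (of_imH w)) \<in> K_group" for t
  proof -
    have "unipotent (\<lambda>w. scale_right (t *\<^sub>R p) (of_imH w)) = unipotent (\<lambda>w. scale_right (t *\<^sub>R p) (of_imH w)) \<circ> sp_act id qone"
      by simp
    then show ?thesis unfolding K_group_eq semidirect_def EH_eq using Sp_id qone_ne_0 by blast
  qed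
  note lin = linear_cmul[OF linear_scale_right] linear_0[OF linear_scale_right]
  show "unipotent (\<lambda>w. scale_right (0 *\<^sub>R p) (of_imH w)) = id" by (auto simp: unipotent_def lin)
  fix a :: "'n T"
  obtain v w where a: "a = (v, w)" by (cases a)
  have "((\<lambda>t. (v + t *\<^sub>R scale_right p (of_imH w), w)) has_vector_derivative (scale_right p (of_imH w), 0)) (at 0)"
    by (auto intro!: derivative_eq_intros has_vector_derivative_Pair)
  then show "((\<lambda>t. unipotent (\<lambda>w. scale_right (t *\<^sub>R p) (of_imH w)) a) has_vector_derivative
      (case a of (v, w) \<Rightarrow> (scale_right p (of_imH w), 0))) (at 0)"
    by (simp add: a unipotent_def lin)
qed simp

lemma sp_in_lie_algebra_K:
  fixes X :: "('n::finite) V \<Rightarrow> 'n V"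
  assumes X: "linear X" and skew: "\<And>x y. X x \<bullet> y = - (x \<bullet> X y)" and comm: "\<And>s v. X (J s v) = J s (X v)"
  shows "(\<lambda>(v, w). (X v, 0)) \<in> lie_algebra K_group"
proof -
  define P where "P t v = v + t *\<^sub>R X v" for t :: real and v
  have P: "linear (P t)" for t
    unfolding P_def using X by (intro linearI) (simp_all add: linear_add linear_cmul algebra_simps)
  \<comment> \<open>Skewness gives \<open>v \<bullet> X v = 0\<close>, so the length of
    \<open>P t v\<close> is even in \<open>t\<close> and at least that of \<open>v\<close>. Evenness
    makes \<open>g t\<close> below an isometry, the bound makes \<open>P t\<close>
    invertible.\<close>
  have norm_P: "norm (P (- t) v) = norm (P t v)" "norm v \<le> norm (P t v)" for t v
  proof -
    have "v \<bullet> X v = 0" "X v \<bullet> v = 0" using skew[of v v] by (simp_all add: inner_commute)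
    then have "P t v \<bullet> P t v = v \<bullet> v + t * t * (X v \<bullet> X v)" for t
      by (simp add: P_def inner_add_left inner_add_right)
    then show "norm (P (- t) v) = norm (P t v)" "norm v \<le> norm (P t v)"
      by (simp_all add: norm_eq_sqrt_inner)
  qed
  have inj: "inj (P t)" for t
    using norm_P(2)[of _ t] linear_injective_0[OF P] by (metis norm_le_zero_iff norm_zero)
  have bij: "bij (P t)" for t
    using linear_injective_imp_surjective[OF P inj] inj by (simp add: bij_def)
  have PJ: "P t (J s v) = J s (P t v)" for t s v by (simp add: P_def comm J_add J_scaleR)
  have Pinv: "P t (inv (P t) v) = v" for t v using bij by (simp add: bij_is_surj surj_f_inv_f)
  \<comment> \<open>The Cayley transform of \<open>t X\<close> replaces the exponential: only its derivative at \<open>0\<close> matters.\<close>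
  define g where "g t v = P (t / 2) (inv (P (- (t / 2))) v)" for t v
  have "g t \<in> Sp" for t
  proof (rule SpI)
    have "linear (inv (P (- (t / 2))))" by (rule inj_linear_imp_inv_linear[OF P inj])
    from linear_compose[OF this P] show "linear (g t)" unfolding g_def o_def .
    show "norm (g t v) = norm v" for v
      using norm_P(1)[of "- (t / 2)"] by (simp add: g_def Pinv)
    have "inv (P t) (J s v) = J s (inv (P t) v)" for t s v
    proof -
      have "P t (J s (inv (P t) v)) = J s v" by (simp add: PJ Pinv)
      then show ?thesis using inj by (metis inv_f_f)
    qed
    then show "g t (J s v) = J s (g t v)" for s v by (simp add: g_def PJ)
  qed
  moreover have P0: "P 0 = id" by (auto simp: P_def)
  then have g0: "g 0 = id" by (auto simp: g_def)
  moreover have "((\<lambda>t. g t v) has_vector_derivative X v) (at 0)" for v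
  proof -
    have dP: "((\<lambda>t. P (k * t) v) has_derivative (\<lambda>t. (k * t) *\<^sub>R X v)) (at 0)" for k v
      unfolding P_def by (auto intro!: derivative_eq_intros)
    then have fP: "frechet_derivative (\<lambda>t. P (k * t) v) (at 0) = (\<lambda>t. (k * t) *\<^sub>R X v)"
      and diffP: "(\<lambda>t. P (k * t) v) differentiable (at 0)" for k v
      using frechet_derivative_at[OF dP] differentiable_def by metis+
    note d1 = has_derivative_inverse_family[OF open_UNIV UNIV_I P bij diffP has_derivative_const, of "-1/2" v]
    note d2 = has_derivative_linear_family[OF open_UNIV UNIV_I P diffP d1, of "1/2"]
    show ?thesis
      using d2 unfolding fP by (simp add: P0 g_def has_vector_derivative_def scaleR_add_left[symmetric])
  qed
  ultimately have g: "\<And>t. g t \<in> Sp" "g 0 = id" "\<And>v. ((\<lambda>t. g t v) has_vector_derivative X v) (at 0)"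
    by auto
  show ?thesis
  proof (rule linear_group.lie_algebraI[OF linear_group_K, of 1 "\<lambda>t. sp_act (g t) qone"])
    show "sp_act (g t) qone \<in> K_group" for t
      by (rule sp_act_in_K_group[OF g(1) qone_ne_0])
    show "((\<lambda>t. sp_act (g t) qone a) has_vector_derivative (case a of (v, w) \<Rightarrow> (X v, 0))) (at 0)" for a
      using has_vector_derivative_Pair[OF g(3) has_vector_derivative_const] by (cases a) (simp add: sp_act_def)
  qed (simp_all add: g(2))
qed

section \<open>The algebraic core\<close>

text \<open>In terms of \<open>M s = - J s (H s)\<close>, the hypothesis with \<open>r = s\<close>
  says that the skew parts of all \<open>M s\<close> agree, and with \<open>r \<noteq> s\<close>
  that \<open>M s - M r\<close> anticommutes with the third unit. Such maps differ from a common
  \<open>A\<close> by symmetric maps \<open>Q s\<close> commuting with \<open>J s\<close> and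
  anticommuting with the other two units.\<close>

lemma hypercomplex_decomposition:
  fixes H :: "3 \<Rightarrow> ('n::finite) V \<Rightarrow> 'n V"
  assumes lin: "\<And>s. linear (H s)"
    and sym: "\<And>a b. \<exists>\<kappa>. \<forall>r s. (J r (H s a) \<bullet> b + J r a \<bullet> H s b) + (J s (H r a) \<bullet> b + J s a \<bullet> H r b)
      = (if r = s then \<kappa> else 0)"
  obtains A X where "linear A" "\<And>s. linear (X s)" "\<And>s v. H s v = J s (A v) + X s v"
    "\<And>s x y. X s x \<bullet> y = - (x \<bullet> X s y)" "\<And>r s v. X s (J r v) = J r (X s v)"
proof -
  define M where "M s v = - J s (H s v)" for s v
  have linM: "linear (M s)" for s
    unfolding M_def using linear_compose_neg[OF linear_compose[OF lin linear_J]] by (simp add: o_def)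
  have HM: "H s v = J s (M s v)" for s v by (simp add: M_def J_neg J_J)
  define N where "N r v = M r v - M 1 v" for r v
  have linN: "linear (N r)" for r unfolding N_def using linear_compose_sub[OF linM linM] .
  \<comment> \<open>The value \<open>\<kappa>\<close> for \<open>r = s\<close> does not depend on
    \<open>s\<close>, so all \<open>M s\<close> have the same skew part.\<close>
  have diff_sym: "(M s a - M r a) \<bullet> b = a \<bullet> (M s b - M r b)" for r s a b
  proof -
    obtain \<kappa> where \<kappa>: "\<And>s. (J s (H s a) \<bullet> b + J s a \<bullet> H s b) + (J s (H s a) \<bullet> b + J s a \<bullet> H s b) = \<kappa>"
      using sym[of a b] by metis
    have "2 * (a \<bullet> M s b - M s a \<bullet> b) = \<kappa>" for s
      using \<kappa>[of s] inner_J[of s a "H s b"] by (simp add: M_def)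
    from this[of r] this[of s] show ?thesis by (simp add: inner_diff_left inner_diff_right)
  qed
  \<comment> \<open>For distinct indices the right side of \<open>sym\<close> is zero. Moving the
    \<open>J\<close> across the inner product and using \<open>diff_sym\<close> turns this bilinear
    identity into one between operators.\<close>
  have anti: "J r (J s (M s a - M r a)) = - (M s (J r (J s a)) - M r (J r (J s a)))" if "r \<noteq> s" for r s a
  proof -
    have "(J r (J s (M s a - M r a)) + (M s (J r (J s a)) - M r (J r (J s a)))) \<bullet> b = 0" for b
    proof -
      have 0: "(J r (H s a) \<bullet> b + J r a \<bullet> H s b) + (J s (H r a) \<bullet> b + J s a \<bullet> H r b) = 0"
        using sym[of a b] that by auto
      have 1: "J s (H r a) = - J r (J s (M r a))" using that by (simp add: HM J_anticommute[of s r])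
      have 2: "J r a \<bullet> H s b = J r (J s a) \<bullet> M s b"
        using inner_J[of s "J r a" "M s b"] that by (simp add: HM J_anticommute[of s r])
      have 3: "J s a \<bullet> H r b = - (J r (J s a) \<bullet> M r b)"
        using inner_J[of r "J s a" "M r b"] by (simp add: HM)
      have "J r (J s (M s a - M r a)) \<bullet> b + J r (J s a) \<bullet> (M s b - M r b) = 0"
        using 0 unfolding 1 2 3 HM[of s a] by (simp add: J_diff inner_diff_left inner_diff_right)
      then show ?thesis unfolding diff_sym[symmetric] by (simp add: inner_add_left)
    qed
    then show ?thesis using inner_eq_zero_iff eq_neg_iff_add_eq_0 by metis
  qed
  have N2: "N 2 (J 3 v) = - J 3 (N 2 v)" for v
    using anti[of 1 2 v] linear_neg[OF linN[of 2]] by (simp add: N_def J_mult linear_neg[OF linM] algebra_simps)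
  have N3: "N 3 (J 2 v) = - J 2 (N 3 v)" for v
    using anti[of 1 3 v] by (simp add: N_def J_mult J_diff algebra_simps)
  have N32: "N 3 (J 1 v) - N 2 (J 1 v) = - J 1 (N 3 v - N 2 v)" for v
    using anti[of 2 3 v] by (simp add: N_def J_mult linear_neg[OF linM] J_diff algebra_simps)
  \<comment> \<open>\<open>N 2\<close> anticommutes with \<open>J 3\<close>, so it splits into a part commuting with \<open>J 1\<close> only, which is \<open>P\<close>, and a part
    commuting with \<open>J 2\<close> only. Symmetric maps of these types lie in \<open>J 1 sp(n)\<close> and \<open>J 2 sp(n)\<close>.\<close>
  define P where "P v = (1/2) *\<^sub>R (N 2 v - J 1 (N 2 (J 1 v)))" for v
  have linP: "linear P" unfolding P_def
    by (rule linearI) (simp_all add: J_add J_scaleR linear_add[OF linN] linear_cmul[OF linN] algebra_simps)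
  have P_sym: "P a \<bullet> b = a \<bullet> P b" for a b
  proof -
    have "J 1 (N 2 (J 1 a)) \<bullet> b = a \<bullet> J 1 (N 2 (J 1 b))"
      using diff_sym[where s=2 and r=1 and a="J 1 a" and b="J 1 b"] inner_J[of 1 "N 2 (J 1 a)" b] inner_J[of 1 a "N 2 (J 1 b)"]
      by (simp add: N_def)
    moreover have "N 2 a \<bullet> b = a \<bullet> N 2 b" using diff_sym[where s=2 and r=1 and a=a and b=b] by (simp add: N_def)
    ultimately show ?thesis by (simp add: P_def inner_diff_left inner_diff_right)
  qed
  have P1: "P (J 1 v) = J 1 (P v)" for v
    by (simp add: P_def J_scaleR J_diff J_J linear_neg[OF linN] J_neg)
  have P3: "P (J 3 v) = - J 3 (P v)" for v
  proof -
    have "J 1 (N 2 (J 1 (J 3 v))) = - J 3 (J 1 (N 2 (J 1 v)))"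
      using J_anticommute[of 1 3 v] J_anticommute[of 1 3 "N 2 (J 1 v)"]
      by (simp add: linear_neg[OF linN] J_neg N2)
    then show ?thesis by (simp add: P_def N2 J_scaleR J_diff algebra_simps)
  qed
  have via13: "J 2 v = J 1 (J 3 v)" for v by (simp add: J_mult)
  have P2: "P (J 2 v) = - J 2 (P v)" for v
    unfolding via13 by (simp add: P1 P3 J_neg)
  \<comment> \<open>Adding \<open>P\<close> to \<open>M 1\<close> leaves the remainders
    \<open>- P\<close>, \<open>N 2 - P\<close> and \<open>N 3 - P\<close>, each of which commutes
    with exactly the \<open>J\<close> of its own index by the relations below, in the sense that it
    anticommutes with the others.\<close>
  define A where "A v = M 1 v + P v" for v
  define Q where "Q s v = M s v - A v" for s v
  have linA: "linear A" unfolding A_def by (rule linear_compose_add[OF linM linP])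
  have linQ: "linear (Q s)" for s unfolding Q_def by (rule linear_compose_sub[OF linM linA])
  have Q_eq: "Q 1 v = - P v" "Q 2 v = N 2 v - P v" "Q 3 v = N 3 v - P v" for v
    by (simp_all add: Q_def A_def N_def)
  have Q_sym: "Q s a \<bullet> b = a \<bullet> Q s b" for s a b
    using diff_sym[where s=s and r=1 and a=a and b=b] P_sym[of a b] by (simp add: Q_def A_def inner_simps)
  have Q21: "Q 2 (J 1 v) = - J 1 (Q 2 v)" for v
    by (simp add: Q_eq P1 J_diff) (simp add: P_def J_scaleR J_diff J_J algebra_simps flip: scaleR_2)
  have Q23: "Q 2 (J 3 v) = - J 3 (Q 2 v)" for v by (simp add: Q_eq P3 N2 J_diff)
  have Q22: "Q 2 (J 2 v) = J 2 (Q 2 v)" for v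
    unfolding via13 by (simp add: Q21 Q23 J_neg)
  \<comment> \<open>\<open>Q 3\<close> is \<open>(N 3 - N 2) + Q 2\<close>, and both summands
    anticommute with \<open>J 1\<close>; so the correction \<open>P\<close> found from
    \<open>N 2\<close> also serves for \<open>N 3\<close>.\<close>
  have Q31: "Q 3 (J 1 v) = - J 1 (Q 3 v)" for v
    using N32[of v] Q21[of v] by (simp add: Q_eq J_diff algebra_simps)
  have Q32: "Q 3 (J 2 v) = - J 2 (Q 3 v)" for v by (simp add: Q_eq P2 N3 J_diff)
  have Q33: "Q 3 (J 3 v) = J 3 (Q 3 v)" for v
    using Q32[of "J 1 v"] by (simp add: Q31 J_mult J_neg)
  have Q_comm: "Q s (J r v) = (if r = s then J r (Q s v) else - J r (Q s v))" for r s v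
    using exhaust_3[of r] exhaust_3[of s] by (auto simp: Q21 Q22 Q23 Q31 Q32 Q33) (auto simp: Q_eq P1 P2 P3 J_neg)
  show ?thesis
  \<comment> \<open>\<open>Q s\<close> is symmetric and commutes with the skew map
    \<open>J s\<close>, so the product is skew. For \<open>r \<noteq> s\<close> both factors
    anticommute with \<open>J r\<close>, so the product commutes with it.\<close>
  proof (rule that[of A "\<lambda>s v. J s (Q s v)"])
    show "linear A" by (rule linA)
    show "linear (\<lambda>v. J s (Q s v))" for s using linear_compose[OF linQ linear_J] by (simp add: o_def)
    show "H s v = J s (A v) + J s (Q s v)" for s v by (simp add: HM Q_def J_diff)
    show "J s (Q s x) \<bullet> y = - (x \<bullet> J s (Q s y))" for s x y
      using inner_J[of s "Q s x" y] Q_sym[of s x "J s y"] Q_comm[of s s y] by simp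
    show "J s (Q s (J r v)) = J r (J s (Q s v))" for r s v
      using J_anticommute[of r s "Q s v"] by (simp add: Q_comm J_neg)
  qed
qed

text \<open>This is surjectivity of the antisymmetrisation from linear maps
  \<open>W \<rightarrow> EH\<close> onto alternating maps on \<open>W\<close> with values in
  \<open>V\<close>; both spaces have dimension three times that of \<open>V\<close>.\<close>

lemma alternating_from_EH:
  fixes \<beta> :: "W \<Rightarrow> W \<Rightarrow> ('n::finite) V"
  assumes \<beta>: "bilinear \<beta>" and alt: "\<And>x. \<beta> x x = 0"
  obtains u where "linear u"
    "\<And>x y. scale_right (u x) (of_imH y) - scale_right (u y) (of_imH x) = \<beta> x y"
proof -
  let ?e = "\<lambda>s. axis s 1 :: W"
  have skew: "\<beta> y x = - \<beta> x y" for x y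
  proof -
    have "\<beta> (x + y) (x + y) = \<beta> x y + \<beta> y x"
      by (simp only: bilinear_ladd[OF \<beta>] bilinear_radd[OF \<beta>]) (simp add: alt)
    from trans[OF sym[OF this] alt] have "\<beta> x y + \<beta> y x = 0" .
    then show ?thesis by (metis add.commute eq_neg_iff_add_eq_0)
  qed
  define b12 b23 b31 where "b12 = \<beta> (?e 1) (?e 2)" and "b23 = \<beta> (?e 2) (?e 3)" and "b31 = \<beta> (?e 3) (?e 1)"
  \<comment> \<open>With \<open>u1 = - J 1 S - b23\<close> and its cyclic analogues, each of the
    equations \<open>12\<close>, \<open>23\<close>, \<open>31\<close> determines \<open>S\<close>,
    and all three give this same vector.\<close>
  define S where "S = (1/2) *\<^sub>R (J 3 b12 + J 1 b23 + J 2 b31)"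
  define u1 u2 u3 where "u1 = - J 1 S - b23" and "u2 = - J 2 S - b31" and "u3 = - J 3 S - b12"
  have 12: "J 2 u1 - J 1 u2 = b12" and 23: "J 3 u2 - J 2 u3 = b23" and 31: "J 1 u3 - J 3 u1 = b31"
    unfolding u1_def u2_def u3_def S_def
    by (simp_all add: J_diff J_neg J_mult J_scaleR J_add) (simp_all add: algebra_simps flip: scaleR_2)
  have 1: "J 1 u1 = S - J 1 b23" "J 2 u2 = S - J 2 b31" "J 3 u3 = S - J 3 b12"
    by (simp_all add: u1_def u2_def u3_def J_diff J_neg J_J)
  define u where "u x = (x $ 1) *\<^sub>R u1 + (x $ 2) *\<^sub>R u2 + (x $ 3) *\<^sub>R u3" for x :: W
  show ?thesis
  proof (rule that)
    show "linear u" by (rule linearI) (simp_all add: u_def algebra_simps)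
    fix x y :: W
    have exp: "x = (x $ 1) *\<^sub>R ?e 1 + (x $ 2) *\<^sub>R ?e 2 + (x $ 3) *\<^sub>R ?e 3" for x :: W
      by (simp add: vec_eq_iff forall_3 axis_def)
    have "\<beta> x y = (x $ 1 * y $ 2 - x $ 2 * y $ 1) *\<^sub>R b12 + (x $ 2 * y $ 3 - x $ 3 * y $ 2) *\<^sub>R b23
        + (x $ 3 * y $ 1 - x $ 1 * y $ 3) *\<^sub>R b31"
      unfolding b12_def b23_def b31_def
      by (subst exp[of x], subst exp[of y], unfold bilinear_ladd[OF \<beta>] bilinear_radd[OF \<beta>] bilinear_lmul[OF \<beta>] bilinear_rmul[OF \<beta>])
        (simp add: alt skew[of "?e 2" "?e 1"] skew[of "?e 3" "?e 2"] skew[of "?e 1" "?e 3"] algebra_simps)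
    also have "\<dots> = scale_right (u x) (of_imH y) - scale_right (u y) (of_imH x)"
      unfolding 12[symmetric] 23[symmetric] 31[symmetric] scale_right_of_imH u_def sum_3
      by (simp add: J_add J_scaleR algebra_simps)
    finally show "scale_right (u x) (of_imH y) - scale_right (u y) (of_imH x) = \<beta> x y" by simp
  qed
qed

text \<open>Scalars are central, so the commutator of two infinitesimal similarities is skew. This
  disposes of the terms quadratic in \<open>\<alpha>\<close> in the Jacobi identity on
  \<open>V\<close>, \<open>V\<close>, \<open>W\<close>.\<close>

lemma conformal_commutator:
  fixes C D :: "'a::real_inner \<Rightarrow> 'a"
  assumes C: "\<And>w w'. C w \<bullet> w' + w \<bullet> C w' = k * (w \<bullet> w')" and D: "\<And>w w'. D w \<bullet> w' + w \<bullet> D w' = l * (w \<bullet> w')"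
  shows "(C (D w) - D (C w)) \<bullet> w' + w \<bullet> (C (D w') - D (C w')) = 0"
proof -
  have "C (D w) \<bullet> w' = k * (D w \<bullet> w') - D w \<bullet> C w'" "w \<bullet> C (D w') = k * (w \<bullet> D w') - C w \<bullet> D w'"
    "D (C w) \<bullet> w' = l * (C w \<bullet> w') - C w \<bullet> D w'" "w \<bullet> D (C w') = l * (w \<bullet> C w') - D w \<bullet> C w'"
    using C[of "D w" w'] C[of w "D w'"] D[of "C w" w'] D[of w "C w'"] by linarith+
  then have "(C (D w) - D (C w)) \<bullet> w' + w \<bullet> (C (D w') - D (C w'))
      = k * (D w \<bullet> w' + w \<bullet> D w') - l * (C w \<bullet> w' + w \<bullet> C w')"
    by (simp add: inner_diff_left inner_diff_right algebra_simps)
  then show ?thesis unfolding C D by simp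
qed

lemma dual_tensor_B_components:
  fixes \<alpha> :: "('n::finite) T \<Rightarrow> 'n T \<Rightarrow> 'n T"
  assumes "\<alpha> \<in> dual_tensor (lie_algebra B_group)"
  shows "snd (\<alpha> x (v, 0)) = 0"
    and "(\<lambda>(v, w). (fst (\<alpha> x (v, 0)), snd (\<alpha> x (0, w)))) \<in> lie_algebra K_group"
    and "snd (\<alpha> x (0, imH_form v v')) = imH_form (fst (\<alpha> x (v, 0))) v' + imH_form v (fst (\<alpha> x (v', 0)))"
    and "\<exists>\<mu>. \<forall>w w'. snd (\<alpha> x (0, w)) \<bullet> w' + w \<bullet> snd (\<alpha> x (0, w')) = \<mu> * (w \<bullet> w')"
    and "bilinear \<alpha>"
proof -
  have m: "\<alpha> x \<in> lie_algebra B_group" and "bilinear \<alpha>" using assms unfolding dual_tensor_def by blast+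
  then show "bilinear \<alpha>" by simp
  show "snd (\<alpha> x (v, 0)) = 0"
    and "(\<lambda>(v, w). (fst (\<alpha> x (v, 0)), snd (\<alpha> x (0, w)))) \<in> lie_algebra K_group"
    and "snd (\<alpha> x (0, imH_form v v')) = imH_form (fst (\<alpha> x (v, 0))) v' + imH_form v (fst (\<alpha> x (v', 0)))"
    and "\<exists>\<mu>. \<forall>w w'. snd (\<alpha> x (0, w)) \<bullet> w' + w \<bullet> snd (\<alpha> x (0, w')) = \<mu> * (w \<bullet> w')"
    by (rule lie_algebra_B_group[OF m])+
qed

lemma imH_form_simps:
  "imH_form 0 y = 0" "imH_form x 0 = 0" "imH_form y x = - imH_form x y"
  "imH_form (x + x') y = imH_form x y + imH_form x' y" "imH_form x (y + y') = imH_form x y + imH_form x y'"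
  "imH_form (x - x') y = imH_form x y - imH_form x' y" "imH_form x (y - y') = imH_form x y - imH_form x y'"
proof -
  interpret bounded_bilinear imH_form by (rule bounded_bilinear_imH_form)
  show "imH_form y x = - imH_form x y"
  proof -
    have "J s y \<bullet> x = - (J s x \<bullet> y)" for s using inner_J[of s x y] inner_commute[of "J s y" x] by simp
    then show ?thesis by (simp add: imH_form_def vec_eq_iff)
  qed
qed (rule bounded_bilinear.zero_left[OF bounded_bilinear_imH_form]
    bounded_bilinear.zero_right[OF bounded_bilinear_imH_form]
    bounded_bilinear.add_left[OF bounded_bilinear_imH_form]
    bounded_bilinear.add_right[OF bounded_bilinear_imH_form]
    bounded_bilinear.diff_left[OF bounded_bilinear_imH_form]
    bounded_bilinear.diff_right[OF bounded_bilinear_imH_form])+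

text \<open>\<open>\<tau>\<close> is the torsion at one point and \<open>D\<tau> a\<close> its derivative in the direction \<open>a\<close>; the last two assumptions are
  the linear conditions on \<open>\<partial>(T\<^sup>*\<otimes>\<bb>)\<close> that survive differentiation.\<close>

locale qc_torsion =
  fixes \<alpha> \<tau> :: "('n::finite) T \<Rightarrow> 'n T \<Rightarrow> 'n T" and D\<tau> :: "'n T \<Rightarrow> 'n T \<Rightarrow> 'n T \<Rightarrow> 'n T"
  assumes \<alpha>: "\<alpha> \<in> dual_tensor (lie_algebra B_group)"
    and \<tau>: "\<tau> a b = Theta0 a b + spencer \<alpha> a b"
    and cyc: "D\<tau> a b c + D\<tau> b c a + D\<tau> c a b = \<tau> a (\<tau> b c) + \<tau> b (\<tau> c a) + \<tau> c (\<tau> a b)"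
    and D_alt: "D\<tau> a c b = - D\<tau> a b c"
    and D_VV: "snd (D\<tau> a (v, 0) (v', 0)) = 0"
    and D_VW: "\<exists>\<mu>. \<forall>w w'. snd (D\<tau> a (v, 0) (0, w)) \<bullet> w' + w \<bullet> snd (D\<tau> a (v, 0) (0, w')) = \<mu> * (w \<bullet> w')"
begin

lemmas comps = dual_tensor_B_components[OF \<alpha>]

lemma \<alpha>_split: "\<alpha> x (v, w) = (fst (\<alpha> x (v, 0)) + fst (\<alpha> x (0, w)), snd (\<alpha> x (0, w)))"
proof -
  have "\<alpha> x (v, w) = \<alpha> x (v, 0) + \<alpha> x (0, w)"
    using bilinear_radd[OF comps(5), of x "(v, 0)" "(0, w)"] by simp
  then show ?thesis using comps(1) by (simp add: prod_eq_iff)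
qed

text \<open>In the \<open>W\<close>-component of \<open>cyc\<close> on two vectors of
  \<open>V\<close> and one of \<open>W\<close>, the terms not displayed here combine to an
  infinitesimal similarity of \<open>W\<close>. The symmetric part of the displayed terms must then
  be a multiple of the inner product.\<close>

lemma VVW_identity:
  "\<exists>\<kappa>. \<forall>w w'. (imH_form (fst (\<alpha> (a, 0) (0, w))) b + imH_form a (fst (\<alpha> (b, 0) (0, w)))) \<bullet> w'
    + w \<bullet> (imH_form (fst (\<alpha> (a, 0) (0, w'))) b + imH_form a (fst (\<alpha> (b, 0) (0, w')))) = \<kappa> * (w \<bullet> w')"
proof -
  define A where "A x v = fst (\<alpha> x (v, 0))" for x v
  define C where "C x w = snd (\<alpha> x (0, w))" for x w
  define h where "h v w = fst (\<alpha> (v, 0) (0, w))" for v w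
  have \<alpha>0: "\<alpha> x 0 = 0" "\<alpha> 0 x = 0" for x using bilinear_rzero[OF comps(5)] bilinear_lzero[OF comps(5)] by auto
  have C0: "C x 0 = 0" for x using \<alpha>0(1)[of x] by (simp add: C_def zero_prod_def)
  have snd_\<alpha>: "snd (\<alpha> x (v, w)) = C x w" for x v w by (subst \<alpha>_split) (simp add: C_def)
  have snd_\<tau>: "snd (\<tau> x y) = imH_form (fst x) (fst y) + C x (snd y) - C y (snd x)" for x y
    using snd_\<alpha>[of x "fst y" "snd y"] snd_\<alpha>[of y "fst x" "snd x"] by (simp add: \<tau> spencer_def Theta0_eq)
  have fst_\<tau>: "fst (\<tau> x y) = fst (\<alpha> x y) - fst (\<alpha> y x)" for x y
    by (simp add: \<tau> spencer_def Theta0_eq)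
  define L where "L w = snd (D\<tau> (a, 0) (b, 0) (0, w)) - snd (D\<tau> (b, 0) (a, 0) (0, w))" for w
  obtain \<mu>\<^sub>1 where \<mu>1: "\<And>w w'. snd (D\<tau> (a, 0) (b, 0) (0, w)) \<bullet> w' + w \<bullet> snd (D\<tau> (a, 0) (b, 0) (0, w')) = \<mu>\<^sub>1 * (w \<bullet> w')"
    using D_VW by metis
  obtain \<mu>\<^sub>2 where \<mu>2: "\<And>w w'. snd (D\<tau> (b, 0) (a, 0) (0, w)) \<bullet> w' + w \<bullet> snd (D\<tau> (b, 0) (a, 0) (0, w')) = \<mu>\<^sub>2 * (w \<bullet> w')"
    using D_VW by metis
  have L: "L w \<bullet> w' + w \<bullet> L w' = (\<mu>\<^sub>1 - \<mu>\<^sub>2) * (w \<bullet> w')" for w w'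
    unfolding L_def using \<mu>1[of w w'] \<mu>2[of w w'] by (simp add: inner_diff_left inner_diff_right algebra_simps)
  have conf: "\<exists>\<mu>. \<forall>w w'. C x w \<bullet> w' + w \<bullet> C x w' = \<mu> * (w \<bullet> w')" for x
    unfolding C_def by (rule comps(4))
  obtain \<mu>\<^sub>a where \<mu>a: "\<And>w w'. C (a, 0) w \<bullet> w' + w \<bullet> C (a, 0) w' = \<mu>\<^sub>a * (w \<bullet> w')" using conf by metis
  obtain \<mu>\<^sub>b where \<mu>b: "\<And>w w'. C (b, 0) w \<bullet> w' + w \<bullet> C (b, 0) w' = \<mu>\<^sub>b * (w \<bullet> w')" using conf by metis
  define t where "t = \<tau> (a, 0) (b, 0)"
  obtain \<mu>\<^sub>t where \<mu>t: "\<And>w w'. C t w \<bullet> w' + w \<bullet> C t w' = \<mu>\<^sub>t * (w \<bullet> w')" using conf by metis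
  let ?F = "\<lambda>w. C (a, 0) (C (b, 0) w) - C (b, 0) (C (a, 0) w)"
  \<comment> \<open>This is that component solved for the terms with \<open>h\<close>. On the right,
    \<open>L\<close> and \<open>C t\<close> are conformal and \<open>?F\<close> is skew.\<close>
  have key: "imH_form (h a w) b + imH_form a (h b w) = L w - ?F w + C t w" for w
  proof -
    \<comment> \<open>Equivariance of the form under \<open>\<alpha> (0, w)\<close> cancels the
      terms containing \<open>A (0, w)\<close>.\<close>
    have inv: "C (0, w) (imH_form a b) = imH_form (A (0, w) a) b + imH_form a (A (0, w) b)"
      unfolding C_def A_def by (rule comps(3))
    have "D\<tau> (b, 0) (0, w) (a, 0) = - D\<tau> (b, 0) (a, 0) (0, w)" by (rule D_alt)
    then have "L w = snd (D\<tau> (a, 0) (b, 0) (0, w) + D\<tau> (b, 0) (0, w) (a, 0) + D\<tau> (0, w) (a, 0) (b, 0))"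
      by (simp add: L_def D_VV)
    also have "\<dots> = snd (\<tau> (a, 0) (\<tau> (b, 0) (0, w))) + snd (\<tau> (b, 0) (\<tau> (0, w) (a, 0))) + snd (\<tau> (0, w) t)"
      unfolding cyc t_def by simp
    also have "snd (\<tau> (a, 0) (\<tau> (b, 0) (0, w))) = imH_form a (h b w - A (0, w) b) + C (a, 0) (C (b, 0) w)"
      by (simp add: snd_\<tau> fst_\<tau> C0 imH_form_simps(1,2) h_def A_def)
    also have "snd (\<tau> (b, 0) (\<tau> (0, w) (a, 0))) = imH_form b (A (0, w) a - h a w) + C (b, 0) (- C (a, 0) w)"
      by (simp add: snd_\<tau> fst_\<tau> C0 imH_form_simps(1,2) h_def A_def)
    also have "C (b, 0) (- C (a, 0) w) = - C (b, 0) (C (a, 0) w)"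
      using bilinear_rneg[OF comps(5), of "(b, 0)" "(0, C (a, 0) w)"] by (simp add: C_def)
    also have "snd (\<tau> (0, w) t) = C (0, w) (imH_form a b) - C t w"
      by (simp add: snd_\<tau> C0 imH_form_simps(1,2) t_def)
    finally show ?thesis
      unfolding inv by (simp add: imH_form_simps(3)[of b] imH_form_simps(4-7) algebra_simps)
  qed
  have "(imH_form (h a w) b + imH_form a (h b w)) \<bullet> w' + w \<bullet> (imH_form (h a w') b + imH_form a (h b w'))
      = (\<mu>\<^sub>1 - \<mu>\<^sub>2 + \<mu>\<^sub>t) * (w \<bullet> w')" for w w'
    unfolding key using L[of w w'] \<mu>t[of w w'] conformal_commutator[OF \<mu>a \<mu>b, of w w']
    by (simp add: inner_add_left inner_add_right inner_diff_left inner_diff_right algebra_simps)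
  then show ?thesis unfolding h_def by blast
qed

text \<open>The block diagonal part of \<open>\<alpha>\<close> already takes values in the Lie
  algebra of \<open>K_group\<close>. Only its part from \<open>W\<close> to \<open>V\<close> has to
  be replaced, by \<open>hypercomplex_decomposition\<close> in the directions of \<open>V\<close>
  and by \<open>alternating_from_EH\<close> in those of \<open>W\<close>.\<close>

lemma spencer_in_K:
  obtains \<alpha>' where "\<alpha>' \<in> dual_tensor (lie_algebra K_group)" "\<And>a b. spencer \<alpha> a b = spencer \<alpha>' a b"
proof -
  interpret K: linear_group "K_group :: ('n T \<Rightarrow> 'n T) set" by (rule linear_group_K)
  let ?e = "\<lambda>s. axis s 1 :: W"
  define H where "H s v = fst (\<alpha> (v, 0) (0, ?e s))" for s v
  note bil = comps(5)
  have bil': "linear (\<lambda>y. \<alpha> x y)" "linear (\<lambda>x. \<alpha> x y)" for x y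
    using bil unfolding bilinear_def by blast+
  have lin_inl: "linear (\<lambda>v. (v, 0 :: W) :: 'n T)" and lin_inr: "linear (\<lambda>w. (0, w) :: 'n T)"
    by (auto intro!: linearI)
  have lin_fst: "linear (fst :: 'n T \<Rightarrow> 'n V)" and lin_snd: "linear (snd :: 'n T \<Rightarrow> W)"
    by (auto intro!: linearI)
  have lin_H: "linear (H s)" for s
    using linear_compose[OF linear_compose[OF lin_inl bil'(2)] lin_fst] unfolding H_def o_def .
  have exp: "fst (\<alpha> (v, 0) (0, w)) = (\<Sum>s\<in>UNIV. (w $ s) *\<^sub>R H s v)" for v w
  proof -
    have l: "linear (\<lambda>w. fst (\<alpha> (v, 0) (0, w)))"
      using linear_compose[OF linear_compose[OF lin_inr bil'(1)] lin_fst] unfolding o_def .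
    have "w = (\<Sum>s\<in>UNIV. (w $ s) *\<^sub>R ?e s)" by (simp add: sum_3 vec_eq_iff forall_3 axis_def)
    then show ?thesis using linear_sum[OF l] linear_cmul[OF l] unfolding H_def by (metis (no_types, lifting) sum.cong)
  qed
  \<comment> \<open>This is \<open>VVW_identity\<close> at the basis vectors \<open>w = ?e s\<close>
    and \<open>w' = ?e r\<close>.\<close>
  have H_sym: "\<exists>\<kappa>. \<forall>r s. (J r (H s a) \<bullet> b + J r a \<bullet> H s b) + (J s (H r a) \<bullet> b + J s a \<bullet> H r b)
      = (if r = s then \<kappa> else 0)" for a b
  proof -
    have ax: "?e s $ r = (if r = s then 1 else 0)" for r s by (simp add: axis_def)
    obtain \<kappa> where \<kappa>: "\<And>w w'. (imH_form (fst (\<alpha> (a, 0) (0, w))) b + imH_form a (fst (\<alpha> (b, 0) (0, w)))) \<bullet> w'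
      + w \<bullet> (imH_form (fst (\<alpha> (a, 0) (0, w'))) b + imH_form a (fst (\<alpha> (b, 0) (0, w')))) = \<kappa> * (w \<bullet> w')"
      using VVW_identity[of a b] by metis
    have "(J r (H s a) \<bullet> b + J r a \<bullet> H s b) + (J s (H r a) \<bullet> b + J s a \<bullet> H r b)
      = (if r = s then \<kappa> else 0)" for r s
      using \<kappa>[of "?e s" "?e r"]
      by (simp add: inner_axis inner_axis' H_def[symmetric] imH_form_def inner_axis_axis ax)
    then show ?thesis by blast
  qed
  obtain A X where A: "linear A" and X: "\<And>s. linear (X s)" "\<And>s v. H s v = J s (A v) + X s v"
    "\<And>s x y. X s x \<bullet> y = - (x \<bullet> X s y)" "\<And>r s v. X s (J r v) = J r (X s v)"
    by (rule hypercomplex_decomposition[OF lin_H H_sym]) (rule that)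
  define \<beta> where "\<beta> w w' = fst (\<alpha> (0, w) (0, w')) - fst (\<alpha> (0, w') (0, w))" for w w'
  have "bilinear \<beta>"
  proof -
    have "linear (\<lambda>w'. fst (\<alpha> (0, w) (0, w')))" "linear (\<lambda>w'. fst (\<alpha> (0, w') (0, w)))" for w
      using linear_compose[OF linear_compose[OF lin_inr bil'(1)] lin_fst]
        linear_compose[OF linear_compose[OF lin_inr bil'(2)] lin_fst] unfolding o_def by blast+
    then show ?thesis unfolding \<beta>_def bilinear_def by (auto intro: linear_compose_sub)
  qed
  then obtain u where u: "linear u"
    "\<And>x y. scale_right (u x) (of_imH y) - scale_right (u y) (of_imH x) = \<beta> x y"
    using alternating_from_EH[of \<beta>] by (auto simp: \<beta>_def)
  \<comment> \<open>The parts \<open>X s\<close> pair a vector of \<open>V\<close> in the first slot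
    with one of \<open>W\<close> in the second. Exchanging the slots is invisible to
    \<open>spencer\<close> up to sign, hence the minus.\<close>
  define Z where "Z w v = (\<Sum>s\<in>UNIV. (- (w $ s)) *\<^sub>R X s v)" for w v
  \<comment> \<open>\<open>p x\<close> is the parameter of the \<open>EH\<close> part:
    \<open>A\<close> accounts for the summands \<open>J s (A v)\<close> of \<open>H s\<close>, and
    \<open>u\<close> for \<open>\<beta>\<close>.\<close>
  define p where "p x = A (fst x) + u (snd x)" for x :: "'n T"
  define \<alpha>' :: "'n T \<Rightarrow> 'n T \<Rightarrow> 'n T" where "\<alpha>' x y = (fst (\<alpha> x (fst y, 0)), snd (\<alpha> x (0, snd y)))
    + ((scale_right (p x) (of_imH (snd y)), 0) + (Z (snd x) (fst y), 0))" for x y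
  have linZ: "linear (Z w)" "linear (\<lambda>w. Z w v)" for v w
    unfolding Z_def
    by (rule linearI; simp add: linear_add[OF X(1)] linear_cmul[OF X(1)] scaleR_add_right scaleR_add_left
        scaleR_diff_left sum.distrib sum_subtractf sum_negf scaleR_sum_right mult.commute)+
  have linp: "linear p"
    unfolding p_def using linear_compose_add[OF linear_compose[OF lin_fst A] linear_compose[OF lin_snd u(1)]] by (simp add: o_def)
  have mem: "\<alpha>' x \<in> lie_algebra K_group" for x
  proof -
    have 1: "(\<lambda>y. (fst (\<alpha> x (fst y, 0)), snd (\<alpha> x (0, snd y)))) \<in> lie_algebra K_group"
      using comps(2)[of x] by (simp add: case_prod_beta')
    have 2: "(\<lambda>y. (scale_right (p x) (of_imH (snd y)), 0)) \<in> lie_algebra K_group"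
      using EH_in_lie_algebra_K[of "p x"] by (simp add: case_prod_beta')
    have 3: "(\<lambda>y. (Z (snd x) (fst y), 0)) \<in> lie_algebra K_group"
      using sp_in_lie_algebra_K[OF linZ(1), of "snd x"] X(3,4)
      by (simp add: case_prod_beta' Z_def inner_sum_left inner_sum_right sum_negf linear_sum[OF linear_J]
          J_neg J_scaleR)
    show ?thesis
      unfolding \<alpha>'_def by (rule K.lie_algebra_add[OF 1 K.lie_algebra_add[OF 2 3]])
  qed
  moreover have "linear (\<lambda>x. \<alpha>' x y)" for y
    unfolding \<alpha>'_def
    by (rule linearI)
      (simp_all add: bilinear_ladd[OF bil] bilinear_lmul[OF bil] linear_add[OF linp] linear_cmul[OF linp]
        linear_add[OF linear_scale_right] linear_cmul[OF linear_scale_right]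
        linear_add[OF linZ(2)] linear_cmul[OF linZ(2)] prod_eq_iff scaleR_add_right)
  moreover have "linear (\<alpha>' x)" for x using mem by (auto simp: lie_algebra_def)
  ultimately have "\<alpha>' \<in> dual_tensor (lie_algebra K_group)"
    by (auto simp: dual_tensor_def bilinear_def)
  moreover have "spencer \<alpha> a b = spencer \<alpha>' a b" for a b
  proof -
    obtain av aw where a: "a = (av, aw)" by (cases a)
    obtain bv bw where b: "b = (bv, bw)" by (cases b)
    have spl: "fst (\<alpha> (v, w) (0, w')) = scale_right (A v) (of_imH w') - Z w' v + fst (\<alpha> (0, w) (0, w'))" for v w w'
    proof -
      have "fst (\<alpha> (v, w) (0, w')) = fst (\<alpha> (v, 0) (0, w')) + fst (\<alpha> (0, w) (0, w'))"
        using bilinear_ladd[OF bil, of "(v, 0)" "(0, w)" "(0, w')"] by simp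
      then show ?thesis
        by (simp add: exp X(2) Z_def scale_right_of_imH scaleR_add_right sum.distrib sum_negf)
    qed
    have "fst (spencer \<alpha> a b) = fst (\<alpha> a (bv, 0)) - fst (\<alpha> b (av, 0)) + (fst (\<alpha> a (0, bw)) - fst (\<alpha> b (0, aw)))"
      unfolding spencer_def using \<alpha>_split[of a bv bw] \<alpha>_split[of b av aw] by (simp add: a b)
    also have "fst (\<alpha> a (0, bw)) - fst (\<alpha> b (0, aw)) = scale_right (A av) (of_imH bw) - scale_right (A bv) (of_imH aw)
        + Z aw bv - Z bw av + \<beta> aw bw"
      unfolding a b spl[of av aw bw] spl[of bv bw aw] \<beta>_def by simp
    also have "fst (\<alpha> a (bv, 0)) - fst (\<alpha> b (av, 0)) + (scale_right (A av) (of_imH bw) - scale_right (A bv) (of_imH aw)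
        + Z aw bv - Z bw av + \<beta> aw bw) = fst (spencer \<alpha>' a b)"
      unfolding u(2)[symmetric]
      by (simp add: spencer_def \<alpha>'_def a b p_def linear_add[OF linear_scale_right])
    finally have "fst (spencer \<alpha> a b) = fst (spencer \<alpha>' a b)" .
    moreover have "snd (spencer \<alpha> a b) = snd (spencer \<alpha>' a b)"
      using \<alpha>_split[of a bv bw] \<alpha>_split[of b av aw] by (simp add: spencer_def \<alpha>'_def a b)
    ultimately show ?thesis by (simp add: prod_eq_iff)
  qed
  ultimately show ?thesis using that by blast
qed

end

section \<open>Constancy of the intrinsic torsion\<close>

text \<open>Through this, algebraic relations satisfied by the torsion at every point pass to its
  derivative.\<close>

lemma has_derivative_constant_on_open:
  assumes "open S" "p \<in> S" "\<And>y. y \<in> S \<Longrightarrow> f y = c" "(f has_derivative f') (at p)"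
  shows "f' X = 0"
proof -
  have "((\<lambda>y. c) has_derivative f') (at p)"
    by (rule has_derivative_transform_within_open[OF assms(4,1,2,3)])
  then show ?thesis using has_derivative_unique[OF has_derivative_const] by metis
qed

text \<open>Composing a section with one constant element of the group keeps it smooth and moves its
  value at \<open>x\<close> to the prescribed frame.\<close>

lemma (in linear_group) local_section_through:
  assumes P: "G_structure A G P" and p: "(x, u) \<in> P"
  obtains U s where "x \<in> U" "local_section A P U s" "s x = u"
proof -
  obtain U s where s: "x \<in> U" "local_section A P U s"
    using P unfolding G_structure_def by blast
  have fibre: "{u'. (y, u') \<in> P} = {s y \<circ> g | g. g \<in> G}" if "y \<in> U" for y
    using P s(2) that unfolding G_structure_def local_section_def by blast
  obtain g where g: "g \<in> G" "u = s x \<circ> g" using fibre[OF s(1)] p by blast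
  have "local_section A P U (\<lambda>y. s y \<circ> g)"
    using s(2) fibre g(1) unfolding local_section_def by auto
  then show ?thesis using that[OF s(1)] g(2) by blast
qed

theorem theorem27:
  fixes A :: "('m::{t2_space, second_countable_topology}, ('n::finite) T) chart set"
    and P :: "('m \<times> ('m, 'n T) frame) set"
  assumes "smooth_atlas A"
    and "integrable_qc_K_structure A P"
  shows "\<forall>p\<in>P. intrinsic_torsion A K_group P p = coker_class K_group Theta0"
proof
  fix p assume p: "p \<in> P"
  obtain x u where xu: "p = (x, u)" by (cases p)
  interpret K: linear_group "K_group :: ('n T \<Rightarrow> 'n T) set" by (rule linear_group_K)
  interpret B: linear_group "B_group :: ('n T \<Rightarrow> 'n T) set" by (rule linear_group_B)
  have GP: "G_structure A K_group P"
    and int: "\<And>p. p \<in> P \<Longrightarrow>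
      intrinsic_torsion A B_group (extend_structure P B_group) p = coker_class B_group Theta0"
    using assms(2) by (auto simp: integrable_qc_K_structure_def)
  have PF: "P \<subseteq> Sigma UNIV (frames A)" using GP by (simp add: G_structure_def)
  obtain U s where s: "x \<in> U" "local_section A P U s" "s x = u"
    using K.local_section_through[OF GP] p xu by blast
  have sP: "(y, s y) \<in> P" if "y \<in> U" for y using s(2) that by (simp add: local_section_def)
  interpret framed_open A U s
    using assms(1) s(2) PF sP by unfold_locales (auto simp: local_section_def)
  define \<Gamma> where "\<Gamma> = flat_christoffel s"
  have fibre: "\<exists>g\<in>K_group. u' = s y \<circ> g" if "y \<in> U" "(y, u') \<in> P" for y u'
    using GP sP[OF that(1)] that(2) unfolding G_structure_def by blast
  have conK: "connection_on A K_group P U \<Gamma>"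
    unfolding \<Gamma>_def using fibre
    by (intro connection_on_flat linear_group_K) (auto simp: local_section_def)
  have conB: "connection_on A B_group (extend_structure P B_group) U \<Gamma>"
    unfolding \<Gamma>_def
  proof (rule connection_on_flat[OF linear_group_B])
    fix V s' y assume "local_section A (extend_structure P B_group) V s'" "y \<in> U" "y \<in> V"
    then obtain u' g where u': "s' y = u' \<circ> g" "(y, u') \<in> P" "g \<in> B_group"
      unfolding local_section_def extend_structure_def by blast
    obtain k where k: "k \<in> K_group" "u' = s y \<circ> k" using fibre[OF \<open>y \<in> U\<close> u'(2)] by blast
    have "s' y = s y \<circ> (k \<circ> g)" by (simp only: u'(1) k(2) o_assoc)
    moreover have "k \<circ> g \<in> B_group"
      by (rule B.comp[OF subsetD[OF K_group_subset_B_group k(1)] u'(3)])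
    ultimately show "\<exists>g\<in>B_group. s' y = s y \<circ> g" by blast
  qed
  have secB: "local_section A (extend_structure P B_group) U s"
  proof -
    have "(y, s y) \<in> extend_structure P B_group" if "y \<in> U" for y
    proof -
      have "s y = s y \<circ> id" by simp
      then show ?thesis using sP[OF that] B.id unfolding extend_structure_def by blast
    qed
    then show ?thesis using s(2) by (auto simp: local_section_def)
  qed
  \<comment> \<open>The hypothesis is used along the whole section and not only at \<open>x\<close>,
    because the resulting relations are differentiated below.\<close>
  have torB: "\<exists>\<alpha>\<in>dual_tensor (lie_algebra B_group). \<forall>a b.
      torsion A \<Gamma> (y, s y) a b = Theta0 a b + spencer \<alpha> a b" if y: "y \<in> U" for y
  proof -
    have "coker_class B_group (torsion A \<Gamma> (y, s y)) = coker_class B_group Theta0"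
      using intrinsic_torsion_eq[OF linear_group_B conB secB y y frame[OF y]] int[OF sP[OF y]] by simp
    then have "torsion A \<Gamma> (y, s y) \<in> coker_class B_group Theta0" using B.mem_coker_class by metis
    then show ?thesis unfolding coker_class_def by auto
  qed
  obtain c where c: "c \<in> A" "x \<in> fst c" by (rule chart_exists)
  let ?S = "snd c ` (U \<inter> fst c)" and ?p = "snd c x"
  have S: "open ?S" "?p \<in> ?S" using open_domain[OF c(1)] s(1) c(2) by auto
  define \<tau> where "\<tau> y = torsion A \<Gamma> (chart_inv c y, s (chart_inv c y))" for y
  have \<tau>B: "\<exists>\<alpha>\<in>dual_tensor (lie_algebra B_group). \<forall>a b. \<tau> y a b = Theta0 a b + spencer \<alpha> a b"
    if "y \<in> ?S" for y
    using torB that c(1) unfolding \<tau>_def by auto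
  define D\<tau> where "D\<tau> a b d = frechet_derivative (\<lambda>y. \<tau> y b d) (at ?p) (s x a c)" for a b d
  have d\<tau>: "((\<lambda>y. \<tau> y a b) has_derivative frechet_derivative (\<lambda>y. \<tau> y a b) (at ?p)) (at ?p)" for a b
    using flat_torsion_cyclic(1)[OF c(1) s(1) c(2)] frechet_derivative_works unfolding \<tau>_def \<Gamma>_def by blast
  obtain \<alpha> where \<alpha>: "\<alpha> \<in> dual_tensor (lie_algebra B_group)" "\<And>a b. \<tau> ?p a b = Theta0 a b + spencer \<alpha> a b"
    using \<tau>B[OF S(2)] by blast
  have "qc_torsion \<alpha> (\<tau> ?p) D\<tau>"
  proof
    show "D\<tau> a b d + D\<tau> b d a + D\<tau> d a b = \<tau> ?p a (\<tau> ?p b d) + \<tau> ?p b (\<tau> ?p d a) + \<tau> ?p d (\<tau> ?p a b)" for a b d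
      using flat_torsion_cyclic(2)[OF c(1) s(1) c(2)] unfolding D\<tau>_def \<tau>_def \<Gamma>_def by blast
    show "D\<tau> a d b = - D\<tau> a b d" for a b d
    proof -
      have "\<tau> y d b + \<tau> y b d = 0" if y: "y \<in> ?S" for y
      proof -
        obtain \<alpha> where \<alpha>: "\<And>a b. \<tau> y a b = Theta0 a b + spencer \<alpha> a b"
          using \<tau>B[OF y] by blast
        show ?thesis
          unfolding \<alpha> by (simp add: spencer_def Theta0_eq imH_form_simps(3)[where x="fst d" and y="fst b"] prod_eq_iff)
      qed
      from has_derivative_constant_on_open[OF S this has_derivative_add[OF d\<tau>[of d b] d\<tau>[of b d]]]
      show ?thesis unfolding D\<tau>_def by (simp add: eq_neg_iff_add_eq_0)
    qed
    show "snd (D\<tau> a (v, 0) (v', 0)) = 0" for a v v'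
    proof -
      \<comment> \<open>The tensor \<open>\<alpha>\<close> may vary with \<open>y\<close> in an
        uncontrolled way, but its values preserve \<open>V\<close>, so the
        \<open>W\<close>-component does not depend on \<open>y\<close>.\<close>
      have "snd (\<tau> y (v, 0) (v', 0)) = imH_form v v'" if "y \<in> ?S" for y
        using \<tau>B[OF that] dual_tensor_B_components(1) by (fastforce simp: spencer_def Theta0_eq)
      from has_derivative_constant_on_open[OF S this has_derivative_snd[OF d\<tau>]]
      show ?thesis unfolding D\<tau>_def .
    qed
    show "\<exists>\<mu>. \<forall>w w'. snd (D\<tau> a (v, 0) (0, w)) \<bullet> w' + w \<bullet> snd (D\<tau> a (v, 0) (0, w')) = \<mu> * (w \<bullet> w')" for a v
    proof -
      let ?e = "axis 1 1 :: W"
      \<comment> \<open>The factor \<open>\<mu>\<close> is obtained separately at each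
        \<open>y\<close>. Evaluation on the unit vector \<open>?e\<close> expresses it through
        \<open>\<tau>\<close>, so that the relation can be differentiated.\<close>
      have vanish: "snd (\<tau> y (v, 0) (0, w)) \<bullet> w' + w \<bullet> snd (\<tau> y (v, 0) (0, w'))
          - 2 * (snd (\<tau> y (v, 0) (0, ?e)) \<bullet> ?e) * (w \<bullet> w') = 0" if y: "y \<in> ?S" for y w w'
      proof -
        obtain \<alpha> where \<alpha>: "\<alpha> \<in> dual_tensor (lie_algebra B_group)" "\<And>a b. \<tau> y a b = Theta0 a b + spencer \<alpha> a b"
          using \<tau>B[OF y] by blast
        note comps = dual_tensor_B_components[OF \<alpha>(1)]
        have e: "snd (\<tau> y (v, 0) (0, w)) = snd (\<alpha> (v, 0) (0, w))" for w
          by (simp add: \<alpha>(2) spencer_def Theta0_eq imH_form_simps(2) comps(1))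
        obtain \<mu> where \<mu>: "\<And>w w'. snd (\<alpha> (v, 0) (0, w)) \<bullet> w' + w \<bullet> snd (\<alpha> (v, 0) (0, w')) = \<mu> * (w \<bullet> w')"
          using comps(4)[of "(v, 0)"] by blast
        show ?thesis unfolding e using \<mu>[of w w'] \<mu>[of ?e ?e] by (simp add: inner_commute inner_axis_axis)
      qed
      let ?d = "\<lambda>w X. snd (frechet_derivative (\<lambda>y. \<tau> y (v, 0) (0, w)) (at ?p) X)"
      have "snd (D\<tau> a (v, 0) (0, w)) \<bullet> w' + w \<bullet> snd (D\<tau> a (v, 0) (0, w'))
          - 2 * (snd (D\<tau> a (v, 0) (0, ?e)) \<bullet> ?e) * (w \<bullet> w') = 0" for w w'
      proof -
        have "((\<lambda>y. snd (\<tau> y (v, 0) (0, w)) \<bullet> w' + w \<bullet> snd (\<tau> y (v, 0) (0, w'))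
            - 2 * (snd (\<tau> y (v, 0) (0, ?e)) \<bullet> ?e) * (w \<bullet> w')) has_derivative
            (\<lambda>X. ?d w X \<bullet> w' + w \<bullet> ?d w' X - 2 * (?d ?e X \<bullet> ?e) * (w \<bullet> w'))) (at ?p)"
          by (intro has_derivative_diff has_derivative_add has_derivative_inner_left has_derivative_inner_right
              has_derivative_mult_left has_derivative_mult_right has_derivative_snd d\<tau>)
        from has_derivative_constant_on_open[OF S vanish this] show ?thesis unfolding D\<tau>_def .
      qed
      then show ?thesis by (metis eq_iff_diff_eq_0)
    qed
  qed (use \<alpha> in auto)
  then obtain \<alpha>' where \<alpha>': "\<alpha>' \<in> dual_tensor (lie_algebra K_group)" "\<And>a b. spencer \<alpha> a b = spencer \<alpha>' a b"
    using qc_torsion.spencer_in_K by blast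
  have "torsion A \<Gamma> (x, s x) a b = Theta0 a b + spencer \<alpha>' a b" for a b
    using \<alpha>(2)[of a b] \<alpha>'(2)[of a b] c unfolding \<tau>_def by simp
  then have "coker_class K_group (torsion A \<Gamma> (x, s x)) = coker_class K_group Theta0"
    by (rule K.coker_class_eqI[OF \<alpha>'(1)])
  then show "intrinsic_torsion A K_group P p = coker_class K_group Theta0"
    using intrinsic_torsion_eq[OF linear_group_K conK s(2) s(1) s(1) frame[OF s(1)]] s(3) xu by simp
qed

end
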